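(* A double category admits the structure of a CGW category if and only if it is an abstract CGW category.
   Context: A double category $\mathbb{D}$ has objects, horizontal morphisms (forming a category $\mathcal{H}(\mathbb{D})$), vertical morphisms (forming a category $\mathcal{V}(\mathbb{D})$ with the same objects), and squares (also called distinguished squares); a square written (top $f$; left $h$; right $k$; bottom $g$) has boundary $f\colon A\to B$, $g\colon C\to D$ horizontal and $h\colon A\to C$, $k\colon B\to D$ vertical. Squares compose horizontally and vertically, with identities, subject to unit, associativity and interchange laws. $\mathcal{H}(\mathbb{D}_v)$ is the category whose objects are vertical morphisms and whose morphisms $h\to k$ are squares with left $h$ and right $k$ (composed horizontally); $\mathcal{V}(\mathbb{D}_h)$ is the category whose objects are horizontal morphisms and whose morphisms $f\to g$ are squares with top $f$ and bottom $g$. $\mathcal{H}^\triangleleft(\mathbb{D}_h)$ is the category whose objects are horizontal morphisms and whose morphisms from $a\colon X\to Y$ to $b\colon X'\to Y'$ are commutative squares in $\mathcal{H}(\mathbb{D})$, i.e. pairs $(s\colon X\to X', t\colon Y\to Y')$ with $bs=ta$, for which $s$ is an isomorphism; $\mathcal{V}^\triangleleft(\mathbb{D}_v)$ is defined analogously from $\mathcal{V}(\mathbb{D})$. Shared isomorphism: a pair $(f,f')$ of a horizontal isomorphism $f\colon A\to B$ and a vertical isomorphism $f'\colon A\to B$ equipped with squares (top $f$; left $f'$; right $\mathrm{id}_B$; bottom $\mathrm{id}_B$), (top $\mathrm{id}_A$; left $\mathrm{id}_A$; right $f'$; bottom $f$), (top $f$; left $\mathrm{id}_A$; right $f'^{-1}$;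 bottom $\mathrm{id}_A$), (top $\mathrm{id}_A$; left $f'$; right $\mathrm{id}_A$; bottom $f^{-1}$). A CGW category is a double category $\mathbb{D}$ equipped with an identity-on-objects isomorphism $\varphi\colon\mathrm{iso}(\mathcal{H}(\mathbb{D}))\to\mathrm{iso}(\mathcal{V}(\mathbb{D}))$ of maximal subgroupoids, an equivalence of categories $k\colon\mathcal{H}(\mathbb{D}_v)\to\mathcal{H}^\triangleleft(\mathbb{D}_h)$ (kernel), and an equivalence of categories $c\colon\mathcal{V}(\mathbb{D}_h)\to\mathcal{V}^\triangleleft(\mathbb{D}_v)$ (cokernel), satisfying: (Z) there is an object $\varnothing$ initial in both $\mathcal{H}(\mathbb{D})$ and $\mathcal{V}(\mathbb{D})$; (I) for every horizontal isomorphism $f$, the pair $(f,\varphi(f))$ is a shared isomorphism; (M) every morphism in $\mathcal{H}(\mathbb{D})$ and every morphism in $\mathcal{V}(\mathbb{D})$ is a monomorphism; (K) for every vertical $g\colon A\to B$, the codomain of $k(g)\colon\ker(g)\to B$ is $B$ and there is a unique square with top $\varnothing\to A$, left $\varnothing\to\ker(g)$, right $g$, bottom $k(g)$; and for every horizontal $f\colon A\to B$, the codomain of $c(f)\colon\mathrm{coker}(f)\to B$ is $B$ and there is a unique square with top $\varnothing\to\mathrm{coker}(f)$, left $\varnothing\to A$, right $c(f)$, bottom $f$. $\mathbb{D}$ has shared isomorphisms if there are bijections $\varphi$ from horizontal isomorphisms $A\to B$ to vertical isomorphisms $A\to B$, for all objects $A,B$, such that: (a) for horizontal $f\colon A\to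 A'$, $g\colon B\to B'$ and horizontal isomorphisms $h\colon A\to B$, $k\colon A'\to B'$, one has $kf=gh$ if and only if there is a square (top $f$; left $\varphi(h)$; right $\varphi(k)$; bottom $g$), and such a square is unique relative to its boundary; (b) for vertical $u\colon A\to B$, $u'\colon A'\to B'$ and horizontal isomorphisms $h\colon A\to A'$, $k\colon B\to B'$, one has $u'\varphi(h)=\varphi(k)u$ if and only if there is a square (top $h$; left $u$; right $u'$; bottom $k$), and such a square is unique relative to its boundary. In such a double category every isomorphism belongs to a unique shared isomorphism; "isomorphism" means shared isomorphism, and an isomorphism of squares is a family of shared isomorphisms at the four corners that is natural for the horizontal morphisms, the vertical morphisms and the squares. An abstract CGW category is a double category $\mathbb{D}$ satisfying: (I') $\mathbb{D}$ has shared isomorphisms; (M) all horizontal and vertical morphisms are monic in $\mathcal{H}(\mathbb{D})$, respectively $\mathcal{V}(\mathbb{D})$; (Z) there is an object $\varnothing$ initial in both $\mathcal{H}(\mathbb{D})$ and $\mathcal{V}(\mathbb{D})$; (K') any pair consisting of a horizontal $f\colon A\to B$ and a vertical $k\colon B\to D$, and any pair consisting of a vertical $h\colon A\to C$ and a horizontal $g\colon C\to D$, extends to a square (top $f$; left $h$; right $k$; bottom $g$) that is unique up to a unique isomorphism which is the identity on the three objects of the given pair.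
   Formalization: The codomain condition in (K) is also imposed on squares: k sends a square to a commutative square whose codomain component is its bottom side, and c to one whose codomain component is its right side; with the condition only on morphisms g and f, the "only if" direction fails. *)

theory Defs
  imports Main
begin

section \<open>Categories\<close>

record ('o, 'm) cat =
  Ob :: "'o set"
  Ar :: "'m set"
  Src :: "'m \<Rightarrow> 'o"
  Tgt :: "'m \<Rightarrow> 'o"
  Ident :: "'o \<Rightarrow> 'm"
  Cmp :: "'m \<Rightarrow> 'm \<Rightarrow> 'm" (infixl "\<cdot>\<index>" 70)

definition hom :: "('o, 'm) cat \<Rightarrow> 'o \<Rightarrow> 'o \<Rightarrow> 'm set" where
  "hom C A B = {f \<in> Ar C. Src C f = A \<and> Tgt C f = B}"

definition category :: "('o, 'm) cat \<Rightarrow> bool" where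
  "category C \<longleftrightarrow>
     (\<forall>f\<in>Ar C. Src C f \<in> Ob C \<and> Tgt C f \<in> Ob C) \<and>
     (\<forall>A\<in>Ob C. Ident C A \<in> hom C A A) \<and>
     (\<forall>f\<in>Ar C. \<forall>g\<in>Ar C. Tgt C f = Src C g \<longrightarrow> g \<cdot>\<^bsub>C\<^esub> f \<in> hom C (Src C f) (Tgt C g)) \<and>
     (\<forall>f\<in>Ar C. f \<cdot>\<^bsub>C\<^esub> Ident C (Src C f) = f \<and> Ident C (Tgt C f) \<cdot>\<^bsub>C\<^esub> f = f) \<and>
     (\<forall>f\<in>Ar C. \<forall>g\<in>Ar C. \<forall>h\<in>Ar C. Tgt C f = Src C g \<longrightarrow> Tgt C g = Src C h \<longrightarrow>
        h \<cdot>\<^bsub>C\<^esub> (g \<cdot>\<^bsub>C\<^esub> f) = (h \<cdot>\<^bsub>C\<^esub> g) \<cdot>\<^bsub>C\<^esub> f)"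

definition inverse_arrows :: "('o, 'm) cat \<Rightarrow> 'm \<Rightarrow> 'm \<Rightarrow> bool" where
  "inverse_arrows C f g \<longleftrightarrow>
     f \<in> Ar C \<and> g \<in> hom C (Tgt C f) (Src C f) \<and>
     g \<cdot>\<^bsub>C\<^esub> f = Ident C (Src C f) \<and> f \<cdot>\<^bsub>C\<^esub> g = Ident C (Tgt C f)"

definition iso_arrow :: "('o, 'm) cat \<Rightarrow> 'm \<Rightarrow> bool" where
  "iso_arrow C f \<longleftrightarrow> (\<exists>g. inverse_arrows C f g)"

definition inv_arrow :: "('o, 'm) cat \<Rightarrow> 'm \<Rightarrow> 'm" where
  "inv_arrow C f = (THE g. inverse_arrows C f g)"

definition mono_arrow :: "('o, 'm) cat \<Rightarrow> 'm \<Rightarrow> bool" where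
  "mono_arrow C f \<longleftrightarrow> f \<in> Ar C \<and>
     (\<forall>g\<in>Ar C. \<forall>h\<in>Ar C. Src C g = Src C h \<longrightarrow> Tgt C g = Src C f \<longrightarrow> Tgt C h = Src C f \<longrightarrow>
        f \<cdot>\<^bsub>C\<^esub> g = f \<cdot>\<^bsub>C\<^esub> h \<longrightarrow> g = h)"

definition initial_object :: "('o, 'm) cat \<Rightarrow> 'o \<Rightarrow> bool" where
  "initial_object C z \<longleftrightarrow> z \<in> Ob C \<and> (\<forall>A\<in>Ob C. \<exists>!f. f \<in> hom C z A)"

definition from_initial :: "('o, 'm) cat \<Rightarrow> 'o \<Rightarrow> 'o \<Rightarrow> 'm" where
  "from_initial C z A = (THE f. f \<in> hom C z A)"

definition max_subgroupoid :: "('o, 'm) cat \<Rightarrow> ('o, 'm) cat" where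
  "max_subgroupoid C = C\<lparr>Ar := {f. iso_arrow C f}\<rparr>"

record ('o, 'm, 'p, 'n) functor_data =
  on_ob :: "'o \<Rightarrow> 'p"
  on_ar :: "'m \<Rightarrow> 'n"

definition is_functor ::
  "('o, 'm) cat \<Rightarrow> ('p, 'n) cat \<Rightarrow> ('o, 'm, 'p, 'n) functor_data \<Rightarrow> bool" where
  "is_functor C D F \<longleftrightarrow>
     (\<forall>A\<in>Ob C. on_ob F A \<in> Ob D) \<and>
     (\<forall>f\<in>Ar C. on_ar F f \<in> hom D (on_ob F (Src C f)) (on_ob F (Tgt C f))) \<and>
     (\<forall>A\<in>Ob C. on_ar F (Ident C A) = Ident D (on_ob F A)) \<and>
     (\<forall>f\<in>Ar C. \<forall>g\<in>Ar C. Tgt C f = Src C g \<longrightarrow>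
        on_ar F (g \<cdot>\<^bsub>C\<^esub> f) = on_ar F g \<cdot>\<^bsub>D\<^esub> on_ar F f)"

definition id_functor :: "('o, 'm, 'o, 'm) functor_data" where
  "id_functor = \<lparr>on_ob = (\<lambda>A. A), on_ar = (\<lambda>f. f)\<rparr>"

definition comp_functor ::
  "('p, 'n, 'q, 'l) functor_data \<Rightarrow> ('o, 'm, 'p, 'n) functor_data \<Rightarrow> ('o, 'm, 'q, 'l) functor_data" where
  "comp_functor G F = \<lparr>on_ob = on_ob G \<circ> on_ob F, on_ar = on_ar G \<circ> on_ar F\<rparr>"

definition category_isomorphism ::
  "('o, 'm) cat \<Rightarrow> ('p, 'n) cat \<Rightarrow> ('o, 'm, 'p, 'n) functor_data \<Rightarrow> bool" where
  "category_isomorphism C D F \<longleftrightarrow>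
     is_functor C D F \<and> bij_betw (on_ob F) (Ob C) (Ob D) \<and> bij_betw (on_ar F) (Ar C) (Ar D)"

definition natural_isomorphism ::
  "('o, 'm) cat \<Rightarrow> ('p, 'n) cat \<Rightarrow> ('o, 'm, 'p, 'n) functor_data \<Rightarrow> ('o, 'm, 'p, 'n) functor_data \<Rightarrow>
     ('o \<Rightarrow> 'n) \<Rightarrow> bool" where
  "natural_isomorphism C D F G \<eta> \<longleftrightarrow>
     (\<forall>A\<in>Ob C. iso_arrow D (\<eta> A) \<and> \<eta> A \<in> hom D (on_ob F A) (on_ob G A)) \<and>
     (\<forall>f\<in>Ar C. \<eta> (Tgt C f) \<cdot>\<^bsub>D\<^esub> on_ar F f = on_ar G f \<cdot>\<^bsub>D\<^esub> \<eta> (Src C f))"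

definition category_equivalence ::
  "('o, 'm) cat \<Rightarrow> ('p, 'n) cat \<Rightarrow> ('o, 'm, 'p, 'n) functor_data \<Rightarrow> bool" where
  "category_equivalence C D F \<longleftrightarrow>
     is_functor C D F \<and>
     (\<exists>G \<eta> \<epsilon>. is_functor D C G \<and>
        natural_isomorphism C C id_functor (comp_functor G F) \<eta> \<and>
        natural_isomorphism D D (comp_functor F G) id_functor \<epsilon>)"

text \<open>\<open>CommSq a s t b\<close> is the commutative square \<open>b \<cdot> s = t \<cdot> a\<close>, seen as a morphism
  from \<open>a\<close> to \<open>b\<close>.\<close>

datatype 'm comm_sq = CommSq (cs_src: 'm) (cs_dom: 'm) (cs_cod: 'm) (cs_tgt: 'm)

text \<open>The category of morphisms of \<open>C\<close> and commutative squares that are invertible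
  on the domains. For \<open>C\<close> the category of horizontal (vertical) morphisms of a double
  category this is \<open>\<H>\<^sup>\<triangleleft>(\<D>\<^sub>h)\<close> (\<open>\<V>\<^sup>\<triangleleft>(\<D>\<^sub>v)\<close>).\<close>

definition triangle_cat :: "('o, 'm) cat \<Rightarrow> ('m, 'm comm_sq) cat" where
  "triangle_cat C =
     \<lparr>Ob = Ar C,
      Ar = {CommSq a s t b | a s t b. a \<in> Ar C \<and> b \<in> Ar C \<and>
              s \<in> hom C (Src C a) (Src C b) \<and> t \<in> hom C (Tgt C a) (Tgt C b) \<and>
              iso_arrow C s \<and> b \<cdot>\<^bsub>C\<^esub> s = t \<cdot>\<^bsub>C\<^esub> a},
      Src = cs_src,
      Tgt = cs_tgt,
      Ident = (\<lambda>a. CommSq a (Ident C (Src C a)) (Ident C (Tgt C a)) a),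
      Cmp = (\<lambda>\<tau> \<sigma>. CommSq (cs_src \<sigma>) (cs_dom \<tau> \<cdot>\<^bsub>C\<^esub> cs_dom \<sigma>) (cs_cod \<tau> \<cdot>\<^bsub>C\<^esub> cs_cod \<sigma>) (cs_tgt \<tau>))\<rparr>"


section \<open>Double categories\<close>

text \<open>Both compositions of squares are written in the order of composition of functions:
  in \<open>sq_hcomp D \<tau> \<sigma>\<close> the square \<open>\<tau>\<close> is to the right of \<open>\<sigma>\<close>, and in
  \<open>sq_vcomp D \<tau> \<sigma>\<close> it is below \<open>\<sigma>\<close>. The square \<open>sq_hid D u\<close> is the identity of the
  vertical morphism \<open>u\<close> for horizontal composition, and \<open>sq_vid D f\<close> the identity of the
  horizontal morphism \<open>f\<close> for vertical composition.\<close>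

record ('o, 'h, 'v, 's) double_cat =
  HC :: "('o, 'h) cat"
  VC :: "('o, 'v) cat"
  Sq :: "'s set"
  sq_top :: "'s \<Rightarrow> 'h"
  sq_left :: "'s \<Rightarrow> 'v"
  sq_right :: "'s \<Rightarrow> 'v"
  sq_bottom :: "'s \<Rightarrow> 'h"
  sq_hcomp :: "'s \<Rightarrow> 's \<Rightarrow> 's"
  sq_vcomp :: "'s \<Rightarrow> 's \<Rightarrow> 's"
  sq_hid :: "'v \<Rightarrow> 's"
  sq_vid :: "'h \<Rightarrow> 's"

text \<open>The categories \<open>\<H>(\<D>\<^sub>v)\<close> and \<open>\<V>(\<D>\<^sub>h)\<close>.\<close>

definition H_Dv :: "('o, 'h, 'v, 's) double_cat \<Rightarrow> ('v, 's) cat" where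
  "H_Dv D = \<lparr>Ob = Ar (VC D), Ar = Sq D, Src = sq_left D, Tgt = sq_right D,
             Ident = sq_hid D, Cmp = sq_hcomp D\<rparr>"

definition V_Dh :: "('o, 'h, 'v, 's) double_cat \<Rightarrow> ('h, 's) cat" where
  "V_Dh D = \<lparr>Ob = Ar (HC D), Ar = Sq D, Src = sq_top D, Tgt = sq_bottom D,
             Ident = sq_vid D, Cmp = sq_vcomp D\<rparr>"

definition double_category :: "('o, 'h, 'v, 's) double_cat \<Rightarrow> bool" where
  "double_category D \<longleftrightarrow>
     category (HC D) \<and> category (VC D) \<and> Ob (HC D) = Ob (VC D) \<and>
     category (H_Dv D) \<and> category (V_Dh D) \<and>
     (\<forall>\<sigma>\<in>Sq D.
        Src (HC D) (sq_top D \<sigma>) = Src (VC D) (sq_left D \<sigma>) \<and>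
        Tgt (HC D) (sq_top D \<sigma>) = Src (VC D) (sq_right D \<sigma>) \<and>
        Src (HC D) (sq_bottom D \<sigma>) = Tgt (VC D) (sq_left D \<sigma>) \<and>
        Tgt (HC D) (sq_bottom D \<sigma>) = Tgt (VC D) (sq_right D \<sigma>)) \<and>
     (\<forall>\<sigma>\<in>Sq D. \<forall>\<tau>\<in>Sq D. sq_right D \<sigma> = sq_left D \<tau> \<longrightarrow>
        sq_top D (sq_hcomp D \<tau> \<sigma>) = sq_top D \<tau> \<cdot>\<^bsub>HC D\<^esub> sq_top D \<sigma> \<and>
        sq_bottom D (sq_hcomp D \<tau> \<sigma>) = sq_bottom D \<tau> \<cdot>\<^bsub>HC D\<^esub> sq_bottom D \<sigma>) \<and>
     (\<forall>\<sigma>\<in>Sq D. \<forall>\<tau>\<in>Sq D. sq_bottom D \<sigma> = sq_top D \<tau> \<longrightarrow>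
        sq_left D (sq_vcomp D \<tau> \<sigma>) = sq_left D \<tau> \<cdot>\<^bsub>VC D\<^esub> sq_left D \<sigma> \<and>
        sq_right D (sq_vcomp D \<tau> \<sigma>) = sq_right D \<tau> \<cdot>\<^bsub>VC D\<^esub> sq_right D \<sigma>) \<and>
     (\<forall>u\<in>Ar (VC D).
        sq_top D (sq_hid D u) = Ident (HC D) (Src (VC D) u) \<and>
        sq_bottom D (sq_hid D u) = Ident (HC D) (Tgt (VC D) u)) \<and>
     (\<forall>f\<in>Ar (HC D).
        sq_left D (sq_vid D f) = Ident (VC D) (Src (HC D) f) \<and>
        sq_right D (sq_vid D f) = Ident (VC D) (Tgt (HC D) f)) \<and>
     (\<forall>A\<in>Ob (HC D). sq_hid D (Ident (VC D) A) = sq_vid D (Ident (HC D) A)) \<and>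
     (\<forall>u\<in>Ar (VC D). \<forall>w\<in>Ar (VC D). Tgt (VC D) u = Src (VC D) w \<longrightarrow>
        sq_hid D (w \<cdot>\<^bsub>VC D\<^esub> u) = sq_vcomp D (sq_hid D w) (sq_hid D u)) \<and>
     (\<forall>f\<in>Ar (HC D). \<forall>g\<in>Ar (HC D). Tgt (HC D) f = Src (HC D) g \<longrightarrow>
        sq_vid D (g \<cdot>\<^bsub>HC D\<^esub> f) = sq_hcomp D (sq_vid D g) (sq_vid D f)) \<and>
     (\<forall>\<alpha>\<in>Sq D. \<forall>\<beta>\<in>Sq D. \<forall>\<gamma>\<in>Sq D. \<forall>\<delta>\<in>Sq D.
        sq_right D \<alpha> = sq_left D \<beta> \<longrightarrow> sq_right D \<gamma> = sq_left D \<delta> \<longrightarrow>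
        sq_bottom D \<alpha> = sq_top D \<gamma> \<longrightarrow> sq_bottom D \<beta> = sq_top D \<delta> \<longrightarrow>
        sq_vcomp D (sq_hcomp D \<delta> \<gamma>) (sq_hcomp D \<beta> \<alpha>) =
        sq_hcomp D (sq_vcomp D \<delta> \<beta>) (sq_vcomp D \<gamma> \<alpha>))"

text \<open>The arguments are the top, left, right and bottom sides, in this order.\<close>

definition is_square :: "('o, 'h, 'v, 's) double_cat \<Rightarrow> 's \<Rightarrow> 'h \<Rightarrow> 'v \<Rightarrow> 'v \<Rightarrow> 'h \<Rightarrow> bool" where
  "is_square D \<sigma> f h k g \<longleftrightarrow>
     \<sigma> \<in> Sq D \<and> sq_top D \<sigma> = f \<and> sq_left D \<sigma> = h \<and> sq_right D \<sigma> = k \<and> sq_bottom D \<sigma> = g"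

definition shared_iso :: "('o, 'h, 'v, 's) double_cat \<Rightarrow> 'o \<Rightarrow> 'o \<Rightarrow> 'h \<times> 'v \<Rightarrow> bool" where
  "shared_iso D A B = (\<lambda>(f, f').
     f \<in> hom (HC D) A B \<and> iso_arrow (HC D) f \<and>
     f' \<in> hom (VC D) A B \<and> iso_arrow (VC D) f' \<and>
     (\<exists>\<sigma>. is_square D \<sigma> f f' (Ident (VC D) B) (Ident (HC D) B)) \<and>
     (\<exists>\<sigma>. is_square D \<sigma> (Ident (HC D) A) (Ident (VC D) A) f' f) \<and>
     (\<exists>\<sigma>. is_square D \<sigma> f (Ident (VC D) A) (inv_arrow (VC D) f') (Ident (HC D) A)) \<and>
     (\<exists>\<sigma>. is_square D \<sigma> (Ident (HC D) A) f' (Ident (VC D) A) (inv_arrow (HC D) f)))"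

definition id_shared :: "('o, 'h, 'v, 's) double_cat \<Rightarrow> 'o \<Rightarrow> 'h \<times> 'v" where
  "id_shared D A = (Ident (HC D) A, Ident (VC D) A)"

text \<open>\<open>square_iso D \<sigma> \<tau> a b c d\<close>: the shared isomorphisms \<open>a\<close>, \<open>b\<close>, \<open>c\<close>, \<open>d\<close> at the upper
  left, upper right, lower left and lower right corners form an isomorphism from the square
  \<open>\<sigma>\<close> to the square \<open>\<tau>\<close>. Naturality for the squares says that the cubes
  with faces \<open>\<sigma>\<close> and \<open>\<tau>\<close> commute, both when the connecting isomorphisms are drawn
  horizontally and when they are drawn vertically. In the presence of shared isomorphisms the
  side faces \<open>\<gamma>\<close>, \<open>\<rho>\<close>, \<open>\<alpha>\<close>, \<open>\<beta>\<close> of these cubes are determined by their boundaries.\<close>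

definition square_iso ::
  "('o, 'h, 'v, 's) double_cat \<Rightarrow> 's \<Rightarrow> 's \<Rightarrow> 'h \<times> 'v \<Rightarrow> 'h \<times> 'v \<Rightarrow> 'h \<times> 'v \<Rightarrow> 'h \<times> 'v \<Rightarrow> bool" where
  "square_iso D \<sigma> \<tau> a b c d \<longleftrightarrow>
     \<sigma> \<in> Sq D \<and> \<tau> \<in> Sq D \<and>
     shared_iso D (Src (HC D) (sq_top D \<sigma>)) (Src (HC D) (sq_top D \<tau>)) a \<and>
     shared_iso D (Tgt (HC D) (sq_top D \<sigma>)) (Tgt (HC D) (sq_top D \<tau>)) b \<and>
     shared_iso D (Src (HC D) (sq_bottom D \<sigma>)) (Src (HC D) (sq_bottom D \<tau>)) c \<and>
     shared_iso D (Tgt (HC D) (sq_bottom D \<sigma>)) (Tgt (HC D) (sq_bottom D \<tau>)) d \<and>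
     sq_top D \<tau> \<cdot>\<^bsub>HC D\<^esub> fst a = fst b \<cdot>\<^bsub>HC D\<^esub> sq_top D \<sigma> \<and>
     sq_bottom D \<tau> \<cdot>\<^bsub>HC D\<^esub> fst c = fst d \<cdot>\<^bsub>HC D\<^esub> sq_bottom D \<sigma> \<and>
     sq_left D \<tau> \<cdot>\<^bsub>VC D\<^esub> snd a = snd c \<cdot>\<^bsub>VC D\<^esub> sq_left D \<sigma> \<and>
     sq_right D \<tau> \<cdot>\<^bsub>VC D\<^esub> snd b = snd d \<cdot>\<^bsub>VC D\<^esub> sq_right D \<sigma> \<and>
     (\<exists>\<gamma> \<rho>. is_square D \<gamma> (fst a) (sq_left D \<sigma>) (sq_left D \<tau>) (fst c) \<and>
             is_square D \<rho> (fst b) (sq_right D \<sigma>) (sq_right D \<tau>) (fst d) \<and>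
             sq_hcomp D \<tau> \<gamma> = sq_hcomp D \<rho> \<sigma>) \<and>
     (\<exists>\<alpha> \<beta>. is_square D \<alpha> (sq_top D \<sigma>) (snd a) (snd b) (sq_top D \<tau>) \<and>
             is_square D \<beta> (sq_bottom D \<sigma>) (snd c) (snd d) (sq_bottom D \<tau>) \<and>
             sq_vcomp D \<tau> \<alpha> = sq_vcomp D \<beta> \<sigma>)"


section \<open>CGW categories\<close>

definition all_mono :: "('o, 'h, 'v, 's) double_cat \<Rightarrow> bool" where
  "all_mono D \<longleftrightarrow>
     (\<forall>f\<in>Ar (HC D). mono_arrow (HC D) f) \<and> (\<forall>u\<in>Ar (VC D). mono_arrow (VC D) u)"

definition double_initial :: "('o, 'h, 'v, 's) double_cat \<Rightarrow> 'o \<Rightarrow> bool" where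
  "double_initial D z \<longleftrightarrow> initial_object (HC D) z \<and> initial_object (VC D) z"

text \<open>The requirement that \<open>k(g)\<close> has the same codomain as \<open>g\<close> is read functorially, for the
  objects and for the morphisms of \<open>\<H>(\<D>\<^sub>v)\<close>: a square with bottom side \<open>b\<close> is sent to a
  commutative square whose component on codomains is \<open>b\<close> itself. Dually, \<open>c\<close> sends a square
  with right side \<open>r\<close> to a commutative square whose component on codomains is \<open>r\<close>. With the
  requirement on objects only, squares need not be determined by their boundaries.\<close>

definition kernel_axiom ::
  "('o, 'h, 'v, 's) double_cat \<Rightarrow> 'o \<Rightarrow> ('v, 's, 'h, 'h comm_sq) functor_data \<Rightarrow> bool" where
  "kernel_axiom D z k \<longleftrightarrow>
     (\<forall>g\<in>Ar (VC D).
        Tgt (HC D) (on_ob k g) = Tgt (VC D) g \<and>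
        (\<exists>!\<sigma>. is_square D \<sigma>
           (from_initial (HC D) z (Src (VC D) g))
           (from_initial (VC D) z (Src (HC D) (on_ob k g)))
           g
           (on_ob k g))) \<and>
     (\<forall>\<sigma>\<in>Sq D. cs_cod (on_ar k \<sigma>) = sq_bottom D \<sigma>)"

definition cokernel_axiom ::
  "('o, 'h, 'v, 's) double_cat \<Rightarrow> 'o \<Rightarrow> ('h, 's, 'v, 'v comm_sq) functor_data \<Rightarrow> bool" where
  "cokernel_axiom D z c \<longleftrightarrow>
     (\<forall>f\<in>Ar (HC D).
        Tgt (VC D) (on_ob c f) = Tgt (HC D) f \<and>
        (\<exists>!\<sigma>. is_square D \<sigma>
           (from_initial (HC D) z (Src (VC D) (on_ob c f)))
           (from_initial (VC D) z (Src (HC D) f))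
           (on_ob c f)
           f)) \<and>
     (\<forall>\<sigma>\<in>Sq D. cs_cod (on_ar c \<sigma>) = sq_right D \<sigma>)"

definition cgw_structure ::
  "('o, 'h, 'v, 's) double_cat \<Rightarrow> ('h \<Rightarrow> 'v) \<Rightarrow>
     ('v, 's, 'h, 'h comm_sq) functor_data \<Rightarrow> ('h, 's, 'v, 'v comm_sq) functor_data \<Rightarrow> bool" where
  "cgw_structure D \<phi> k c \<longleftrightarrow>
     category_isomorphism (max_subgroupoid (HC D)) (max_subgroupoid (VC D))
       \<lparr>on_ob = (\<lambda>A. A), on_ar = \<phi>\<rparr> \<and>
     category_equivalence (H_Dv D) (triangle_cat (HC D)) k \<and>
     category_equivalence (V_Dh D) (triangle_cat (VC D)) c \<and>
     (\<forall>f. iso_arrow (HC D) f \<longrightarrow> shared_iso D (Src (HC D) f) (Tgt (HC D) f) (f, \<phi> f)) \<and>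
     all_mono D \<and>
     (\<exists>z. double_initial D z \<and> kernel_axiom D z k \<and> cokernel_axiom D z c)"


section \<open>Abstract CGW categories\<close>

definition shared_iso_bijection :: "('o, 'h, 'v, 's) double_cat \<Rightarrow> ('h \<Rightarrow> 'v) \<Rightarrow> bool" where
  "shared_iso_bijection D \<phi> \<longleftrightarrow>
     (\<forall>A\<in>Ob (HC D). \<forall>B\<in>Ob (HC D).
        bij_betw \<phi> {f \<in> hom (HC D) A B. iso_arrow (HC D) f}
                   {u \<in> hom (VC D) A B. iso_arrow (VC D) u}) \<and>
     (\<forall>f g h k. f \<in> Ar (HC D) \<longrightarrow> g \<in> Ar (HC D) \<longrightarrow>
        h \<in> hom (HC D) (Src (HC D) f) (Src (HC D) g) \<longrightarrow> iso_arrow (HC D) h \<longrightarrow>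
        k \<in> hom (HC D) (Tgt (HC D) f) (Tgt (HC D) g) \<longrightarrow> iso_arrow (HC D) k \<longrightarrow>
        (k \<cdot>\<^bsub>HC D\<^esub> f = g \<cdot>\<^bsub>HC D\<^esub> h \<longleftrightarrow> (\<exists>\<sigma>. is_square D \<sigma> f (\<phi> h) (\<phi> k) g)) \<and>
        (\<forall>\<sigma> \<tau>. is_square D \<sigma> f (\<phi> h) (\<phi> k) g \<longrightarrow> is_square D \<tau> f (\<phi> h) (\<phi> k) g \<longrightarrow> \<sigma> = \<tau>)) \<and>
     (\<forall>u u' h k. u \<in> Ar (VC D) \<longrightarrow> u' \<in> Ar (VC D) \<longrightarrow>
        h \<in> hom (HC D) (Src (VC D) u) (Src (VC D) u') \<longrightarrow> iso_arrow (HC D) h \<longrightarrow>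
        k \<in> hom (HC D) (Tgt (VC D) u) (Tgt (VC D) u') \<longrightarrow> iso_arrow (HC D) k \<longrightarrow>
        (u' \<cdot>\<^bsub>VC D\<^esub> \<phi> h = \<phi> k \<cdot>\<^bsub>VC D\<^esub> u \<longleftrightarrow> (\<exists>\<sigma>. is_square D \<sigma> h u u' k)) \<and>
        (\<forall>\<sigma> \<tau>. is_square D \<sigma> h u u' k \<longrightarrow> is_square D \<tau> h u u' k \<longrightarrow> \<sigma> = \<tau>))"

definition has_shared_isos :: "('o, 'h, 'v, 's) double_cat \<Rightarrow> bool" where
  "has_shared_isos D \<longleftrightarrow> (\<exists>\<phi>. shared_iso_bijection D \<phi>)"

definition extends_top_right :: "('o, 'h, 'v, 's) double_cat \<Rightarrow> bool" where
  "extends_top_right D \<longleftrightarrow>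
     (\<forall>f\<in>Ar (HC D). \<forall>k\<in>Ar (VC D). Tgt (HC D) f = Src (VC D) k \<longrightarrow>
        (\<exists>\<sigma>\<in>Sq D. sq_top D \<sigma> = f \<and> sq_right D \<sigma> = k) \<and>
        (\<forall>\<sigma>\<in>Sq D. \<forall>\<tau>\<in>Sq D.
           sq_top D \<sigma> = f \<longrightarrow> sq_right D \<sigma> = k \<longrightarrow> sq_top D \<tau> = f \<longrightarrow> sq_right D \<tau> = k \<longrightarrow>
           (\<exists>!\<theta>. square_iso D \<sigma> \<tau> (id_shared D (Src (HC D) f)) (id_shared D (Tgt (HC D) f))
                    \<theta> (id_shared D (Tgt (VC D) k)))))"

definition extends_left_bottom :: "('o, 'h, 'v, 's) double_cat \<Rightarrow> bool" where
  "extends_left_bottom D \<longleftrightarrow>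
     (\<forall>h\<in>Ar (VC D). \<forall>g\<in>Ar (HC D). Tgt (VC D) h = Src (HC D) g \<longrightarrow>
        (\<exists>\<sigma>\<in>Sq D. sq_left D \<sigma> = h \<and> sq_bottom D \<sigma> = g) \<and>
        (\<forall>\<sigma>\<in>Sq D. \<forall>\<tau>\<in>Sq D.
           sq_left D \<sigma> = h \<longrightarrow> sq_bottom D \<sigma> = g \<longrightarrow> sq_left D \<tau> = h \<longrightarrow> sq_bottom D \<tau> = g \<longrightarrow>
           (\<exists>!\<theta>. square_iso D \<sigma> \<tau> (id_shared D (Src (VC D) h)) \<theta>
                    (id_shared D (Src (HC D) g)) (id_shared D (Tgt (HC D) g)))))"

definition abstract_cgw :: "('o, 'h, 'v, 's) double_cat \<Rightarrow> bool" where
  "abstract_cgw D \<longleftrightarrow>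
     has_shared_isos D \<and> all_mono D \<and> (\<exists>z. double_initial D z) \<and>
     extends_top_right D \<and> extends_left_bottom D"

end

theory Submission
  imports Defs
begin

text \<open>In a CGW category the kernel functor is faithful and keeps the bottom side of a square as
  the component on codomains, and all morphisms are monic; hence a square is determined by its left,
  right and bottom sides, and dually by its top, right and bottom sides. Pasting the squares of a
  shared isomorphism next to a given square reduces the conditions on shared isomorphisms to squares
  with identity vertical sides, which are identities by this uniqueness. A square with top \<open>f\<close> and
  right side \<open>w\<close> is found by writing the vertical morphism \<open>w \<cdot> c(f)\<close> as a cokernel.

  Conversely, in an abstract CGW category the kernel of \<open>w : A \<rightarrow> B\<close> is the bottom side of a square
  with top \<open>\<emptyset> \<rightarrow> A\<close> and right side \<open>w\<close>; its action on squares comes from the uniqueness of such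
  squares up to isomorphism, and completing the left and bottom sides to a square gives fullness and
  essential surjectivity. Both directions need only one half of the argument, since the notions are
  invariant under exchanging horizontal and vertical morphisms.\<close>

section \<open>Categories and equivalences\<close>

text \<open>What ties extensions of squares to cokernels: \<open>c\<close> sends a square with top
  \<open>f\<close>, right side \<open>w\<close> and bottom \<open>g\<close> to an equation c(g) s =
  w c(f) with \<open>s\<close> invertible, and fullness turns such equations back into squares. A
  possible bottom side is therefore a horizontal morphism whose cokernel is w c(f) up to an
  isomorphism of domains. Essential surjectivity yields one, and two of them are compared through
  their isomorphisms \<open>s\<close>. But essential surjectivity fixes the codomain only up to
  isomorphism too; this is why the shared isomorphisms are settled before the extensions: they allow
  that error to be composed away horizontally.

  The obstacle in the converse is fullness: completing given left and bottom sides does not produce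
  a prescribed right side. Pasting kernel squares on the left makes the obtained and the prescribed
  right side belong to squares with the same left and bottom sides, and such squares differ by an
  isomorphism.

  Transposition has a cost of its own: \<open>\<phi>\<close> runs from horizontal to vertical
  isomorphisms, so its inverse has to inherit all the properties.\<close>

lemma in_hom: "f \<in> hom C A B \<longleftrightarrow> f \<in> Ar C \<and> Src C f = A \<and> Tgt C f = B"
  by (auto simp: hom_def)

lemma in_hom_self: "f \<in> Ar C \<Longrightarrow> f \<in> hom C (Src C f) (Tgt C f)"
  by (simp add: in_hom)

lemma mono_cancel:
  "\<lbrakk>mono_arrow C m; m \<in> hom C B E; f \<in> hom C A B; g \<in> hom C A B; m \<cdot>\<^bsub>C\<^esub> f = m \<cdot>\<^bsub>C\<^esub> g\<rbrakk> \<Longrightarrow> f = g"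
  unfolding mono_arrow_def in_hom by metis

locale category_on =
  fixes C :: "('o, 'm) cat"
  assumes category: "category C"
begin

lemma hom_ob: "f \<in> hom C A B \<Longrightarrow> A \<in> Ob C \<and> B \<in> Ob C"
  using category unfolding category_def in_hom by blast

lemma ar_ob: "f \<in> Ar C \<Longrightarrow> Src C f \<in> Ob C \<and> Tgt C f \<in> Ob C"
  using category unfolding category_def by blast

lemma ident_hom: "A \<in> Ob C \<Longrightarrow> Ident C A \<in> hom C A A"
  using category unfolding category_def by blast

lemma cmp_hom: "\<lbrakk>f \<in> hom C A B; g \<in> hom C B E\<rbrakk> \<Longrightarrow> g \<cdot>\<^bsub>C\<^esub> f \<in> hom C A E"
  using category unfolding category_def in_hom by metis

lemma ident_left: "f \<in> hom C A B \<Longrightarrow> Ident C B \<cdot>\<^bsub>C\<^esub> f = f"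
  using category unfolding category_def in_hom by metis

lemma ident_right: "f \<in> hom C A B \<Longrightarrow> f \<cdot>\<^bsub>C\<^esub> Ident C A = f"
  using category unfolding category_def in_hom by metis

lemma assoc:
  "\<lbrakk>f \<in> hom C A B; g \<in> hom C B E; h \<in> hom C E F\<rbrakk> \<Longrightarrow> (h \<cdot>\<^bsub>C\<^esub> g) \<cdot>\<^bsub>C\<^esub> f = h \<cdot>\<^bsub>C\<^esub> (g \<cdot>\<^bsub>C\<^esub> f)"
  using category unfolding category_def in_hom by metis

lemma inverse_arrows_unique:
  assumes "inverse_arrows C f g" "inverse_arrows C f g'"
  shows "g = g'"
proof -
  let ?A = "Src C f" and ?B = "Tgt C f"
  have h: "f \<in> hom C ?A ?B" "g \<in> hom C ?B ?A" "g' \<in> hom C ?B ?A"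
    using assms by (auto simp: inverse_arrows_def in_hom)
  have "g = g \<cdot>\<^bsub>C\<^esub> (f \<cdot>\<^bsub>C\<^esub> g')"
    using assms ident_right[OF h(2)] by (simp add: inverse_arrows_def)
  also have "\<dots> = (g \<cdot>\<^bsub>C\<^esub> f) \<cdot>\<^bsub>C\<^esub> g'"
    using assoc h by metis
  also have "\<dots> = g'"
    using assms ident_left[OF h(3)] by (simp add: inverse_arrows_def)
  finally show ?thesis .
qed

lemma inverse_arrows_inv: "iso_arrow C f \<Longrightarrow> inverse_arrows C f (inv_arrow C f)"
  unfolding iso_arrow_def inv_arrow_def by (metis inverse_arrows_unique theI)

lemma inv_arrow_eqI: "inverse_arrows C f g \<Longrightarrow> inv_arrow C f = g"
  using inverse_arrows_inv inverse_arrows_unique iso_arrow_def by metis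

lemma iso_ar: "iso_arrow C f \<Longrightarrow> f \<in> Ar C"
  by (auto simp: iso_arrow_def inverse_arrows_def)

lemma isoI:
  assumes "f \<in> hom C A B" "g \<in> hom C B A" "g \<cdot>\<^bsub>C\<^esub> f = Ident C A" "f \<cdot>\<^bsub>C\<^esub> g = Ident C B"
  shows "iso_arrow C f" "inv_arrow C f = g"
proof -
  have "inverse_arrows C f g"
    using assms by (auto simp: inverse_arrows_def in_hom)
  then show "iso_arrow C f" "inv_arrow C f = g"
    using iso_arrow_def inv_arrow_eqI by metis+
qed

context
  fixes f A B
  assumes f: "iso_arrow C f" "f \<in> hom C A B"
begin

lemma inv_hom: "inv_arrow C f \<in> hom C B A"
  using inverse_arrows_inv[OF f(1)] f(2) by (auto simp: inverse_arrows_def in_hom)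

lemma inv_left: "inv_arrow C f \<cdot>\<^bsub>C\<^esub> f = Ident C A"
  using inverse_arrows_inv[OF f(1)] f(2) by (auto simp: inverse_arrows_def in_hom)

lemma inv_right: "f \<cdot>\<^bsub>C\<^esub> inv_arrow C f = Ident C B"
  using inverse_arrows_inv[OF f(1)] f(2) by (auto simp: inverse_arrows_def in_hom)

lemma inv_iso: "iso_arrow C (inv_arrow C f)"
  using isoI(1)[OF inv_hom f(2) inv_right inv_left] .

lemma inv_left_cancel: "g \<in> hom C X A \<Longrightarrow> inv_arrow C f \<cdot>\<^bsub>C\<^esub> (f \<cdot>\<^bsub>C\<^esub> g) = g"
  using assoc[OF _ f(2) inv_hom] inv_left ident_left by metis

lemma inv_left_cancel': "g \<in> hom C X B \<Longrightarrow> f \<cdot>\<^bsub>C\<^esub> (inv_arrow C f \<cdot>\<^bsub>C\<^esub> g) = g"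
  using assoc[OF _ inv_hom f(2)] inv_right ident_left by metis

lemma inv_right_cancel: "g \<in> hom C A X \<Longrightarrow> (g \<cdot>\<^bsub>C\<^esub> inv_arrow C f) \<cdot>\<^bsub>C\<^esub> f = g"
  using assoc[OF f(2) inv_hom] inv_left ident_right by metis

lemma inv_right_cancel': "g \<in> hom C B X \<Longrightarrow> (g \<cdot>\<^bsub>C\<^esub> f) \<cdot>\<^bsub>C\<^esub> inv_arrow C f = g"
  using assoc[OF inv_hom f(2)] inv_right ident_right by metis

lemma iso_cancel_left: "\<lbrakk>g \<in> hom C X A; g' \<in> hom C X A; f \<cdot>\<^bsub>C\<^esub> g = f \<cdot>\<^bsub>C\<^esub> g'\<rbrakk> \<Longrightarrow> g = g'"
  using inv_left_cancel by metis

lemma iso_cancel_right: "\<lbrakk>g \<in> hom C B X; g' \<in> hom C B X; g \<cdot>\<^bsub>C\<^esub> f = g' \<cdot>\<^bsub>C\<^esub> f\<rbrakk> \<Longrightarrow> g = g'"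
  using inv_right_cancel' by metis

end

lemma ident_iso: "A \<in> Ob C \<Longrightarrow> iso_arrow C (Ident C A)"
  using isoI[OF ident_hom ident_hom] ident_left[OF ident_hom] by blast

lemma cmp_iso:
  assumes f: "f \<in> hom C A B" "iso_arrow C f" and g: "g \<in> hom C B E" "iso_arrow C g"
  shows "iso_arrow C (g \<cdot>\<^bsub>C\<^esub> f)"
proof (rule isoI(1))
  let ?f = "inv_arrow C f" and ?g = "inv_arrow C g"
  note i = inv_hom[OF f(2,1)] inv_hom[OF g(2,1)]
  show "g \<cdot>\<^bsub>C\<^esub> f \<in> hom C A E" "?f \<cdot>\<^bsub>C\<^esub> ?g \<in> hom C E A"
    using cmp_hom f g i by blast+
  show "?f \<cdot>\<^bsub>C\<^esub> ?g \<cdot>\<^bsub>C\<^esub> (g \<cdot>\<^bsub>C\<^esub> f) = Ident C A"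
    using assoc[OF cmp_hom[OF f(1) g(1)] i(2) i(1)] inv_left_cancel[OF g(2,1) f(1)]
      inv_left[OF f(2,1)] by simp
  show "g \<cdot>\<^bsub>C\<^esub> f \<cdot>\<^bsub>C\<^esub> (?f \<cdot>\<^bsub>C\<^esub> ?g) = Ident C E"
    using assoc[OF cmp_hom[OF i(2) i(1)] f(1) g(1)] inv_left_cancel'[OF f(2,1) i(2)]
      inv_right[OF g(2,1)] by simp
qed

lemma initial_unique:
  "\<lbrakk>initial_object C z; f \<in> hom C z A; g \<in> hom C z A\<rbrakk> \<Longrightarrow> f = g"
  using hom_ob unfolding initial_object_def by blast

lemma from_initial_hom: "\<lbrakk>initial_object C z; A \<in> Ob C\<rbrakk> \<Longrightarrow> from_initial C z A \<in> hom C z A"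
  unfolding initial_object_def from_initial_def by (metis theI')

lemma from_initial_eq: "\<lbrakk>initial_object C z; f \<in> hom C z A\<rbrakk> \<Longrightarrow> from_initial C z A = f"
  using initial_unique from_initial_hom hom_ob by metis

end

section \<open>Functors, and equivalences as full, faithful and essentially surjective
  functors\<close>

lemma functor_hom:
  "\<lbrakk>is_functor C D F; f \<in> hom C A B\<rbrakk> \<Longrightarrow> on_ar F f \<in> hom D (on_ob F A) (on_ob F B)"
  unfolding is_functor_def in_hom by metis

lemma functor_ident:
  "\<lbrakk>is_functor C D F; A \<in> Ob C\<rbrakk> \<Longrightarrow> on_ar F (Ident C A) = Ident D (on_ob F A)"
  unfolding is_functor_def by metis

lemma functor_ob: "\<lbrakk>is_functor C D F; A \<in> Ob C\<rbrakk> \<Longrightarrow> on_ob F A \<in> Ob D"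
  unfolding is_functor_def by metis

lemma functor_cmp:
  "\<lbrakk>is_functor C D F; f \<in> hom C A B; g \<in> hom C B E\<rbrakk> \<Longrightarrow>
     on_ar F (g \<cdot>\<^bsub>C\<^esub> f) = on_ar F g \<cdot>\<^bsub>D\<^esub> on_ar F f"
  unfolding is_functor_def in_hom by metis

lemma natural_isomorphismD:
  assumes "natural_isomorphism C D F G \<eta>"
  shows "A \<in> Ob C \<Longrightarrow> iso_arrow D (\<eta> A)" "A \<in> Ob C \<Longrightarrow> \<eta> A \<in> hom D (on_ob F A) (on_ob G A)"
    "f \<in> hom C A B \<Longrightarrow> \<eta> B \<cdot>\<^bsub>D\<^esub> on_ar F f = on_ar G f \<cdot>\<^bsub>D\<^esub> \<eta> A"
  using assms unfolding natural_isomorphism_def in_hom by blast+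

locale equivalence_of =
  C: category_on C + D: category_on D
  for C :: "('o, 'm) cat" and D :: "('p, 'n) cat" and F :: "('o, 'm, 'p, 'n) functor_data" +
  assumes equivalence: "category_equivalence C D F"
begin

lemma is_functor: "is_functor C D F"
  using equivalence by (simp add: category_equivalence_def)

lemma faithful:
  assumes f: "f \<in> hom C A B" and g: "g \<in> hom C A B" and eq: "on_ar F f = on_ar F g"
  shows "f = g"
proof -
  obtain G \<eta> where \<eta>: "natural_isomorphism C C id_functor (comp_functor G F) \<eta>"
    using equivalence unfolding category_equivalence_def by blast
  have B: "B \<in> Ob C"
    using C.hom_ob f by blast
  have "\<eta> B \<cdot>\<^bsub>C\<^esub> f = \<eta> B \<cdot>\<^bsub>C\<^esub> g"
    using natural_isomorphismD(3)[OF \<eta> f] natural_isomorphismD(3)[OF \<eta> g] eq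
    by (simp add: id_functor_def comp_functor_def)
  moreover have "\<eta> B \<in> hom C B (on_ob G (on_ob F B))"
    using natural_isomorphismD(2)[OF \<eta> B] by (simp add: id_functor_def comp_functor_def)
  ultimately show ?thesis
    using C.iso_cancel_left[OF natural_isomorphismD(1)[OF \<eta> B]] f g by blast
qed

text \<open>Conjugating \<open>G d\<close> with the unit gives the candidate. Cancelling the unit
  shows that \<open>G\<close> agrees on \<open>F f\<close> and \<open>d\<close>; naturality of the
  invertible \<open>\<epsilon>\<close> carries this equality back to \<open>D\<close>.\<close>

lemma full:
  assumes A: "A \<in> Ob C" and B: "B \<in> Ob C" and d: "d \<in> hom D (on_ob F A) (on_ob F B)"
  obtains f where "f \<in> hom C A B" "on_ar F f = d"
proof -
  obtain G \<eta> \<epsilon> where G: "is_functor D C G"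
    and \<eta>: "natural_isomorphism C C id_functor (comp_functor G F) \<eta>"
    and \<epsilon>: "natural_isomorphism D D (comp_functor F G) id_functor \<epsilon>"
    using equivalence unfolding category_equivalence_def by blast
  note simps = id_functor_def comp_functor_def
  have \<eta>h: "\<eta> X \<in> hom C X (on_ob G (on_ob F X))" "iso_arrow C (\<eta> X)" if "X \<in> Ob C" for X
    using natural_isomorphismD(1,2)[OF \<eta> that] by (simp_all add: simps)
  have \<epsilon>h: "\<epsilon> X \<in> hom D (on_ob F (on_ob G X)) X" "iso_arrow D (\<epsilon> X)" if "X \<in> Ob D" for X
    using natural_isomorphismD(1,2)[OF \<epsilon> that] by (simp_all add: simps)
  define f where "f = inv_arrow C (\<eta> B) \<cdot>\<^bsub>C\<^esub> (on_ar G d \<cdot>\<^bsub>C\<^esub> \<eta> A)"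
  have Gd: "on_ar G d \<cdot>\<^bsub>C\<^esub> \<eta> A \<in> hom C A (on_ob G (on_ob F B))"
    using C.cmp_hom \<eta>h(1)[OF A] functor_hom[OF G d] by blast
  have f: "f \<in> hom C A B"
    using C.cmp_hom Gd C.inv_hom[OF \<eta>h(2,1)[OF B]] unfolding f_def by blast
  have "\<eta> B \<cdot>\<^bsub>C\<^esub> f = on_ar G d \<cdot>\<^bsub>C\<^esub> \<eta> A"
    using C.inv_left_cancel'[OF \<eta>h(2,1)[OF B] Gd] by (simp add: f_def)
  then have "on_ar G (on_ar F f) \<cdot>\<^bsub>C\<^esub> \<eta> A = on_ar G d \<cdot>\<^bsub>C\<^esub> \<eta> A"
    using natural_isomorphismD(3)[OF \<eta> f] by (simp add: simps)
  then have eq: "on_ar G (on_ar F f) = on_ar G d"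
    using C.iso_cancel_right[OF \<eta>h(2,1)[OF A]] functor_hom[OF G functor_hom[OF is_functor f]]
      functor_hom[OF G d] by blast
  have FA: "on_ob F A \<in> Ob D"
    using functor_ob[OF is_functor A] .
  have "on_ar F f \<cdot>\<^bsub>D\<^esub> \<epsilon> (on_ob F A) = d \<cdot>\<^bsub>D\<^esub> \<epsilon> (on_ob F A)"
    using natural_isomorphismD(3)[OF \<epsilon> functor_hom[OF is_functor f]]
      natural_isomorphismD(3)[OF \<epsilon> d] eq by (simp add: simps)
  then have "on_ar F f = d"
    using D.iso_cancel_right[OF \<epsilon>h(2,1)[OF FA]] functor_hom[OF is_functor f] d by blast
  with f show ?thesis by (rule that)
qed

lemma essentially_surjective:
  assumes "Y \<in> Ob D"
  obtains X d where "X \<in> Ob C" "d \<in> hom D Y (on_ob F X)" "iso_arrow D d"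
proof -
  obtain G \<epsilon> where G: "is_functor D C G"
    and \<epsilon>: "natural_isomorphism D D (comp_functor F G) id_functor \<epsilon>"
    using equivalence unfolding category_equivalence_def by blast
  note e = natural_isomorphismD(1,2)[OF \<epsilon> assms]
  have "on_ob G Y \<in> Ob C"
    using functor_ob[OF G assms] .
  moreover have "inv_arrow D (\<epsilon> Y) \<in> hom D Y (on_ob F (on_ob G Y))"
    using D.inv_hom[OF e] by (simp add: id_functor_def comp_functor_def)
  moreover have "iso_arrow D (inv_arrow D (\<epsilon> Y))"
    using D.inv_iso[OF e] .
  ultimately show ?thesis by (rule that)
qed

end

text \<open>The weak inverse comes from choices: an object \<open>g Y\<close> with an isomorphism
  \<open>\<epsilon> Y\<close> onto \<open>Y\<close>, and lifts \<open>l\<close> along the full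
  functor \<open>F\<close>. Faithfulness makes the lifts coherent, since each equation between them
  can be checked after applying \<open>F\<close>.\<close>

lemma category_equivalenceI:
  assumes C: "category C" and D: "category D" and F: "is_functor C D F"
    and full: "\<And>A B d. \<lbrakk>A \<in> Ob C; B \<in> Ob C; d \<in> hom D (on_ob F A) (on_ob F B)\<rbrakk> \<Longrightarrow>
      \<exists>f\<in>hom C A B. on_ar F f = d"
    and faithful: "\<And>A B f g. \<lbrakk>f \<in> hom C A B; g \<in> hom C A B; on_ar F f = on_ar F g\<rbrakk> \<Longrightarrow> f = g"
    and essentially_surjective: "\<And>Y. Y \<in> Ob D \<Longrightarrow>
      \<exists>X\<in>Ob C. \<exists>d\<in>hom D (on_ob F X) Y. iso_arrow D d"
  shows "category_equivalence C D F"
proof -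
  interpret C: category_on C by unfold_locales (rule C)
  interpret D: category_on D by unfold_locales (rule D)
  obtain g \<epsilon> where g: "\<And>Y. Y \<in> Ob D \<Longrightarrow> g Y \<in> Ob C"
    and \<epsilon>: "\<And>Y. Y \<in> Ob D \<Longrightarrow> \<epsilon> Y \<in> hom D (on_ob F (g Y)) Y"
      "\<And>Y. Y \<in> Ob D \<Longrightarrow> iso_arrow D (\<epsilon> Y)"
    using essentially_surjective by metis
  have "\<exists>l. \<forall>A B d. A \<in> Ob C \<longrightarrow> B \<in> Ob C \<longrightarrow> d \<in> hom D (on_ob F A) (on_ob F B) \<longrightarrow>
      l A B d \<in> hom C A B \<and> on_ar F (l A B d) = d"
    using full by metis
  then obtain l where l: "\<And>A B d. \<lbrakk>A \<in> Ob C; B \<in> Ob C; d \<in> hom D (on_ob F A) (on_ob F B)\<rbrakk> \<Longrightarrow>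
      l A B d \<in> hom C A B"
    "\<And>A B d. \<lbrakk>A \<in> Ob C; B \<in> Ob C; d \<in> hom D (on_ob F A) (on_ob F B)\<rbrakk> \<Longrightarrow>
      on_ar F (l A B d) = d"
    by blast
  define \<delta> where "\<delta> Y = inv_arrow D (\<epsilon> Y)" for Y
  have \<delta>: "\<delta> Y \<in> hom D Y (on_ob F (g Y))" "\<delta> Y \<cdot>\<^bsub>D\<^esub> \<epsilon> Y = Ident D (on_ob F (g Y))"
      "\<epsilon> Y \<cdot>\<^bsub>D\<^esub> \<delta> Y = Ident D Y" if "Y \<in> Ob D" for Y
    using D.inv_hom[OF \<epsilon>(2,1)] D.inv_left[OF \<epsilon>(2,1)] D.inv_right[OF \<epsilon>(2,1)] that
    by (auto simp: \<delta>_def)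
  \<comment> \<open>Transport of \<open>d\<close> along \<open>\<epsilon>\<close>, the only arrow
    for which \<open>\<epsilon>\<close> is natural. Both functor laws of the weak inverse reduce to
    \<open>conj_unique\<close>.\<close>
  define conj where "conj d = \<delta> (Tgt D d) \<cdot>\<^bsub>D\<^esub> (d \<cdot>\<^bsub>D\<^esub> \<epsilon> (Src D d))" for d
  have conj: "conj d \<in> hom D (on_ob F (g X)) (on_ob F (g Y))" "\<epsilon> Y \<cdot>\<^bsub>D\<^esub> conj d = d \<cdot>\<^bsub>D\<^esub> \<epsilon> X"
    if d: "d \<in> hom D X Y" for d X Y
  proof -
    have XY: "X \<in> Ob D" "Y \<in> Ob D" "Src D d = X" "Tgt D d = Y"
      using d D.hom_ob[OF d] by (auto simp: in_hom)
    have de: "d \<cdot>\<^bsub>D\<^esub> \<epsilon> X \<in> hom D (on_ob F (g X)) Y"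
      using D.cmp_hom d \<epsilon>(1) XY by blast
    show "conj d \<in> hom D (on_ob F (g X)) (on_ob F (g Y))"
      using D.cmp_hom[OF de \<delta>(1)] XY by (simp add: conj_def)
    show "\<epsilon> Y \<cdot>\<^bsub>D\<^esub> conj d = d \<cdot>\<^bsub>D\<^esub> \<epsilon> X"
      using D.inv_left_cancel'[OF \<epsilon>(2,1) de] XY by (simp add: conj_def \<delta>_def)
  qed
  have conj_unique: "conj d = d'"
    if "d \<in> hom D X Y" "d' \<in> hom D (on_ob F (g X)) (on_ob F (g Y))" "\<epsilon> Y \<cdot>\<^bsub>D\<^esub> d' = d \<cdot>\<^bsub>D\<^esub> \<epsilon> X"
    for d d' X Y
    using D.iso_cancel_left[OF \<epsilon>(2,1)] conj[OF that(1)] that D.hom_ob[OF that(1)] by metis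
  define G where "G = \<lparr>on_ob = g, on_ar = (\<lambda>d. l (g (Src D d)) (g (Tgt D d)) (conj d))\<rparr>"
  have Gob: "on_ob G = g"
    by (simp add: G_def)
  have Gar: "on_ar G d \<in> hom C (g X) (g Y)" "on_ar F (on_ar G d) = conj d"
    if d: "d \<in> hom D X Y" for d X Y
    using l[OF g g conj(1)[OF d]] d D.hom_ob[OF d] by (auto simp: G_def in_hom)
  have Gfun: "is_functor D C G"
    unfolding is_functor_def Gob
  proof (intro conjI ballI impI)
    show "g Y \<in> Ob C" if "Y \<in> Ob D" for Y
      using g that .
    show "on_ar G d \<in> hom C (g (Src D d)) (g (Tgt D d))" if "d \<in> Ar D" for d
      using Gar(1)[OF in_hom_self[OF that]] .
    fix Y assume Y: "Y \<in> Ob D"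
    have "conj (Ident D Y) = Ident D (on_ob F (g Y))"
      using conj_unique[OF D.ident_hom[OF Y]] D.ident_hom[OF functor_ob[OF F g[OF Y]]]
        D.ident_left[OF \<epsilon>(1)[OF Y]] D.ident_right[OF \<epsilon>(1)[OF Y]] by metis
    then show "on_ar G (Ident D Y) = Ident C (g Y)"
      using faithful Gar[OF D.ident_hom[OF Y]] C.ident_hom[OF g[OF Y]] functor_ident[OF F g[OF Y]]
      by metis
  next
    fix d d' assume a: "d \<in> Ar D" "d' \<in> Ar D" "Tgt D d = Src D d'"
    let ?X = "Src D d" and ?Y = "Tgt D d" and ?Z = "Tgt D d'"
    have d: "d \<in> hom D ?X ?Y" "d' \<in> hom D ?Y ?Z"
      using a by (auto simp: in_hom)
    have ob: "?X \<in> Ob D" "?Y \<in> Ob D" "?Z \<in> Ob D"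
      using D.hom_ob d by blast+
    note dd = D.cmp_hom[OF d]
    note cc = D.cmp_hom[OF conj(1)[OF d(1)] conj(1)[OF d(2)]]
    have "conj (d' \<cdot>\<^bsub>D\<^esub> d) = conj d' \<cdot>\<^bsub>D\<^esub> conj d"
    proof (rule conj_unique[OF dd cc])
      have "\<epsilon> ?Z \<cdot>\<^bsub>D\<^esub> (conj d' \<cdot>\<^bsub>D\<^esub> conj d) = (\<epsilon> ?Z \<cdot>\<^bsub>D\<^esub> conj d') \<cdot>\<^bsub>D\<^esub> conj d"
        using D.assoc[OF conj(1)[OF d(1)] conj(1)[OF d(2)] \<epsilon>(1)[OF ob(3)]] by simp
      also have "\<dots> = d' \<cdot>\<^bsub>D\<^esub> (\<epsilon> ?Y \<cdot>\<^bsub>D\<^esub> conj d)"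
        using D.assoc[OF conj(1)[OF d(1)] \<epsilon>(1)[OF ob(2)] d(2)] conj(2)[OF d(2)] by simp
      also have "\<dots> = d' \<cdot>\<^bsub>D\<^esub> d \<cdot>\<^bsub>D\<^esub> \<epsilon> ?X"
        using D.assoc[OF \<epsilon>(1)[OF ob(1)] d] conj(2)[OF d(1)] by simp
      finally show "\<epsilon> ?Z \<cdot>\<^bsub>D\<^esub> (conj d' \<cdot>\<^bsub>D\<^esub> conj d) = d' \<cdot>\<^bsub>D\<^esub> d \<cdot>\<^bsub>D\<^esub> \<epsilon> ?X" .
    qed
    then show "on_ar G (d' \<cdot>\<^bsub>D\<^esub> d) = on_ar G d' \<cdot>\<^bsub>C\<^esub> on_ar G d"
      using faithful[OF Gar(1)[OF dd] C.cmp_hom[OF Gar(1)[OF d(1)] Gar(1)[OF d(2)]]]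
        Gar(2)[OF dd] Gar(2)[OF d(1)] Gar(2)[OF d(2)]
        functor_cmp[OF F Gar(1)[OF d(1)] Gar(1)[OF d(2)]] by simp
  qed
  have \<epsilon>nat: "natural_isomorphism D D (comp_functor F G) id_functor \<epsilon>"
    unfolding natural_isomorphism_def comp_functor_def id_functor_def
    using \<epsilon> conj(2)[OF in_hom_self] Gar(2)[OF in_hom_self] by (simp add: Gob)
  \<comment> \<open>The unit lifts the inverse of the counit at \<open>F A\<close>; a lift of the
    counit itself is then its inverse.\<close>
  define \<eta> where "\<eta> A = l A (g (on_ob F A)) (\<delta> (on_ob F A))" for A
  have FA: "on_ob F A \<in> Ob D" "g (on_ob F A) \<in> Ob C" if "A \<in> Ob C" for A
    using functor_ob[OF F that] g by auto
  have \<eta>: "\<eta> A \<in> hom C A (g (on_ob F A))" "on_ar F (\<eta> A) = \<delta> (on_ob F A)" if "A \<in> Ob C" for A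
    using l[OF that FA(2)[OF that] \<delta>(1)[OF FA(1)[OF that]]] by (auto simp: \<eta>_def)
  have \<eta>iso: "iso_arrow C (\<eta> A)" if A: "A \<in> Ob C" for A
  proof -
    obtain e where e: "e \<in> hom C (g (on_ob F A)) A" "on_ar F e = \<epsilon> (on_ob F A)"
      using full[OF FA(2)[OF A] A \<epsilon>(1)[OF FA(1)[OF A]]] by blast
    show ?thesis
    proof (rule C.isoI(1)[OF \<eta>(1)[OF A] e(1)])
      show "e \<cdot>\<^bsub>C\<^esub> \<eta> A = Ident C A"
        using faithful[OF C.cmp_hom[OF \<eta>(1)[OF A] e(1)] C.ident_hom[OF A]]
          functor_cmp[OF F \<eta>(1)[OF A] e(1)] \<eta>(2)[OF A] e(2) functor_ident[OF F A] \<delta>(3)[OF FA(1)[OF A]]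
        by simp
      show "\<eta> A \<cdot>\<^bsub>C\<^esub> e = Ident C (g (on_ob F A))"
        using faithful[OF C.cmp_hom[OF e(1) \<eta>(1)[OF A]] C.ident_hom[OF FA(2)[OF A]]]
          functor_cmp[OF F e(1) \<eta>(1)[OF A]] \<eta>(2)[OF A] e(2) functor_ident[OF F FA(2)[OF A]]
          \<delta>(2)[OF FA(1)[OF A]]
        by simp
    qed
  qed
  have \<eta>nat: "\<eta> (Tgt C f) \<cdot>\<^bsub>C\<^esub> f = on_ar G (on_ar F f) \<cdot>\<^bsub>C\<^esub> \<eta> (Src C f)" if a: "f \<in> Ar C" for f
  proof -
    let ?A = "Src C f" and ?B = "Tgt C f"
    note f = in_hom_self[OF a] and Ff = functor_hom[OF F in_hom_self[OF a]]
    have ob: "?A \<in> Ob C" "?B \<in> Ob C"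
      using C.ar_ob[OF a] by auto
    note fo = FA(1)[OF ob(1)] FA(1)[OF ob(2)]
    have "on_ar F (\<eta> ?B \<cdot>\<^bsub>C\<^esub> f) = \<delta> (on_ob F ?B) \<cdot>\<^bsub>D\<^esub> on_ar F f"
      using functor_cmp[OF F f \<eta>(1)[OF ob(2)]] \<eta>(2)[OF ob(2)] by simp
    \<comment> \<open>Both composites become \<open>on_ar F f\<close> after composition with the
      invertible counit.\<close>
    also have "\<dots> = conj (on_ar F f) \<cdot>\<^bsub>D\<^esub> \<delta> (on_ob F ?A)"
    proof (rule D.iso_cancel_left[OF \<epsilon>(2)[OF fo(2)] \<epsilon>(1)[OF fo(2)]])
      show "\<delta> (on_ob F ?B) \<cdot>\<^bsub>D\<^esub> on_ar F f \<in> hom D (on_ob F ?A) (on_ob F (g (on_ob F ?B)))"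
        using D.cmp_hom Ff \<delta>(1)[OF fo(2)] by blast
      show "conj (on_ar F f) \<cdot>\<^bsub>D\<^esub> \<delta> (on_ob F ?A) \<in> hom D (on_ob F ?A) (on_ob F (g (on_ob F ?B)))"
        using D.cmp_hom conj(1)[OF Ff] \<delta>(1)[OF fo(1)] by blast
      have "\<epsilon> (on_ob F ?B) \<cdot>\<^bsub>D\<^esub> (\<delta> (on_ob F ?B) \<cdot>\<^bsub>D\<^esub> on_ar F f) = on_ar F f"
        using D.assoc[OF Ff \<delta>(1)[OF fo(2)] \<epsilon>(1)[OF fo(2)]] \<delta>(3)[OF fo(2)] D.ident_left[OF Ff] by simp
      moreover have "\<epsilon> (on_ob F ?B) \<cdot>\<^bsub>D\<^esub> (conj (on_ar F f) \<cdot>\<^bsub>D\<^esub> \<delta> (on_ob F ?A)) = on_ar F f"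
        using D.assoc[OF \<delta>(1)[OF fo(1)] conj(1)[OF Ff] \<epsilon>(1)[OF fo(2)]] conj(2)[OF Ff]
          D.assoc[OF \<delta>(1)[OF fo(1)] \<epsilon>(1)[OF fo(1)] Ff] \<delta>(3)[OF fo(1)] D.ident_right[OF Ff]
        by simp
      ultimately show "\<epsilon> (on_ob F ?B) \<cdot>\<^bsub>D\<^esub> (\<delta> (on_ob F ?B) \<cdot>\<^bsub>D\<^esub> on_ar F f) =
          \<epsilon> (on_ob F ?B) \<cdot>\<^bsub>D\<^esub> (conj (on_ar F f) \<cdot>\<^bsub>D\<^esub> \<delta> (on_ob F ?A))" by simp
    qed
    also have "\<dots> = on_ar F (on_ar G (on_ar F f) \<cdot>\<^bsub>C\<^esub> \<eta> ?A)"
      using functor_cmp[OF F \<eta>(1)[OF ob(1)] Gar(1)[OF Ff]] \<eta>(2)[OF ob(1)] Gar(2)[OF Ff] by simp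
    finally show ?thesis
      using faithful C.cmp_hom[OF f \<eta>(1)[OF ob(2)]] C.cmp_hom[OF \<eta>(1)[OF ob(1)] Gar(1)[OF Ff]]
      by blast
  qed
  have "natural_isomorphism C C id_functor (comp_functor G F) \<eta>"
    unfolding natural_isomorphism_def comp_functor_def id_functor_def
    using \<eta>iso \<eta>(1) \<eta>nat by (simp add: Gob)
  then show ?thesis
    unfolding category_equivalence_def using F Gfun \<epsilon>nat by blast
qed

section \<open>Commutative squares with invertible domain component\<close>

lemma triangle_cat_simps [simp]:
  "Ob (triangle_cat C) = Ar C" "Src (triangle_cat C) = cs_src" "Tgt (triangle_cat C) = cs_tgt"
  "Ident (triangle_cat C) a = CommSq a (Ident C (Src C a)) (Ident C (Tgt C a)) a"
  "Cmp (triangle_cat C) \<tau> \<sigma> =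
     CommSq (cs_src \<sigma>) (cs_dom \<tau> \<cdot>\<^bsub>C\<^esub> cs_dom \<sigma>) (cs_cod \<tau> \<cdot>\<^bsub>C\<^esub> cs_cod \<sigma>) (cs_tgt \<tau>)"
  by (simp_all add: triangle_cat_def)

lemma in_hom_triangle:
  "\<sigma> \<in> hom (triangle_cat C) a b \<longleftrightarrow>
     cs_src \<sigma> = a \<and> cs_tgt \<sigma> = b \<and> a \<in> Ar C \<and> b \<in> Ar C \<and>
     cs_dom \<sigma> \<in> hom C (Src C a) (Src C b) \<and> cs_cod \<sigma> \<in> hom C (Tgt C a) (Tgt C b) \<and>
     iso_arrow C (cs_dom \<sigma>) \<and> b \<cdot>\<^bsub>C\<^esub> cs_dom \<sigma> = cs_cod \<sigma> \<cdot>\<^bsub>C\<^esub> a"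
  by (cases \<sigma>) (auto simp: in_hom triangle_cat_def)

context category_on
begin

lemma triangle_cmp_hom:
  assumes "\<sigma> \<in> hom (triangle_cat C) a b" "\<tau> \<in> hom (triangle_cat C) b e"
  shows "\<tau> \<cdot>\<^bsub>triangle_cat C\<^esub> \<sigma> \<in> hom (triangle_cat C) a e"
proof -
  note s = assms(1)[unfolded in_hom_triangle] and t = assms(2)[unfolded in_hom_triangle]
  have a: "a \<in> hom C (Src C a) (Tgt C a)" "b \<in> hom C (Src C b) (Tgt C b)"
      "e \<in> hom C (Src C e) (Tgt C e)"
    using s t by (auto simp: in_hom)
  have "e \<cdot>\<^bsub>C\<^esub> (cs_dom \<tau> \<cdot>\<^bsub>C\<^esub> cs_dom \<sigma>) = (e \<cdot>\<^bsub>C\<^esub> cs_dom \<tau>) \<cdot>\<^bsub>C\<^esub> cs_dom \<sigma>"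
    using assoc[OF _ _ a(3)] s t by metis
  also have "\<dots> = cs_cod \<tau> \<cdot>\<^bsub>C\<^esub> (b \<cdot>\<^bsub>C\<^esub> cs_dom \<sigma>)"
    using assoc[OF _ a(2)] s t by metis
  also have "\<dots> = (cs_cod \<tau> \<cdot>\<^bsub>C\<^esub> cs_cod \<sigma>) \<cdot>\<^bsub>C\<^esub> a"
    using assoc[OF a(1)] s t by metis
  finally have eq: "e \<cdot>\<^bsub>C\<^esub> (cs_dom \<tau> \<cdot>\<^bsub>C\<^esub> cs_dom \<sigma>) = (cs_cod \<tau> \<cdot>\<^bsub>C\<^esub> cs_cod \<sigma>) \<cdot>\<^bsub>C\<^esub> a" .
  have d: "cs_dom \<sigma> \<in> hom C (Src C a) (Src C b)" "cs_dom \<tau> \<in> hom C (Src C b) (Src C e)"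
    and c: "cs_cod \<sigma> \<in> hom C (Tgt C a) (Tgt C b)" "cs_cod \<tau> \<in> hom C (Tgt C b) (Tgt C e)"
    and i: "iso_arrow C (cs_dom \<sigma>)" "iso_arrow C (cs_dom \<tau>)"
    and ae: "cs_src \<sigma> = a" "cs_tgt \<tau> = e" "a \<in> Ar C" "e \<in> Ar C"
    using s t by blast+
  show ?thesis
    unfolding in_hom_triangle triangle_cat_simps comm_sq.sel
    by (intro conjI ae cmp_hom[OF d] cmp_hom[OF c] cmp_iso[OF d(1) i(1) d(2) i(2)] eq)
qed

lemma category_triangle: "category (triangle_cat C)"
proof -
  let ?T = "triangle_cat C"
  have T: "\<sigma> \<in> hom ?T (cs_src \<sigma>) (cs_tgt \<sigma>)" if "\<sigma> \<in> Ar ?T" for \<sigma>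
    using in_hom_self[OF that] by simp
  have self: "a \<in> hom C (Src C a) (Tgt C a)" if "a \<in> Ar C" for a
    using that by (rule in_hom_self)
  show ?thesis
    unfolding category_def
  proof (intro conjI ballI impI)
    fix \<sigma> assume s: "\<sigma> \<in> Ar ?T"
    note s' = T[OF s, unfolded in_hom_triangle]
    show "Src ?T \<sigma> \<in> Ob ?T" "Tgt ?T \<sigma> \<in> Ob ?T"
      using s' by simp_all
    show "\<sigma> \<cdot>\<^bsub>?T\<^esub> Ident ?T (Src ?T \<sigma>) = \<sigma>" "Ident ?T (Tgt ?T \<sigma>) \<cdot>\<^bsub>?T\<^esub> \<sigma> = \<sigma>"
      using s' ident_left[of "cs_dom \<sigma>"] ident_left[of "cs_cod \<sigma>"]
        ident_right[of "cs_dom \<sigma>"] ident_right[of "cs_cod \<sigma>"]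
      unfolding triangle_cat_simps comm_sq.sel by (metis comm_sq.collapse)+
  next
    fix a assume "a \<in> Ob ?T"
    then have a: "a \<in> Ar C" by simp
    then show "Ident ?T a \<in> hom ?T a a"
      using ar_ob[OF a] ident_hom ident_iso ident_left[OF self[OF a]] ident_right[OF self[OF a]]
      by (simp add: in_hom_triangle)
  next
    fix \<sigma> \<tau> assume "\<sigma> \<in> Ar ?T" "\<tau> \<in> Ar ?T" "Tgt ?T \<sigma> = Src ?T \<tau>"
    then show "\<tau> \<cdot>\<^bsub>?T\<^esub> \<sigma> \<in> hom ?T (Src ?T \<sigma>) (Tgt ?T \<tau>)"
      using triangle_cmp_hom T by (metis triangle_cat_simps(2,3))
  next
    fix \<sigma> \<tau> \<upsilon> assume "\<sigma> \<in> Ar ?T" "\<tau> \<in> Ar ?T" "\<upsilon> \<in> Ar ?T"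
      and eq: "Tgt ?T \<sigma> = Src ?T \<tau>" "Tgt ?T \<tau> = Src ?T \<upsilon>"
    then have "\<sigma> \<in> hom ?T (cs_src \<sigma>) (cs_src \<tau>)" "\<tau> \<in> hom ?T (cs_src \<tau>) (cs_src \<upsilon>)"
        "\<upsilon> \<in> hom ?T (cs_src \<upsilon>) (cs_tgt \<upsilon>)"
      using T by fastforce+
    then have "cs_dom \<upsilon> \<cdot>\<^bsub>C\<^esub> cs_dom \<tau> \<cdot>\<^bsub>C\<^esub> cs_dom \<sigma> = cs_dom \<upsilon> \<cdot>\<^bsub>C\<^esub> (cs_dom \<tau> \<cdot>\<^bsub>C\<^esub> cs_dom \<sigma>)"
      "cs_cod \<upsilon> \<cdot>\<^bsub>C\<^esub> cs_cod \<tau> \<cdot>\<^bsub>C\<^esub> cs_cod \<sigma> = cs_cod \<upsilon> \<cdot>\<^bsub>C\<^esub> (cs_cod \<tau> \<cdot>\<^bsub>C\<^esub> cs_cod \<sigma>)"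
      unfolding in_hom_triangle by (metis assoc)+
    then show "\<upsilon> \<cdot>\<^bsub>?T\<^esub> (\<tau> \<cdot>\<^bsub>?T\<^esub> \<sigma>) = (\<upsilon> \<cdot>\<^bsub>?T\<^esub> \<tau>) \<cdot>\<^bsub>?T\<^esub> \<sigma>"
      by simp
  qed
qed

text \<open>The domain component of an arrow of \<open>triangle_cat\<close> is invertible by
  definition, so an inverse on codomains suffices; the reversed square commutes by
  cancellation.\<close>

lemma triangle_iso:
  assumes s: "\<sigma> \<in> hom (triangle_cat C) a b" and t: "iso_arrow C (cs_cod \<sigma>)"
  shows "iso_arrow (triangle_cat C) \<sigma>"
proof -
  interpret T: category_on "triangle_cat C" by unfold_locales (rule category_triangle)
  note s' = s[unfolded in_hom_triangle]
  have a: "a \<in> hom C (Src C a) (Tgt C a)" "b \<in> hom C (Src C b) (Tgt C b)"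
    using s' by (auto simp: in_hom)
  have d: "iso_arrow C (cs_dom \<sigma>)" "cs_dom \<sigma> \<in> hom C (Src C a) (Src C b)"
    and c: "cs_cod \<sigma> \<in> hom C (Tgt C a) (Tgt C b)"
    using s' by auto
  let ?d = "inv_arrow C (cs_dom \<sigma>)" and ?c = "inv_arrow C (cs_cod \<sigma>)"
  have "a \<cdot>\<^bsub>C\<^esub> ?d = ?c \<cdot>\<^bsub>C\<^esub> b"
  proof (rule iso_cancel_right[OF d cmp_hom[OF inv_hom[OF d] a(1)] cmp_hom[OF a(2) inv_hom[OF t c]]])
    have "?c \<cdot>\<^bsub>C\<^esub> b \<cdot>\<^bsub>C\<^esub> cs_dom \<sigma> = ?c \<cdot>\<^bsub>C\<^esub> (cs_cod \<sigma> \<cdot>\<^bsub>C\<^esub> a)"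
      using assoc[OF d(2) a(2) inv_hom[OF t c]] s' by simp
    then show "a \<cdot>\<^bsub>C\<^esub> ?d \<cdot>\<^bsub>C\<^esub> cs_dom \<sigma> = ?c \<cdot>\<^bsub>C\<^esub> b \<cdot>\<^bsub>C\<^esub> cs_dom \<sigma>"
      using inv_left_cancel[OF t c a(1)] inv_right_cancel[OF d a(1)] by simp
  qed
  then have "CommSq b ?d ?c a \<in> hom (triangle_cat C) b a"
    using s' inv_hom[OF d] inv_hom[OF t c] inv_iso[OF d] by (simp add: in_hom_triangle)
  moreover have "cs_src \<sigma> = a" "cs_tgt \<sigma> = b"
    using s' by auto
  then have "CommSq b ?d ?c a \<cdot>\<^bsub>triangle_cat C\<^esub> \<sigma> = Ident (triangle_cat C) a"
    "\<sigma> \<cdot>\<^bsub>triangle_cat C\<^esub> CommSq b ?d ?c a = Ident (triangle_cat C) b"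
    unfolding triangle_cat_simps comm_sq.sel inv_left[OF d] inv_right[OF d] inv_left[OF t c] inv_right[OF t c]
    by simp_all
  ultimately show ?thesis
    by (rule T.isoI(1)[OF s])
qed

text \<open>Essential surjectivity of the cokernel functor returns an isomorphism of
  \<open>triangle_cat\<close>; its codomain component later has to be undone separately, hence must
  be known to be invertible.\<close>

lemma triangle_iso_cod:
  assumes s: "\<sigma> \<in> hom (triangle_cat C) a b" and i: "iso_arrow (triangle_cat C) \<sigma>"
  shows "iso_arrow C (cs_cod \<sigma>)"
proof -
  interpret T: category_on "triangle_cat C" by unfold_locales (rule category_triangle)
  let ?\<tau> = "inv_arrow (triangle_cat C) \<sigma>"
  have t: "?\<tau> \<in> hom (triangle_cat C) b a"
    using T.inv_hom[OF i s] .
  have "cs_cod \<sigma> \<in> hom C (Tgt C a) (Tgt C b)" "cs_cod ?\<tau> \<in> hom C (Tgt C b) (Tgt C a)"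
    using s t unfolding in_hom_triangle by blast+
  moreover have "cs_cod ?\<tau> \<cdot>\<^bsub>C\<^esub> cs_cod \<sigma> = Ident C (Tgt C a)" "cs_cod \<sigma> \<cdot>\<^bsub>C\<^esub> cs_cod ?\<tau> = Ident C (Tgt C b)"
    using arg_cong[OF T.inv_left[OF i s], of cs_cod] arg_cong[OF T.inv_right[OF i s], of cs_cod]
    by simp_all
  ultimately show ?thesis
    by (rule isoI(1))
qed

end

section \<open>Transposition of double categories\<close>

definition transposed :: "('o, 'h, 'v, 's) double_cat \<Rightarrow> ('o, 'v, 'h, 's) double_cat" where
  "transposed D = \<lparr>HC = VC D, VC = HC D, Sq = Sq D, sq_top = sq_left D, sq_left = sq_top D,
     sq_right = sq_bottom D, sq_bottom = sq_right D, sq_hcomp = sq_vcomp D, sq_vcomp = sq_hcomp D,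
     sq_hid = sq_vid D, sq_vid = sq_hid D\<rparr>"

lemma transposed_simps [simp]:
  "HC (transposed D) = VC D" "VC (transposed D) = HC D" "Sq (transposed D) = Sq D"
  "sq_top (transposed D) = sq_left D" "sq_left (transposed D) = sq_top D"
  "sq_right (transposed D) = sq_bottom D" "sq_bottom (transposed D) = sq_right D"
  "sq_hcomp (transposed D) = sq_vcomp D" "sq_vcomp (transposed D) = sq_hcomp D"
  "sq_hid (transposed D) = sq_vid D" "sq_vid (transposed D) = sq_hid D"
  "H_Dv (transposed D) = V_Dh D" "V_Dh (transposed D) = H_Dv D"
  by (simp_all add: transposed_def H_Dv_def V_Dh_def)

lemma transposed_transposed [simp]: "transposed (transposed D) = D"
  by (simp add: transposed_def)

lemma is_square_transposed [simp]: "is_square (transposed D) \<sigma> f h k g \<longleftrightarrow> is_square D \<sigma> h f g k"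
  by (auto simp: is_square_def)

lemma sq_interchange:
  assumes "double_category D"
    and "\<alpha> \<in> Sq D" "\<beta> \<in> Sq D" "\<gamma> \<in> Sq D" "\<delta> \<in> Sq D"
    and "sq_right D \<alpha> = sq_left D \<beta>" "sq_right D \<gamma> = sq_left D \<delta>"
    and "sq_bottom D \<alpha> = sq_top D \<gamma>" "sq_bottom D \<beta> = sq_top D \<delta>"
  shows "sq_vcomp D (sq_hcomp D \<delta> \<gamma>) (sq_hcomp D \<beta> \<alpha>) =
    sq_hcomp D (sq_vcomp D \<delta> \<beta>) (sq_vcomp D \<gamma> \<alpha>)"
  using assms(1)[unfolded double_category_def] assms(2-) by (elim conjE) simp

lemma sq_corners:
  assumes "double_category D" "\<sigma> \<in> Sq D"
  shows "Src (HC D) (sq_top D \<sigma>) = Src (VC D) (sq_left D \<sigma>)"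
    "Tgt (HC D) (sq_top D \<sigma>) = Src (VC D) (sq_right D \<sigma>)"
    "Src (HC D) (sq_bottom D \<sigma>) = Tgt (VC D) (sq_left D \<sigma>)"
    "Tgt (HC D) (sq_bottom D \<sigma>) = Tgt (VC D) (sq_right D \<sigma>)"
  using assms unfolding double_category_def by (elim conjE; simp)+

lemma double_category_transposed:
  assumes "double_category D"
  shows "double_category (transposed D)"
proof -
  note d = assms[unfolded double_category_def]
  show ?thesis
    unfolding double_category_def transposed_simps
  proof (intro conjI)
    show "category (VC D)" "category (HC D)" "Ob (VC D) = Ob (HC D)"
      "category (V_Dh D)" "category (H_Dv D)"
      using d by simp_all
    show "\<forall>\<sigma>\<in>Sq D.
        Src (VC D) (sq_left D \<sigma>) = Src (HC D) (sq_top D \<sigma>) \<and>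
        Tgt (VC D) (sq_left D \<sigma>) = Src (HC D) (sq_bottom D \<sigma>) \<and>
        Src (VC D) (sq_right D \<sigma>) = Tgt (HC D) (sq_top D \<sigma>) \<and>
        Tgt (VC D) (sq_right D \<sigma>) = Tgt (HC D) (sq_bottom D \<sigma>)"
      using sq_corners[OF assms] by simp
    show "\<forall>A\<in>Ob (VC D). sq_vid D (Ident (HC D) A) = sq_hid D (Ident (VC D) A)"
      using d by (elim conjE) metis
    show "\<forall>\<alpha>\<in>Sq D. \<forall>\<beta>\<in>Sq D. \<forall>\<gamma>\<in>Sq D. \<forall>\<delta>\<in>Sq D.
        sq_bottom D \<alpha> = sq_top D \<beta> \<longrightarrow> sq_bottom D \<gamma> = sq_top D \<delta> \<longrightarrow>
        sq_right D \<alpha> = sq_left D \<gamma> \<longrightarrow> sq_right D \<beta> = sq_left D \<delta> \<longrightarrow>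
        sq_hcomp D (sq_vcomp D \<delta> \<gamma>) (sq_vcomp D \<beta> \<alpha>) =
        sq_vcomp D (sq_hcomp D \<delta> \<beta>) (sq_hcomp D \<gamma> \<alpha>)"
    proof (intro ballI impI)
      fix \<alpha> \<beta> \<gamma> \<delta>
      assume "\<alpha> \<in> Sq D" "\<beta> \<in> Sq D" "\<gamma> \<in> Sq D" "\<delta> \<in> Sq D"
        "sq_bottom D \<alpha> = sq_top D \<beta>" "sq_bottom D \<gamma> = sq_top D \<delta>"
        "sq_right D \<alpha> = sq_left D \<gamma>" "sq_right D \<beta> = sq_left D \<delta>"
      then show "sq_hcomp D (sq_vcomp D \<delta> \<gamma>) (sq_vcomp D \<beta> \<alpha>) =
          sq_vcomp D (sq_hcomp D \<delta> \<beta>) (sq_hcomp D \<gamma> \<alpha>)"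
        \<comment> \<open>The interchange law is its own transpose: exchanging
          \<open>\<beta>\<close> and \<open>\<gamma>\<close> swaps its two sides.\<close>
        by (intro sq_interchange[OF assms, symmetric])
    qed
    show "\<forall>\<sigma>\<in>Sq D. \<forall>\<tau>\<in>Sq D. sq_bottom D \<sigma> = sq_top D \<tau> \<longrightarrow>
        sq_left D (sq_vcomp D \<tau> \<sigma>) = sq_left D \<tau> \<cdot>\<^bsub>VC D\<^esub> sq_left D \<sigma> \<and>
        sq_right D (sq_vcomp D \<tau> \<sigma>) = sq_right D \<tau> \<cdot>\<^bsub>VC D\<^esub> sq_right D \<sigma>"
      "\<forall>\<sigma>\<in>Sq D. \<forall>\<tau>\<in>Sq D. sq_right D \<sigma> = sq_left D \<tau> \<longrightarrow>
        sq_top D (sq_hcomp D \<tau> \<sigma>) = sq_top D \<tau> \<cdot>\<^bsub>HC D\<^esub> sq_top D \<sigma> \<and>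
        sq_bottom D (sq_hcomp D \<tau> \<sigma>) = sq_bottom D \<tau> \<cdot>\<^bsub>HC D\<^esub> sq_bottom D \<sigma>"
      "\<forall>f\<in>Ar (HC D).
        sq_left D (sq_vid D f) = Ident (VC D) (Src (HC D) f) \<and>
        sq_right D (sq_vid D f) = Ident (VC D) (Tgt (HC D) f)"
      "\<forall>u\<in>Ar (VC D).
        sq_top D (sq_hid D u) = Ident (HC D) (Src (VC D) u) \<and>
        sq_bottom D (sq_hid D u) = Ident (HC D) (Tgt (VC D) u)"
      "\<forall>f\<in>Ar (HC D). \<forall>g\<in>Ar (HC D). Tgt (HC D) f = Src (HC D) g \<longrightarrow>
        sq_vid D (g \<cdot>\<^bsub>HC D\<^esub> f) = sq_hcomp D (sq_vid D g) (sq_vid D f)"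
      "\<forall>u\<in>Ar (VC D). \<forall>w\<in>Ar (VC D). Tgt (VC D) u = Src (VC D) w \<longrightarrow>
        sq_hid D (w \<cdot>\<^bsub>VC D\<^esub> u) = sq_vcomp D (sq_hid D w) (sq_hid D u)"
      using d by - (elim conjE, assumption)+
  qed
qed

text \<open>Of the four squares in \<open>shared_iso\<close>, the first two are their own transposes
  and the last two are exchanged.\<close>

lemma shared_iso_transposed: "shared_iso (transposed D) A B p \<longleftrightarrow> shared_iso D A B (prod.swap p)"
proof -
  obtain f f' where p: "p = (f, f')" by (cases p)
  show ?thesis
    unfolding p shared_iso_def transposed_simps is_square_transposed swap_simp prod.case
    by (intro iffI; elim conjE; intro conjI; assumption)
qed

text \<open>Reflection in the diagonal exchanges the upper right and lower left corners, so
  \<open>b\<close> and \<open>c\<close> trade places, and the two cube conditions trade places with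
  them. \<open>sq_corners\<close> matches the corners as seen from horizontal and from vertical
  sides.\<close>

lemma square_iso_transposed:
  assumes "double_category D"
  shows "square_iso (transposed D) \<sigma> \<tau> a b c d \<longleftrightarrow>
     square_iso D \<sigma> \<tau> (prod.swap a) (prod.swap c) (prod.swap b) (prod.swap d)"
  using sq_corners[OF assms]
  unfolding square_iso_def shared_iso_transposed is_square_transposed transposed_simps
    fst_swap snd_swap
  by (intro iffI; elim conjE; intro conjI; simp only:)

section \<open>Sides and pastings of squares\<close>

locale double_category_on =
  fixes D :: "('o, 'h, 'v, 's) double_cat"
  assumes double_category: "double_category D"
begin

sublocale H: category_on "HC D"
  using double_category by unfold_locales (simp add: double_category_def)

sublocale V: category_on "VC D"
  using double_category by unfold_locales (simp add: double_category_def)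

sublocale HV: category_on "H_Dv D"
  using double_category by unfold_locales (simp add: double_category_def)

sublocale VH: category_on "V_Dh D"
  using double_category by unfold_locales (simp add: double_category_def)

abbreviation hcmp (infixl "\<bullet>" 70) where "g \<bullet> f \<equiv> g \<cdot>\<^bsub>HC D\<^esub> f"
abbreviation vcmp (infixl "\<star>" 70) where "w \<star> u \<equiv> w \<cdot>\<^bsub>VC D\<^esub> u"
abbreviation "hid \<equiv> Ident (HC D)"
abbreviation "vid \<equiv> Ident (VC D)"

lemma transposed: "double_category_on (transposed D)"
  using double_category double_category_transposed by unfold_locales

lemma same_objects: "Ob (VC D) = Ob (HC D)"
  using double_category by (simp add: double_category_def)

lemma in_hom_H_Dv: "\<sigma> \<in> hom (H_Dv D) u w \<longleftrightarrow> (\<exists>f g. is_square D \<sigma> f u w g)"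
  by (auto simp: in_hom H_Dv_def is_square_def)

lemma in_hom_V_Dh: "\<sigma> \<in> hom (V_Dh D) f g \<longleftrightarrow> (\<exists>u w. is_square D \<sigma> f u w g)"
  by (auto simp: in_hom V_Dh_def is_square_def)

lemma square_sides: "is_square D \<sigma> f u w g \<Longrightarrow>
    \<sigma> \<in> Sq D \<and> sq_top D \<sigma> = f \<and> sq_left D \<sigma> = u \<and> sq_right D \<sigma> = w \<and> sq_bottom D \<sigma> = g"
  by (simp add: is_square_def)

lemma square_self: "\<sigma> \<in> Sq D \<Longrightarrow> is_square D \<sigma> (sq_top D \<sigma>) (sq_left D \<sigma>) (sq_right D \<sigma>) (sq_bottom D \<sigma>)"
  by (simp add: is_square_def)

lemma square_ar:
  assumes "is_square D \<sigma> f u w g"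
  shows "f \<in> Ar (HC D)" "g \<in> Ar (HC D)" "u \<in> Ar (VC D)" "w \<in> Ar (VC D)"
  using HV.hom_ob[of \<sigma> u w] VH.hom_ob[of \<sigma> f g] assms
  by (auto simp: in_hom_H_Dv in_hom_V_Dh) (auto simp: H_Dv_def V_Dh_def)

lemma square_hom:
  assumes "is_square D \<sigma> f u w g" "f \<in> hom (HC D) A B" "g \<in> hom (HC D) A' B'"
  shows "u \<in> hom (VC D) A A'" "w \<in> hom (VC D) B B'"
  using square_ar[OF assms(1)] sq_corners[OF double_category, of \<sigma>] assms
  by (auto simp: in_hom is_square_def)

lemma square_hom':
  assumes "is_square D \<sigma> f u w g" "u \<in> hom (VC D) A A'" "w \<in> hom (VC D) B B'"
  shows "f \<in> hom (HC D) A B" "g \<in> hom (HC D) A' B'"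
  using square_ar[OF assms(1)] sq_corners[OF double_category, of \<sigma>] assms
  by (auto simp: in_hom is_square_def)

lemma square_hcomp:
  assumes s: "is_square D \<sigma> f u w g" and t: "is_square D \<tau> f' w w' g'"
  shows "is_square D (sq_hcomp D \<tau> \<sigma>) (f' \<bullet> f) u w' (g' \<bullet> g)"
proof -
  have "sq_hcomp D \<tau> \<sigma> \<in> hom (H_Dv D) u w'"
    using HV.cmp_hom[of \<sigma> u w \<tau> w'] assms unfolding in_hom_H_Dv by (auto simp: H_Dv_def)
  moreover have "sq_top D (sq_hcomp D \<tau> \<sigma>) = f' \<bullet> f \<and> sq_bottom D (sq_hcomp D \<tau> \<sigma>) = g' \<bullet> g"
    using double_category square_sides[OF s] square_sides[OF t]
    unfolding double_category_def by (elim conjE) simp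
  ultimately show ?thesis
    unfolding in_hom_H_Dv by (auto simp: is_square_def)
qed

lemma square_vcomp:
  assumes s: "is_square D \<sigma> f u w g" and t: "is_square D \<tau> g u' w' g'"
  shows "is_square D (sq_vcomp D \<tau> \<sigma>) f (u' \<star> u) (w' \<star> w) g'"
  using double_category_on.square_hcomp[OF transposed, of \<sigma> u f g w \<tau> u' g' w'] assms by simp

lemma square_hid:
  assumes "u \<in> hom (VC D) A B"
  shows "is_square D (sq_hid D u) (hid A) u u (hid B)"
proof -
  have u: "u \<in> Ar (VC D)" "Src (VC D) u = A" "Tgt (VC D) u = B"
    using assms by (auto simp: in_hom)
  have "sq_hid D u \<in> hom (H_Dv D) u u"
    using HV.ident_hom[of u] u by (simp add: H_Dv_def)
  moreover have "sq_top D (sq_hid D u) = hid A \<and> sq_bottom D (sq_hid D u) = hid B"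
    using double_category u unfolding double_category_def by (elim conjE) simp
  ultimately show ?thesis
    unfolding in_hom_H_Dv by (auto simp: is_square_def)
qed

lemma square_vid: "f \<in> hom (HC D) A B \<Longrightarrow> is_square D (sq_vid D f) f (vid A) (vid B) f"
  using double_category_on.square_hid[OF transposed, of f A B] by simp

lemma hcomp_hid:
  assumes "is_square D \<sigma> f u w g"
  shows "sq_hcomp D (sq_hid D w) \<sigma> = \<sigma>" "sq_hcomp D \<sigma> (sq_hid D u) = \<sigma>"
  using HV.ident_left[of \<sigma> u w] HV.ident_right[of \<sigma> u w] assms unfolding in_hom_H_Dv
  by (auto simp: H_Dv_def)

lemma vcomp_vid:
  assumes "is_square D \<sigma> f u w g"
  shows "sq_vcomp D (sq_vid D g) \<sigma> = \<sigma>" "sq_vcomp D \<sigma> (sq_vid D f) = \<sigma>"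
  using double_category_on.hcomp_hid[OF transposed, of \<sigma> u f g w] assms by simp_all

end

locale monic_double_category = double_category_on D
  for D :: "('o, 'h, 'v, 's) double_cat" +
  assumes all_mono: "all_mono D"
begin

lemma h_mono: "\<lbrakk>m \<in> hom (HC D) B E; f \<in> hom (HC D) A B; g \<in> hom (HC D) A B; m \<bullet> f = m \<bullet> g\<rbrakk> \<Longrightarrow> f = g"
  by (rule mono_cancel[of "HC D" m B E f A g]) (use all_mono in \<open>simp_all add: all_mono_def in_hom\<close>)

lemma v_mono: "\<lbrakk>m \<in> hom (VC D) B E; f \<in> hom (VC D) A B; g \<in> hom (VC D) A B; m \<star> f = m \<star> g\<rbrakk> \<Longrightarrow> f = g"
  by (rule mono_cancel[of "VC D" m B E f A g]) (use all_mono in \<open>simp_all add: all_mono_def in_hom\<close>)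

text \<open>As \<open>b\<close> is monic, the equation between \<open>b \<bullet> s\<close> and
  \<open>t \<bullet> a\<close> admits at most one \<open>s\<close> for a given \<open>t\<close>.
  Every later uniqueness or functoriality argument about kernels is reduced to codomain components,
  that is, to bottom sides of squares, in this way.\<close>

lemma triangle_eq:
  assumes s: "\<sigma> \<in> hom (triangle_cat (HC D)) a b" and t: "\<tau> \<in> hom (triangle_cat (HC D)) a b"
    and cod: "cs_cod \<sigma> = cs_cod \<tau>"
  shows "\<sigma> = \<tau>"
proof -
  note s' = s[unfolded in_hom_triangle] and t' = t[unfolded in_hom_triangle]
  have b: "b \<in> hom (HC D) (Src (HC D) b) (Tgt (HC D) b)"
    using s' by (simp add: in_hom)
  have "cs_dom \<sigma> = cs_dom \<tau>"
    by (rule h_mono[OF b]) (use s' t' cod in auto)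
  then show ?thesis
    using s' t' cod by (simp add: comm_sq.expand)
qed

end

lemma all_mono_transposed: "all_mono (transposed D) \<longleftrightarrow> all_mono D"
  by (auto simp: all_mono_def)

lemma double_initial_transposed: "double_initial (transposed D) z \<longleftrightarrow> double_initial D z"
  by (auto simp: double_initial_def)

lemma extends_transposed:
  assumes D: "double_category D"
  shows "extends_top_right (transposed D) \<longleftrightarrow> extends_left_bottom D"
proof -
  \<comment> \<open>The connecting isomorphism \<open>\<theta>\<close> is a pair that transposition
    swaps; swapping is a bijection of pairs, so it respects unique existence.\<close>
  have sw: "(\<exists>!\<theta>. P (prod.swap \<theta>)) \<longleftrightarrow> (\<exists>!\<theta>. P \<theta>)" for P :: "('h \<times> 'v) \<Rightarrow> bool"
    by (metis swap_swap)
  have id: "prod.swap (id_shared (transposed D) A) = id_shared D A" for A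
    by (simp add: id_shared_def)
  show ?thesis
    unfolding extends_top_right_def extends_left_bottom_def transposed_simps
      square_iso_transposed[OF D] id
    using sw[of "\<lambda>\<theta>. square_iso D _ _ _ \<theta> _ _"]
    by (simp add: conj_commute)
qed

section \<open>Shared isomorphisms\<close>

text \<open>The common core of both notions: \<open>category_isomorphism\<close> adds functoriality
  to it, and \<open>shared_iso_bijection\<close> states it separately for each pair of
  objects.\<close>

definition iso_bijection :: "('o, 'm) cat \<Rightarrow> ('o, 'n) cat \<Rightarrow> ('m \<Rightarrow> 'n) \<Rightarrow> bool" where
  "iso_bijection C D \<phi> \<longleftrightarrow> bij_betw \<phi> {f. iso_arrow C f} {u. iso_arrow D u} \<and>
     (\<forall>f. iso_arrow C f \<longrightarrow> \<phi> f \<in> hom D (Src C f) (Tgt C f))"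

lemma iso_bijection_iff:
  assumes "category C" "category D" "Ob C = Ob D"
  shows "iso_bijection C D \<phi> \<longleftrightarrow>
    (\<forall>A\<in>Ob C. \<forall>B\<in>Ob C. bij_betw \<phi> {f \<in> hom C A B. iso_arrow C f} {u \<in> hom D A B. iso_arrow D u})"
    (is "_ \<longleftrightarrow> ?R")
proof -
  interpret C: category_on C by unfold_locales (rule assms)
  interpret D: category_on D by unfold_locales (rule assms)
  show ?thesis
  proof
    assume "iso_bijection C D \<phi>"
    then have b: "bij_betw \<phi> {f. iso_arrow C f} {u. iso_arrow D u}"
      and h: "\<And>f. iso_arrow C f \<Longrightarrow> \<phi> f \<in> hom D (Src C f) (Tgt C f)"
      by (auto simp: iso_bijection_def)
    show ?R
    proof (intro ballI)
      fix A B
      have "\<phi> ` {f \<in> hom C A B. iso_arrow C f} = {u \<in> hom D A B. iso_arrow D u}"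
      proof
        show "\<phi> ` {f \<in> hom C A B. iso_arrow C f} \<subseteq> {u \<in> hom D A B. iso_arrow D u}"
          using h bij_betwE[OF b] by (auto simp: in_hom)
        show "{u \<in> hom D A B. iso_arrow D u} \<subseteq> \<phi> ` {f \<in> hom C A B. iso_arrow C f}"
        proof
          fix u assume u: "u \<in> {u \<in> hom D A B. iso_arrow D u}"
          then obtain f where f: "iso_arrow C f" "u = \<phi> f"
            using bij_betw_imp_surj_on[OF b] by blast
          then have "f \<in> hom C A B"
            using h[OF f(1)] C.iso_ar[OF f(1)] u by (auto simp: in_hom)
          then show "u \<in> \<phi> ` {f \<in> hom C A B. iso_arrow C f}"
            using f by blast
        qed
      qed
      then show "bij_betw \<phi> {f \<in> hom C A B. iso_arrow C f} {u \<in> hom D A B. iso_arrow D u}"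
        using bij_betw_subset[OF b] by (metis (no_types, lifting) mem_Collect_eq subsetI)
    qed
  next
    assume R: ?R
    have f: "\<phi> f \<in> hom D (Src C f) (Tgt C f) \<and> iso_arrow D (\<phi> f)" if "iso_arrow C f" for f
    proof -
      have "Src C f \<in> Ob C" "Tgt C f \<in> Ob C"
        using C.ar_ob[OF C.iso_ar[OF that]] by auto
      then show ?thesis
        using R bij_betwE that in_hom_self[OF C.iso_ar[OF that]] by fastforce
    qed
    have "inj_on \<phi> {f. iso_arrow C f}"
    proof (rule inj_onI, unfold mem_Collect_eq)
      fix f g assume fg: "iso_arrow C f" "iso_arrow C g" "\<phi> f = \<phi> g"
      then have "f \<in> hom C (Src C f) (Tgt C f)" "g \<in> hom C (Src C f) (Tgt C f)"
        using f[OF fg(1)] f[OF fg(2)] C.iso_ar by (auto simp: in_hom)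
      moreover have "Src C f \<in> Ob C" "Tgt C f \<in> Ob C"
        using C.ar_ob[OF C.iso_ar[OF fg(1)]] by auto
      moreover from this have "inj_on \<phi> {h \<in> hom C (Src C f) (Tgt C f). iso_arrow C h}"
        using R bij_betw_imp_inj_on by blast
      ultimately show "f = g"
        using inj_onD[of \<phi> _ f g] fg by simp
    qed
    moreover have "{u. iso_arrow D u} \<subseteq> \<phi> ` {f. iso_arrow C f}"
    proof
      fix u assume "u \<in> {u. iso_arrow D u}"
      then have u: "iso_arrow D u" by simp
      have "Src D u \<in> Ob C" "Tgt D u \<in> Ob C"
        using D.ar_ob[OF D.iso_ar[OF u]] assms(3) by auto
      then have "\<phi> ` {f \<in> hom C (Src D u) (Tgt D u). iso_arrow C f} =
          {w \<in> hom D (Src D u) (Tgt D u). iso_arrow D w}"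
        using R bij_betw_imp_surj_on by blast
      then show "u \<in> \<phi> ` {f. iso_arrow C f}"
        using u in_hom_self[OF D.iso_ar[OF u]] by blast
    qed
    ultimately show "iso_bijection C D \<phi>"
      unfolding iso_bijection_def bij_betw_def using f by blast
  qed
qed

text \<open>Transposition reverses the direction of \<open>\<phi>\<close>. The inverse preserves end
  points because \<open>\<phi>\<close> does.\<close>

lemma iso_bijection_inverse:
  assumes "iso_bijection C D \<phi>"
  shows "iso_bijection D C (inv_into {f. iso_arrow C f} \<phi>)"
    "iso_arrow C f \<Longrightarrow> inv_into {f. iso_arrow C f} \<phi> (\<phi> f) = f"
    "iso_arrow D u \<Longrightarrow> \<phi> (inv_into {f. iso_arrow C f} \<phi> u) = u"
proof -
  let ?\<psi> = "inv_into {f. iso_arrow C f} \<phi>"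
  have b: "bij_betw \<phi> {f. iso_arrow C f} {u. iso_arrow D u}"
    and h: "\<And>f. iso_arrow C f \<Longrightarrow> \<phi> f \<in> hom D (Src C f) (Tgt C f)"
    using assms by (auto simp: iso_bijection_def)
  show l: "?\<psi> (\<phi> f) = f" if "iso_arrow C f" for f
    using bij_betw_inv_into_left[OF b] that by simp
  show r: "\<phi> (?\<psi> u) = u" if "iso_arrow D u" for u
    using bij_betw_inv_into_right[OF b] that by simp
  have b': "bij_betw ?\<psi> {u. iso_arrow D u} {f. iso_arrow C f}"
    using bij_betw_inv_into[OF b] .
  have "?\<psi> u \<in> hom C (Src D u) (Tgt D u)" if u: "iso_arrow D u" for u
  proof -
    have i: "iso_arrow C (?\<psi> u)"
      using bij_betwE[OF b'] u by blast
    then have "?\<psi> u \<in> Ar C"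
      by (auto simp: iso_arrow_def inverse_arrows_def)
    then show ?thesis
      using h[OF i] r[OF u] by (simp add: in_hom)
  qed
  with b' show "iso_bijection D C ?\<psi>"
    by (simp add: iso_bijection_def)
qed

lemma category_isomorphism_iff:
  assumes "category C" "category D" "Ob C = Ob D"
  shows "category_isomorphism (max_subgroupoid C) (max_subgroupoid D) \<lparr>on_ob = (\<lambda>A. A), on_ar = \<phi>\<rparr> \<longleftrightarrow>
    iso_bijection C D \<phi> \<and> (\<forall>A\<in>Ob C. \<phi> (Ident C A) = Ident D A) \<and>
    (\<forall>f g. iso_arrow C f \<longrightarrow> iso_arrow C g \<longrightarrow> Tgt C f = Src C g \<longrightarrow>
       \<phi> (g \<cdot>\<^bsub>C\<^esub> f) = \<phi> g \<cdot>\<^bsub>D\<^esub> \<phi> f)"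
proof -
  have "iso_arrow D (\<phi> f) \<and> (\<phi> f \<in> Ar D)" if "bij_betw \<phi> {f. iso_arrow C f} {u. iso_arrow D u}" "iso_arrow C f" for f
    using bij_betwE[OF that(1)] that(2) by (auto simp: iso_arrow_def inverse_arrows_def)
  then show ?thesis
    using assms(3)
    unfolding category_isomorphism_def is_functor_def iso_bijection_def max_subgroupoid_def in_hom
    by (auto simp: bij_betw_def)
qed

locale iso_identification = double_category_on D
  for D :: "('o, 'h, 'v, 's) double_cat" +
  fixes \<phi>
  assumes phi_bijection: "iso_bijection (HC D) (VC D) \<phi>"
begin

lemma phi_hom: "\<lbrakk>iso_arrow (HC D) f; f \<in> hom (HC D) A B\<rbrakk> \<Longrightarrow> \<phi> f \<in> hom (VC D) A B"
  using phi_bijection by (auto simp: iso_bijection_def in_hom)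

lemma phi_iso: "iso_arrow (HC D) f \<Longrightarrow> iso_arrow (VC D) (\<phi> f)"
  using phi_bijection unfolding iso_bijection_def by (auto dest: bij_betwE)

lemma phi_surj:
  assumes "iso_arrow (VC D) u" "u \<in> hom (VC D) A B"
  obtains f where "iso_arrow (HC D) f" "f \<in> hom (HC D) A B" "\<phi> f = u"
proof -
  have "u \<in> \<phi> ` {f. iso_arrow (HC D) f}"
    using phi_bijection assms(1) by (simp add: iso_bijection_def bij_betw_def)
  then obtain f where f: "iso_arrow (HC D) f" "\<phi> f = u"
    by auto
  then have "f \<in> hom (HC D) A B"
    using phi_hom[OF f(1) in_hom_self[OF H.iso_ar[OF f(1)]]] assms(2) H.iso_ar[OF f(1)]
    by (simp add: in_hom)
  with f show ?thesis
    by (intro that)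
qed

end

locale shared_isos = double_category_on D
  for D :: "('o, 'h, 'v, 's) double_cat" +
  fixes \<phi>
  assumes shared: "shared_iso_bijection D \<phi>"
begin

sublocale iso_identification D \<phi>
  using shared iso_bijection_iff[OF H.category V.category same_objects[symmetric]]
  by unfold_locales (simp add: shared_iso_bijection_def)

context
  fixes f g h k A A' B B'
  assumes fg: "f \<in> hom (HC D) A A'" "g \<in> hom (HC D) B B'"
    and hk: "h \<in> hom (HC D) A B" "iso_arrow (HC D) h" "k \<in> hom (HC D) A' B'" "iso_arrow (HC D) k"
begin

lemma h_square_iff: "k \<bullet> f = g \<bullet> h \<longleftrightarrow> (\<exists>\<sigma>. is_square D \<sigma> f (\<phi> h) (\<phi> k) g)"
  and h_square_unique: "\<lbrakk>is_square D \<sigma> f (\<phi> h) (\<phi> k) g; is_square D \<tau> f (\<phi> h) (\<phi> k) g\<rbrakk> \<Longrightarrow> \<sigma> = \<tau>"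
proof -
  have c: "f \<in> Ar (HC D)" "g \<in> Ar (HC D)"
    "h \<in> hom (HC D) (Src (HC D) f) (Src (HC D) g)" "iso_arrow (HC D) h"
    "k \<in> hom (HC D) (Tgt (HC D) f) (Tgt (HC D) g)" "iso_arrow (HC D) k"
    using fg hk by (simp_all add: in_hom)
  note s = shared[unfolded shared_iso_bijection_def, THEN conjunct2, THEN conjunct1, rule_format, OF c]
  show "k \<bullet> f = g \<bullet> h \<longleftrightarrow> (\<exists>\<sigma>. is_square D \<sigma> f (\<phi> h) (\<phi> k) g)"
    by (rule s[THEN conjunct1])
  show "\<lbrakk>is_square D \<sigma> f (\<phi> h) (\<phi> k) g; is_square D \<tau> f (\<phi> h) (\<phi> k) g\<rbrakk> \<Longrightarrow> \<sigma> = \<tau>"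
    using s[THEN conjunct2] by blast
qed

end

context
  fixes u u' h k A A' B B'
  assumes u: "u \<in> hom (VC D) A B" "u' \<in> hom (VC D) A' B'"
    and hk: "h \<in> hom (HC D) A A'" "iso_arrow (HC D) h" "k \<in> hom (HC D) B B'" "iso_arrow (HC D) k"
begin

lemma v_square_iff: "u' \<star> \<phi> h = \<phi> k \<star> u \<longleftrightarrow> (\<exists>\<sigma>. is_square D \<sigma> h u u' k)"
  and v_square_unique: "\<lbrakk>is_square D \<sigma> h u u' k; is_square D \<tau> h u u' k\<rbrakk> \<Longrightarrow> \<sigma> = \<tau>"
proof -
  have c: "u \<in> Ar (VC D)" "u' \<in> Ar (VC D)"
    "h \<in> hom (HC D) (Src (VC D) u) (Src (VC D) u')" "iso_arrow (HC D) h"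
    "k \<in> hom (HC D) (Tgt (VC D) u) (Tgt (VC D) u')" "iso_arrow (HC D) k"
    using u hk by (simp_all add: in_hom)
  note s = shared[unfolded shared_iso_bijection_def, THEN conjunct2, THEN conjunct2, rule_format, OF c]
  show "u' \<star> \<phi> h = \<phi> k \<star> u \<longleftrightarrow> (\<exists>\<sigma>. is_square D \<sigma> h u u' k)"
    by (rule s[THEN conjunct1])
  show "\<lbrakk>is_square D \<sigma> h u u' k; is_square D \<tau> h u u' k\<rbrakk> \<Longrightarrow> \<sigma> = \<tau>"
    using s[THEN conjunct2] by blast
qed

end

text \<open>The conditions \<open>h_square_iff\<close> and \<open>v_square_iff\<close> trade places
  when \<open>\<phi>\<close> is replaced by its inverse, so nothing beyond rewriting with the
  inverse is involved.\<close>

lemma shared_transposed: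
  "shared_iso_bijection (transposed D) (inv_into {f. iso_arrow (HC D) f} \<phi>)"
proof -
  let ?\<psi> = "inv_into {f. iso_arrow (HC D) f} \<phi>"
  note b' = iso_bijection_inverse[OF phi_bijection]
  have \<psi>: "?\<psi> u \<in> hom (HC D) A B" "iso_arrow (HC D) (?\<psi> u)"
    if "u \<in> hom (VC D) A B" "iso_arrow (VC D) u" for u A B
    using b'(1) that unfolding iso_bijection_def in_hom by (auto dest: bij_betwE)
  show ?thesis
    unfolding shared_iso_bijection_def transposed_simps is_square_transposed
  proof (intro conjI allI impI)
    show "\<forall>A\<in>Ob (VC D). \<forall>B\<in>Ob (VC D).
        bij_betw ?\<psi> {f \<in> hom (VC D) A B. iso_arrow (VC D) f} {u \<in> hom (HC D) A B. iso_arrow (HC D) u}"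
      using b'(1) iso_bijection_iff[OF V.category H.category same_objects] by simp
  next
    fix f g h k
    assume a: "f \<in> Ar (VC D)" "g \<in> Ar (VC D)"
      "h \<in> hom (VC D) (Src (VC D) f) (Src (VC D) g)" "iso_arrow (VC D) h"
      "k \<in> hom (VC D) (Tgt (VC D) f) (Tgt (VC D) g)" "iso_arrow (VC D) k"
    note f = in_hom_self[OF a(1)] in_hom_self[OF a(2)] \<psi>[OF a(3,4)] \<psi>[OF a(5,6)]
    show "(k \<star> f = g \<star> h) = (\<exists>\<sigma>. is_square D \<sigma> (?\<psi> h) f g (?\<psi> k))"
      using v_square_iff[OF f] b'(3)[OF a(4)] b'(3)[OF a(6)] by auto
    show "\<sigma> = \<tau>" if "is_square D \<sigma> (?\<psi> h) f g (?\<psi> k)" "is_square D \<tau> (?\<psi> h) f g (?\<psi> k)" for \<sigma> \<tau>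
      using v_square_unique[OF f that] .
  next
    fix u u' h k
    assume a: "u \<in> Ar (HC D)" "u' \<in> Ar (HC D)"
      "h \<in> hom (VC D) (Src (HC D) u) (Src (HC D) u')" "iso_arrow (VC D) h"
      "k \<in> hom (VC D) (Tgt (HC D) u) (Tgt (HC D) u')" "iso_arrow (VC D) k"
    note u = in_hom_self[OF a(1)] in_hom_self[OF a(2)] \<psi>[OF a(3,4)] \<psi>[OF a(5,6)]
    show "(u' \<bullet> ?\<psi> h = ?\<psi> k \<bullet> u) = (\<exists>\<sigma>. is_square D \<sigma> u h k u')"
      using h_square_iff[OF u] b'(3)[OF a(4)] b'(3)[OF a(6)] by auto
    show "\<sigma> = \<tau>" if "is_square D \<sigma> u h k u'" "is_square D \<tau> u h k u'" for \<sigma> \<tau>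
      using h_square_unique[OF u] b'(3)[OF a(4)] b'(3)[OF a(6)] that by simp
  qed
qed

end

lemma abstract_cgw_transposed:
  assumes D: "double_category D" and a: "abstract_cgw D"
  shows "abstract_cgw (transposed D)"
proof -
  obtain \<phi> where "shared_iso_bijection D \<phi>"
    using a by (auto simp: abstract_cgw_def has_shared_isos_def)
  with D interpret shared_isos D \<phi>
    by unfold_locales
  have "has_shared_isos (transposed D)"
    using shared_transposed unfolding has_shared_isos_def by blast
  moreover have "extends_top_right (transposed D)" "extends_left_bottom (transposed D)"
    using a extends_transposed[OF D] extends_transposed[OF double_category_transposed[OF D]]
    by (simp_all add: abstract_cgw_def)
  ultimately show ?thesis
    using a by (simp add: abstract_cgw_def all_mono_transposed double_initial_transposed)
qed

section \<open>From CGW categories to abstract CGW categories\<close>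

text \<open>The kernel and cokernel axioms are literally exchanged. What has to be proved concerns
  the inverse of \<open>\<phi>\<close>: it is again functorial, and its pairs are again shared
  isomorphisms.\<close>

lemma cgw_structure_transposed:
  assumes D: "double_category D" and cgw: "cgw_structure D \<phi> k c"
  shows "cgw_structure (transposed D) (inv_into {f. iso_arrow (HC D) f} \<phi>) c k"
proof -
  interpret double_category_on D by unfold_locales (rule D)
  let ?\<psi> = "inv_into {f. iso_arrow (HC D) f} \<phi>"
  note iff = category_isomorphism_iff[OF H.category V.category same_objects[symmetric]]
  have b: "iso_bijection (HC D) (VC D) \<phi>"
    and ident: "\<And>A. A \<in> Ob (HC D) \<Longrightarrow> \<phi> (hid A) = vid A"
    and cmp: "\<And>f g. \<lbrakk>iso_arrow (HC D) f; iso_arrow (HC D) g; Tgt (HC D) f = Src (HC D) g\<rbrakk> \<Longrightarrow>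
      \<phi> (g \<bullet> f) = \<phi> g \<star> \<phi> f"
    using cgw unfolding cgw_structure_def iff by blast+
  note b' = iso_bijection_inverse[OF b]
  have \<psi>: "?\<psi> u \<in> hom (HC D) (Src (VC D) u) (Tgt (VC D) u)" "iso_arrow (HC D) (?\<psi> u)"
    if "iso_arrow (VC D) u" for u
    using b'(1) that unfolding iso_bijection_def by (auto dest: bij_betwE)
  have "category_isomorphism (max_subgroupoid (VC D)) (max_subgroupoid (HC D))
      \<lparr>on_ob = (\<lambda>A. A), on_ar = ?\<psi>\<rparr>"
    unfolding category_isomorphism_iff[OF V.category H.category same_objects]
  proof (intro conjI ballI allI impI)
    show "iso_bijection (VC D) (HC D) ?\<psi>"
      using b'(1) .
    show "?\<psi> (vid A) = hid A" if "A \<in> Ob (VC D)" for A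
      using that ident b'(2)[OF H.ident_iso] same_objects by metis
    fix u w assume a: "iso_arrow (VC D) u" "iso_arrow (VC D) w" "Tgt (VC D) u = Src (VC D) w"
    have t: "Tgt (HC D) (?\<psi> u) = Src (HC D) (?\<psi> w)"
      using \<psi>[OF a(1)] \<psi>[OF a(2)] a(3) by (simp add: in_hom)
    have "iso_arrow (HC D) (?\<psi> w \<bullet> ?\<psi> u)"
      using H.cmp_iso[of "?\<psi> u" _ "Src (VC D) w" "?\<psi> w"] \<psi>[OF a(1)] \<psi>[OF a(2)] a(3) by auto
    then show "?\<psi> (w \<star> u) = ?\<psi> w \<bullet> ?\<psi> u"
      using cmp[OF \<psi>(2)[OF a(1)] \<psi>(2)[OF a(2)] t] b'(2)[of "?\<psi> w \<bullet> ?\<psi> u"] b'(3) a(1,2) by simp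
  qed
  moreover have "shared_iso (transposed D) (Src (VC D) u) (Tgt (VC D) u) (u, ?\<psi> u)"
    if u: "iso_arrow (VC D) u" for u
  proof -
    have "shared_iso D (Src (HC D) (?\<psi> u)) (Tgt (HC D) (?\<psi> u)) (?\<psi> u, \<phi> (?\<psi> u))"
      using cgw \<psi>(2)[OF u] unfolding cgw_structure_def by blast
    then show ?thesis
      using \<psi>(1)[OF u] b'(3)[OF u] by (simp add: shared_iso_transposed in_hom)
  qed
  moreover have "kernel_axiom (transposed D) z c \<longleftrightarrow> cokernel_axiom D z c"
    "cokernel_axiom (transposed D) z k \<longleftrightarrow> kernel_axiom D z k" for z
    by (simp_all add: kernel_axiom_def cokernel_axiom_def)
  ultimately show ?thesis
    using cgw unfolding cgw_structure_def transposed_simps all_mono_transposed double_initial_transposed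
    by blast
qed

locale cgw_category = double_category_on D
  for D :: "('o, 'h, 'v, 's) double_cat" +
  fixes \<phi> k c
  assumes cgw: "cgw_structure D \<phi> k c"
begin

lemma transposed_cgw: "cgw_category (transposed D) (inv_into {f. iso_arrow (HC D) f} \<phi>) c k"
  using transposed cgw_structure_transposed[OF double_category cgw]
  by (simp add: cgw_category_def cgw_category_axioms_def)

sublocale k: equivalence_of "H_Dv D" "triangle_cat (HC D)" k
  using cgw HV.category H.category_triangle by unfold_locales (simp_all add: cgw_structure_def)

sublocale c: equivalence_of "V_Dh D" "triangle_cat (VC D)" c
  using cgw VH.category V.category_triangle by unfold_locales (simp_all add: cgw_structure_def)

lemma kernel_cod: "\<sigma> \<in> Sq D \<Longrightarrow> cs_cod (on_ar k \<sigma>) = sq_bottom D \<sigma>"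
  and cokernel_cod: "\<sigma> \<in> Sq D \<Longrightarrow> cs_cod (on_ar c \<sigma>) = sq_right D \<sigma>"
  and cokernel_tgt: "f \<in> Ar (HC D) \<Longrightarrow> Tgt (VC D) (on_ob c f) = Tgt (HC D) f"
  using cgw by (auto simp: cgw_structure_def kernel_axiom_def cokernel_axiom_def)

sublocale monic_double_category D
  using cgw by unfold_locales (simp add: cgw_structure_def)

sublocale iso_identification D \<phi>
  using cgw unfolding cgw_structure_def
    category_isomorphism_iff[OF H.category V.category same_objects[symmetric]]
  by unfold_locales blast

lemma phi_ident: "A \<in> Ob (HC D) \<Longrightarrow> \<phi> (hid A) = vid A"
  using cgw unfolding cgw_structure_def
    category_isomorphism_iff[OF H.category V.category same_objects[symmetric]] by blast

lemma iso_shared: "\<lbrakk>iso_arrow (HC D) f; f \<in> hom (HC D) A B\<rbrakk> \<Longrightarrow> shared_iso D A B (f, \<phi> f)"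
  using cgw by (auto simp: cgw_structure_def in_hom)

text \<open>The tops \<open>f\<close> and \<open>f'\<close> may differ a priori. That they agree is
  what later turns the existence of a square into an equation between horizontal morphisms.\<close>

lemma square_eq_bottom:
  assumes s: "is_square D \<sigma> f u w g" and t: "is_square D \<tau> f' u w g"
  shows "\<sigma> = \<tau>"
proof -
  have h: "\<sigma> \<in> hom (H_Dv D) u w" "\<tau> \<in> hom (H_Dv D) u w"
    using s t by (auto simp: in_hom_H_Dv)
  have cod: "cs_cod (on_ar k \<sigma>) = cs_cod (on_ar k \<tau>)"
    using kernel_cod square_sides[OF s] square_sides[OF t] by simp
  have "on_ar k \<sigma> = on_ar k \<tau>"
    using triangle_eq[OF functor_hom[OF k.is_functor h(1)] functor_hom[OF k.is_functor h(2)] cod] .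
  then show ?thesis
    by (rule k.faithful[OF h])
qed

lemma phi_square_iff:
  assumes f: "f \<in> hom (HC D) A A'" and g: "g \<in> hom (HC D) B B'"
    and h: "h \<in> hom (HC D) A B" "iso_arrow (HC D) h"
    and k: "k' \<in> hom (HC D) A' B'" "iso_arrow (HC D) k'"
  shows "k' \<bullet> f = g \<bullet> h \<longleftrightarrow> (\<exists>\<sigma>. is_square D \<sigma> f (\<phi> h) (\<phi> k') g)"
proof
  note sh = iso_shared[OF h(2,1), unfolded shared_iso_def prod.case]
    and sk = iso_shared[OF k(2,1), unfolded shared_iso_def prod.case]
  note hi = H.inv_hom[OF h(2,1)] and ki = H.inv_hom[OF k(2,1)]
  {
    assume eq: "k' \<bullet> f = g \<bullet> h"
    \<comment> \<open>From the two shared isomorphisms, only squares with an identity as top are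
      pasted to the identity square of \<open>f\<close>; so the top stays \<open>f\<close>, while
      the bottom becomes \<open>f\<close> conjugated by \<open>h\<close> and \<open>k'\<close>,
      which is \<open>g\<close>.\<close>
    obtain \<alpha> where a: "is_square D \<alpha> (hid A) (\<phi> h) (vid A) (inv_arrow (HC D) h)"
      using sh by blast
    obtain \<beta> where b: "is_square D \<beta> (hid A') (vid A') (\<phi> k') k'"
      using sk by blast
    have "is_square D (sq_hcomp D \<beta> (sq_hcomp D (sq_vid D f) \<alpha>)) (hid A' \<bullet> (f \<bullet> hid A)) (\<phi> h) (\<phi> k')
        (k' \<bullet> (f \<bullet> inv_arrow (HC D) h))"
      using square_hcomp[OF square_hcomp[OF a square_vid[OF f]] b] .
    moreover have "hid A' \<bullet> (f \<bullet> hid A) = f"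
      using H.ident_left[OF f] H.ident_right[OF f] by simp
    moreover have "k' \<bullet> (f \<bullet> inv_arrow (HC D) h) = g"
      using H.assoc[OF hi f k(1)] eq H.inv_right_cancel'[OF h(2,1) g] by simp
    ultimately show "\<exists>\<sigma>. is_square D \<sigma> f (\<phi> h) (\<phi> k') g"
      by auto
  }
  assume "\<exists>\<sigma>. is_square D \<sigma> f (\<phi> h) (\<phi> k') g"
  then obtain \<sigma> where s: "is_square D \<sigma> f (\<phi> h) (\<phi> k') g" by blast
  \<comment> \<open>The companions of the squares used above, again with identity tops: they replace
    the sides \<open>\<phi> h\<close> and \<open>\<phi> k'\<close> of the given square by
    identities, after which \<open>square_eq_bottom\<close> identifies the whole with an identity
    square.\<close>
  obtain \<alpha> where a: "is_square D \<alpha> (hid A) (vid A) (\<phi> h) h"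
    using sh by blast
  obtain \<beta> where b: "is_square D \<beta> (hid A') (\<phi> k') (vid A') (inv_arrow (HC D) k')"
    using sk by blast
  let ?f = "inv_arrow (HC D) k' \<bullet> (g \<bullet> h)"
  note gh = H.cmp_hom[OF h(1) g]
  have f': "?f \<in> hom (HC D) A A'"
    using H.cmp_hom[OF gh ki] .
  have "hid A' \<bullet> (f \<bullet> hid A) = f"
    using H.ident_left[OF f] H.ident_right[OF f] by simp
  then have sq: "is_square D (sq_hcomp D \<beta> (sq_hcomp D \<sigma> \<alpha>)) f (vid A) (vid A') ?f"
    using square_hcomp[OF square_hcomp[OF a s] b] by simp
  have "sq_hcomp D \<beta> (sq_hcomp D \<sigma> \<alpha>) = sq_vid D ?f"
    using square_eq_bottom[OF sq square_vid[OF f']] .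
  then have "f = ?f"
    using square_sides[OF sq] square_sides[OF square_vid[OF f']] by simp
  then show "k' \<bullet> f = g \<bullet> h"
    using H.inv_left_cancel'[OF k(2,1) gh] by simp
qed

end

text \<open>Once identities are preserved, functoriality of \<open>\<phi>\<close> and the four
  squares of each shared isomorphism follow from the two conditions on squares.\<close>

locale normalised_shared_isos = shared_isos D \<phi>
  for D :: "('o, 'h, 'v, 's) double_cat" and \<phi> +
  assumes phi_ident: "A \<in> Ob (HC D) \<Longrightarrow> \<phi> (hid A) = vid A"
begin

text \<open>One square is read twice. The trivial equation
  \<open>g \<bullet> f = (g \<bullet> f) \<bullet> hid A\<close> provides, by
  \<open>h_square_iff\<close>, a square with top \<open>f\<close>, right side
  \<open>\<phi> g\<close> and bottom \<open>g \<bullet> f\<close>; its top and bottom are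
  isomorphisms, so \<open>v_square_iff\<close> turns it into the vertical equation.\<close>

lemma phi_cmp:
  assumes f: "f \<in> hom (HC D) A B" "iso_arrow (HC D) f"
    and g: "g \<in> hom (HC D) B E" "iso_arrow (HC D) g"
  shows "\<phi> (g \<bullet> f) = \<phi> g \<star> \<phi> f"
proof -
  have A: "A \<in> Ob (HC D)"
    using H.hom_ob[OF f(1)] by simp
  note i = H.ident_hom[OF A] H.ident_iso[OF A]
  note gf = H.cmp_hom[OF f(1) g(1)] H.cmp_iso[OF f g]
  note p = phi_hom[OF f(2,1)] phi_hom[OF g(2,1)] phi_hom[OF gf(2,1)] phi_hom[OF i(2,1)]
  have "\<exists>\<sigma>. is_square D \<sigma> f (\<phi> (hid A)) (\<phi> g) (g \<bullet> f)"
    using h_square_iff[OF f(1) gf(1) i g] H.ident_right[OF gf(1)] by simp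
  then have "\<phi> g \<star> \<phi> f = \<phi> (g \<bullet> f) \<star> \<phi> (hid A)"
    using v_square_iff[OF p(4) p(2) f gf] by simp
  then show ?thesis
    using V.ident_right[OF p(3)] phi_ident[OF A] by simp
qed

lemma phi_inv:
  assumes f: "f \<in> hom (HC D) A B" "iso_arrow (HC D) f"
  shows "inv_arrow (VC D) (\<phi> f) = \<phi> (inv_arrow (HC D) f)"
proof (rule V.isoI(2)[OF phi_hom[OF f(2,1)]])
  note g = H.inv_hom[OF f(2,1)] H.inv_iso[OF f(2,1)]
  show "\<phi> (inv_arrow (HC D) f) \<in> hom (VC D) B A"
    using phi_hom[OF g(2,1)] .
  show "\<phi> (inv_arrow (HC D) f) \<star> \<phi> f = vid A" "\<phi> f \<star> \<phi> (inv_arrow (HC D) f) = vid B"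
    using phi_cmp[OF f g] phi_cmp[OF g f] H.inv_left[OF f(2,1)] H.inv_right[OF f(2,1)]
      phi_ident H.hom_ob[OF f(1)] by simp_all
qed

text \<open>Each of the four squares is an instance of \<open>h_square_iff\<close> in which one
  vertical side is \<open>\<phi>\<close> of an identity.\<close>

lemma phi_shared:
  assumes f: "iso_arrow (HC D) f" "f \<in> hom (HC D) A B"
  shows "shared_iso D A B (f, \<phi> f)"
proof -
  have AB: "A \<in> Ob (HC D)" "B \<in> Ob (HC D)"
    using H.hom_ob[OF f(2)] by auto
  note i = H.ident_hom[OF AB(1)] H.ident_iso[OF AB(1)] and j = H.ident_hom[OF AB(2)] H.ident_iso[OF AB(2)]
  note g = H.inv_hom[OF f] H.inv_iso[OF f]
  note ph = phi_ident[OF AB(1)] phi_ident[OF AB(2)] phi_inv[OF f(2,1)]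
  have "\<exists>\<sigma>. is_square D \<sigma> f (\<phi> f) (\<phi> (hid B)) (hid B)"
    using h_square_iff[OF f(2) j(1) f(2,1) j] by simp
  moreover have "\<exists>\<sigma>. is_square D \<sigma> (hid A) (\<phi> (hid A)) (\<phi> f) f"
    using h_square_iff[OF i(1) f(2) i f(2,1)] by simp
  moreover have "\<exists>\<sigma>. is_square D \<sigma> f (\<phi> (hid A)) (\<phi> (inv_arrow (HC D) f)) (hid A)"
    using h_square_iff[OF f(2) i(1) i g] H.inv_left[OF f] H.ident_left[OF i(1)] by simp
  moreover have "\<exists>\<sigma>. is_square D \<sigma> (hid A) (\<phi> f) (\<phi> (hid A)) (inv_arrow (HC D) f)"
    using h_square_iff[OF i(1) g(1) f(2,1) i] H.inv_left[OF f] H.ident_left[OF i(1)] by simp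
  ultimately show ?thesis
    unfolding shared_iso_def prod.case ph
    using f phi_hom[OF f] phi_iso[OF f(1)] by (intro conjI)
qed

text \<open>The vertical part is \<open>\<phi> g\<close> for some \<open>g\<close>, and the first
  square of the shared isomorphism, read through \<open>h_square_iff\<close>, forces
  \<open>f = g\<close>. Hence a shared isomorphism is determined by its horizontal part.\<close>

lemma shared_iso_phi:
  assumes "shared_iso D A B (f, u)"
  shows "u = \<phi> f"
proof -
  have f: "f \<in> hom (HC D) A B" "iso_arrow (HC D) f" and u: "u \<in> hom (VC D) A B" "iso_arrow (VC D) u"
    and sq: "\<exists>\<sigma>. is_square D \<sigma> f u (vid B) (hid B)"
    using assms by (auto simp: shared_iso_def)
  obtain g where g: "iso_arrow (HC D) g" "g \<in> hom (HC D) A B" "\<phi> g = u"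
    using phi_surj[OF u(2,1)] .
  have B: "B \<in> Ob (HC D)"
    using H.hom_ob[OF f(1)] by simp
  have "hid B \<bullet> f = hid B \<bullet> g"
    using h_square_iff[OF f(1) H.ident_hom[OF B] g(2,1) H.ident_hom[OF B] H.ident_iso[OF B]]
      sq g(3) phi_ident[OF B] by simp
  then show ?thesis
    using H.ident_left[OF f(1)] H.ident_left[OF g(2)] g(3) by simp
qed

lemma id_shared: "A \<in> Ob (HC D) \<Longrightarrow> shared_iso D A A (id_shared D A)"
  using phi_shared[OF H.ident_iso H.ident_hom] phi_ident by (simp add: id_shared_def)

end

context cgw_category
begin

lemma square_eq_right:
  assumes "is_square D \<sigma> f u w g" "is_square D \<tau> f u' w g"
  shows "\<sigma> = \<tau>"
  using cgw_category.square_eq_bottom[OF transposed_cgw, of \<sigma> u f g w \<tau> u'] assms by simp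

lemma shared_iso_bijection: "shared_iso_bijection D \<phi>"
  unfolding shared_iso_bijection_def
proof (intro conjI allI impI)
  let ?\<psi> = "inv_into {f. iso_arrow (HC D) f} \<phi>"
  note left = iso_bijection_inverse(2)[OF phi_bijection]
  show "\<forall>A\<in>Ob (HC D). \<forall>B\<in>Ob (HC D).
      bij_betw \<phi> {f \<in> hom (HC D) A B. iso_arrow (HC D) f} {u \<in> hom (VC D) A B. iso_arrow (VC D) u}"
    using phi_bijection iso_bijection_iff[OF H.category V.category same_objects[symmetric]] by simp
  show "\<sigma> = \<tau>" if "is_square D \<sigma> f (\<phi> h) (\<phi> k) g" "is_square D \<tau> f (\<phi> h) (\<phi> k) g" for \<sigma> \<tau> f g h k
    using square_eq_bottom[OF that] .
  show "\<sigma> = \<tau>" if "is_square D \<sigma> h u u' k" "is_square D \<tau> h u u' k" for \<sigma> \<tau> u u' h k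
    using square_eq_bottom[OF that] .
  show "k \<bullet> f = g \<bullet> h \<longleftrightarrow> (\<exists>\<sigma>. is_square D \<sigma> f (\<phi> h) (\<phi> k) g)"
    if "f \<in> Ar (HC D)" "g \<in> Ar (HC D)"
      "h \<in> hom (HC D) (Src (HC D) f) (Src (HC D) g)" "iso_arrow (HC D) h"
      "k \<in> hom (HC D) (Tgt (HC D) f) (Tgt (HC D) g)" "iso_arrow (HC D) k" for f g h k
    using phi_square_iff[OF in_hom_self[OF that(1)] in_hom_self[OF that(2)] that(3-6)] .
  show "u' \<star> \<phi> h = \<phi> k \<star> u \<longleftrightarrow> (\<exists>\<sigma>. is_square D \<sigma> h u u' k)"
    if "u \<in> Ar (VC D)" "u' \<in> Ar (VC D)"
      "h \<in> hom (HC D) (Src (VC D) u) (Src (VC D) u')" "iso_arrow (HC D) h"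
      "k \<in> hom (HC D) (Tgt (VC D) u) (Tgt (VC D) u')" "iso_arrow (HC D) k" for u u' h k
    \<comment> \<open>The condition on vertical morphisms is the horizontal one in the transposed
      double category, applied to \<open>\<phi> h\<close> and \<open>\<phi> k\<close>, which the
      inverse bijection sends back to \<open>h\<close> and \<open>k\<close>.\<close>
    using cgw_category.phi_square_iff[OF transposed_cgw, unfolded transposed_simps is_square_transposed,
        OF in_hom_self[OF that(1)] in_hom_self[OF that(2)] phi_hom[OF that(4,3)] phi_iso[OF that(4)]
          phi_hom[OF that(6,5)] phi_iso[OF that(6)]]
      left[OF that(4)] left[OF that(6)] by auto
qed

sublocale normalised_shared_isos D \<phi>
  using shared_iso_bijection phi_ident by unfold_locales

section \<open>Extending a top and a right side to a square in a CGW category\<close>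

lemma cokernel_hom:
  assumes "is_square D \<sigma> f u w g"
  shows "on_ar c \<sigma> \<in> hom (triangle_cat (VC D)) (on_ob c f) (on_ob c g)" "cs_cod (on_ar c \<sigma>) = w"
proof -
  have "\<sigma> \<in> hom (V_Dh D) f g"
    using assms by (auto simp: in_hom_V_Dh)
  then show "on_ar c \<sigma> \<in> hom (triangle_cat (VC D)) (on_ob c f) (on_ob c g)"
    by (rule functor_hom[OF c.is_functor])
  show "cs_cod (on_ar c \<sigma>) = w"
    using cokernel_cod square_sides[OF assms] by auto
qed

lemma cokernel_arrow:
  assumes "f \<in> hom (HC D) A B"
  shows "on_ob c f \<in> hom (VC D) (Src (VC D) (on_ob c f)) B"
proof -
  have "on_ob c f \<in> Ar (VC D)"
    using functor_ob[OF c.is_functor, of f] assms by (simp add: in_hom V_Dh_def)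
  then show ?thesis
    using cokernel_tgt[of f] assms by (simp add: in_hom)
qed

text \<open>Fullness of \<open>c\<close> gives a square from \<open>f\<close> to \<open>g\<close>
  over the prescribed commutative square; its right side is \<open>w\<close> because
  \<open>c\<close> keeps right sides as codomain components. The left side is whatever
  results.\<close>

lemma cokernel_full:
  assumes f: "f \<in> hom (HC D) A B" and g: "g \<in> hom (HC D) A' B'" and w: "w \<in> hom (VC D) B B'"
    and s: "s \<in> hom (VC D) (Src (VC D) (on_ob c f)) (Src (VC D) (on_ob c g))" "iso_arrow (VC D) s"
    and eq: "on_ob c g \<star> s = w \<star> on_ob c f"
  obtains \<sigma> u where "is_square D \<sigma> f u w g"
proof -
  note cf = cokernel_arrow[OF f] and cg = cokernel_arrow[OF g]
  let ?d = "CommSq (on_ob c f) s w (on_ob c g)"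
  have "Tgt (VC D) (on_ob c f) = B" "Tgt (VC D) (on_ob c g) = B'"
    "on_ob c f \<in> Ar (VC D)" "on_ob c g \<in> Ar (VC D)"
    using cf cg by (simp_all add: in_hom)
  then have d: "?d \<in> hom (triangle_cat (VC D)) (on_ob c f) (on_ob c g)"
    using w s eq by (simp add: in_hom_triangle)
  have "f \<in> Ob (V_Dh D)" "g \<in> Ob (V_Dh D)"
    using f g by (simp_all add: in_hom V_Dh_def)
  then obtain \<sigma> where \<sigma>: "\<sigma> \<in> hom (V_Dh D) f g" "on_ar c \<sigma> = ?d"
    using d by (rule c.full)
  obtain u w' where sq: "is_square D \<sigma> f u w' g"
    using \<sigma>(1) by (auto simp: in_hom_V_Dh)
  then show ?thesis
    using that cokernel_hom(2)[OF sq] \<sigma>(2) by simp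
qed

lemma top_right_square:
  assumes f: "f \<in> hom (HC D) A B" and w: "w \<in> hom (VC D) B E"
  obtains \<sigma> u g where "is_square D \<sigma> f u w g"
proof -
  note cf = cokernel_arrow[OF f]
  let ?v = "w \<star> on_ob c f"
  have v: "?v \<in> hom (VC D) (Src (VC D) (on_ob c f)) E"
    using V.cmp_hom[OF cf w] .
  then have "?v \<in> Ob (triangle_cat (VC D))"
    by (simp add: in_hom)
  \<comment> \<open>The isomorphism \<open>d\<close> also has a component \<open>?t\<close> on
    codomains, so \<open>x\<close> need not end in \<open>E\<close>.\<close>
  then obtain x d where x: "x \<in> Ob (V_Dh D)" and d: "d \<in> hom (triangle_cat (VC D)) ?v (on_ob c x)"
    and di: "iso_arrow (triangle_cat (VC D)) d"
    by (rule c.essentially_surjective)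
  have x': "x \<in> hom (HC D) (Src (HC D) x) (Tgt (HC D) x)"
    using x by (simp add: in_hom V_Dh_def)
  note cx = cokernel_arrow[OF x']
  let ?t = "cs_cod d"
  have t: "?t \<in> hom (VC D) E (Tgt (HC D) x)" "iso_arrow (VC D) ?t"
    and s: "cs_dom d \<in> hom (VC D) (Src (VC D) (on_ob c f)) (Src (VC D) (on_ob c x))" "iso_arrow (VC D) (cs_dom d)"
    and eq: "on_ob c x \<star> cs_dom d = ?t \<star> ?v"
    using d[unfolded in_hom_triangle] V.triangle_iso_cod[OF d di] v cx[unfolded in_hom]
    by (simp_all add: in_hom)
  have eq': "on_ob c x \<star> cs_dom d = (?t \<star> w) \<star> on_ob c f"
    using eq V.assoc[OF cf w t(1)] by simp
  obtain \<sigma> u where \<sigma>: "is_square D \<sigma> f u (?t \<star> w) x"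
    using cokernel_full[OF f x' V.cmp_hom[OF w t(1)] s eq'] .
  \<comment> \<open>The horizontal counterpart of the inverse of \<open>?t\<close>. Composing
    \<open>x\<close> with it gives a bottom side that ends in \<open>E\<close>, and the square
    \<open>\<tau>\<close> pasted below cancels \<open>?t\<close> on the right.\<close>
  obtain h where h: "iso_arrow (HC D) h" "h \<in> hom (HC D) (Tgt (HC D) x) E" "\<phi> h = inv_arrow (VC D) ?t"
    using phi_surj[OF V.inv_iso[OF t(2,1)] V.inv_hom[OF t(2,1)]] .
  let ?X = "Src (HC D) x"
  have X: "?X \<in> Ob (HC D)"
    using H.hom_ob[OF x'] by simp
  note hx = H.cmp_hom[OF x' h(2)]
  obtain \<tau> where "is_square D \<tau> x (\<phi> (hid ?X)) (\<phi> h) (h \<bullet> x)"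
    using phi_square_iff[OF x' hx H.ident_hom[OF X] H.ident_iso[OF X] h(2,1)] H.ident_right[OF hx] by auto
  then have "is_square D (sq_vcomp D \<tau> \<sigma>) f (\<phi> (hid ?X) \<star> u) (inv_arrow (VC D) ?t \<star> (?t \<star> w)) (h \<bullet> x)"
    using square_vcomp[OF \<sigma>] h(3) by simp
  moreover have "inv_arrow (VC D) ?t \<star> (?t \<star> w) = w"
    using V.inv_left_cancel[OF t(2,1) w] .
  ultimately show ?thesis
    using that by simp
qed

text \<open>The cokernels of \<open>g\<close> and \<open>g'\<close> are both
  \<open>w \<star> on_ob c f\<close> up to an isomorphism of domains. Composing one of these
  isomorphisms with the inverse of the other relates them over the identity of \<open>E\<close>, and
  \<open>cokernel_full\<close> makes a square of it.\<close>

lemma top_right_comparison: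
  assumes s: "is_square D \<sigma> f u w g" and t: "is_square D \<tau> f u' w g'" and w: "w \<in> hom (VC D) B E"
  obtains \<rho> v where "is_square D \<rho> g v (vid E) g'"
proof -
  note cs = cokernel_hom[OF s] and ct = cokernel_hom[OF t]
  have f: "f \<in> hom (HC D) (Src (HC D) f) B"
    and g: "g \<in> hom (HC D) (Src (HC D) g) E" and g': "g' \<in> hom (HC D) (Src (HC D) g') E"
    using square_ar[OF s] square_ar[OF t] sq_corners[OF double_category, of \<sigma>]
      sq_corners[OF double_category, of \<tau>] square_sides[OF s] square_sides[OF t] w
    by (auto simp: in_hom)
  note cf = cokernel_arrow[OF f] and cg = cokernel_arrow[OF g] and cg' = cokernel_arrow[OF g']
  let ?s = "cs_dom (on_ar c \<sigma>)" and ?s' = "cs_dom (on_ar c \<tau>)"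
  have s1: "?s \<in> hom (VC D) (Src (VC D) (on_ob c f)) (Src (VC D) (on_ob c g))" "iso_arrow (VC D) ?s"
    and s2: "?s' \<in> hom (VC D) (Src (VC D) (on_ob c f)) (Src (VC D) (on_ob c g'))" "iso_arrow (VC D) ?s'"
    and eq: "on_ob c g \<star> ?s = w \<star> on_ob c f" "on_ob c g' \<star> ?s' = w \<star> on_ob c f"
    using cs ct by (auto simp: in_hom_triangle)
  note si = V.inv_hom[OF s1(2,1)] V.inv_iso[OF s1(2,1)]
  let ?r = "?s' \<star> inv_arrow (VC D) ?s"
  have r: "?r \<in> hom (VC D) (Src (VC D) (on_ob c g)) (Src (VC D) (on_ob c g'))" "iso_arrow (VC D) ?r"
    using V.cmp_hom[OF si(1) s2(1)] V.cmp_iso[OF si s2] by auto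
  have "on_ob c g' \<star> ?r = (on_ob c g \<star> ?s) \<star> inv_arrow (VC D) ?s"
    using V.assoc[OF si(1) s2(1) cg'] eq by simp
  also have "\<dots> = vid E \<star> on_ob c g"
    using V.inv_right_cancel'[OF s1(2,1) cg] V.ident_left[OF cg] by simp
  finally have eq': "on_ob c g' \<star> ?r = vid E \<star> on_ob c g" .
  have "vid E \<in> hom (VC D) E E"
    using V.ident_hom V.hom_ob[OF w] by blast
  then show ?thesis
    using cokernel_full[OF g g' _ r eq'] that by blast
qed

lemma extends_top_right: "extends_top_right D"
  unfolding extends_top_right_def
proof (intro ballI impI conjI)
  fix f w assume a: "f \<in> Ar (HC D)" "w \<in> Ar (VC D)" and eq: "Tgt (HC D) f = Src (VC D) w"
  let ?A = "Src (HC D) f" and ?B = "Tgt (HC D) f" and ?E = "Tgt (VC D) w"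
  have f: "f \<in> hom (HC D) ?A ?B" and w: "w \<in> hom (VC D) ?B ?E"
    using a eq by (auto simp: in_hom)
  show "\<exists>\<sigma>\<in>Sq D. sq_top D \<sigma> = f \<and> sq_right D \<sigma> = w"
    using top_right_square[OF f w] unfolding is_square_def by metis
  fix \<sigma> \<tau> assume "\<sigma> \<in> Sq D" "\<tau> \<in> Sq D" "sq_top D \<sigma> = f" "sq_right D \<sigma> = w"
    "sq_top D \<tau> = f" "sq_right D \<tau> = w"
  then obtain l g l' g' where s: "is_square D \<sigma> f l w g" and t: "is_square D \<tau> f l' w g'"
    by (auto simp: is_square_def)
  let ?C = "Src (HC D) g" and ?C' = "Src (HC D) g'"
  have g: "g \<in> hom (HC D) ?C ?E" and g': "g' \<in> hom (HC D) ?C' ?E"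
    and l: "l \<in> hom (VC D) ?A ?C" and l': "l' \<in> hom (VC D) ?A ?C'"
    using square_ar[OF s] square_ar[OF t] sq_corners[OF double_category, of \<sigma>]
      sq_corners[OF double_category, of \<tau>] square_sides[OF s] square_sides[OF t]
    by (auto simp: in_hom)
  have ob: "?A \<in> Ob (HC D)" "?B \<in> Ob (HC D)" "?E \<in> Ob (HC D)" "?C \<in> Ob (HC D)" "?C' \<in> Ob (HC D)"
    using H.hom_ob[OF f] H.hom_ob[OF g] H.hom_ob[OF g'] by auto
  obtain \<rho> v where \<rho>: "is_square D \<rho> g v (vid ?E) g'"
    using top_right_comparison[OF s t w] .
  obtain \<rho>' v' where \<rho>': "is_square D \<rho>' g' v' (vid ?E) g"
    using top_right_comparison[OF t s w] .
  note v = square_hom(1)[OF \<rho> g g'] and v' = square_hom(1)[OF \<rho>' g' g]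
  have E: "vid ?E \<in> hom (VC D) ?E ?E"
    using square_hom(2)[OF \<rho> g g'] .
  \<comment> \<open>Pasting the two comparisons gives a square with top and bottom \<open>g\<close>
    and an identity on the right; \<open>square_eq_right\<close> makes it the identity square of
    \<open>g\<close>, so its left side is an identity.\<close>
  have v'v: "is_square D (sq_vcomp D \<rho>' \<rho>) g (v' \<star> v) (vid ?E) g"
    using square_vcomp[OF \<rho> \<rho>'] V.ident_left[OF E] by simp
  have inv1: "v' \<star> v = vid ?C"
    using square_eq_right[OF v'v square_vid[OF g]] square_sides[OF v'v] square_sides[OF square_vid[OF g]]
    by simp
  have vv': "is_square D (sq_vcomp D \<rho> \<rho>') g' (v \<star> v') (vid ?E) g'"
    using square_vcomp[OF \<rho>' \<rho>] V.ident_left[OF E] by simp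
  have inv2: "v \<star> v' = vid ?C'"
    using square_eq_right[OF vv' square_vid[OF g']] square_sides[OF vv'] square_sides[OF square_vid[OF g']]
    by simp
  have vi: "iso_arrow (VC D) v"
    using V.isoI(1)[OF v v' inv1 inv2] .
  \<comment> \<open>The horizontal half of the connecting isomorphism. The square
    \<open>\<rho>\<close> now has sides \<open>\<phi> h\<close> and \<open>\<phi> (hid ?E)\<close>,
    so it says that \<open>g' \<bullet> h = g\<close>.\<close>
  obtain h where h: "iso_arrow (HC D) h" "h \<in> hom (HC D) ?C ?C'" "\<phi> h = v"
    using phi_surj[OF vi v] .
  have g'h: "g' \<bullet> h = g"
    using phi_square_iff[OF g g' h(2,1) H.ident_hom[OF ob(3)] H.ident_iso[OF ob(3)]] \<rho> h(3)
      phi_ident[OF ob(3)] H.ident_left[OF g] by auto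
  \<comment> \<open>This square shares top, right and bottom sides with \<open>\<tau>\<close>, hence
    equals it: this gives both the vertical cube condition and the equation for the left
    sides.\<close>
  have comp: "is_square D (sq_vcomp D \<rho> \<sigma>) f (v \<star> l) w g'"
    using square_vcomp[OF s \<rho>] V.ident_left[OF w] by simp
  have \<rho>\<sigma>: "sq_vcomp D \<rho> \<sigma> = \<tau>" "v \<star> l = l'"
    using square_eq_right[OF comp t] square_sides[OF comp] square_sides[OF t] by simp_all
  note hidA = H.ident_hom[OF ob(1)] H.ident_iso[OF ob(1)]
  obtain \<gamma> where \<gamma>: "is_square D \<gamma> (hid ?A) l l' h"
    using v_square_iff[OF l l' hidA h(2,1)] phi_ident[OF ob(1)] V.ident_right[OF l'] h(3) \<rho>\<sigma>(2) by auto
  have "is_square D (sq_hcomp D \<tau> \<gamma>) f l w g"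
    using square_hcomp[OF \<gamma> t] g'h H.ident_right[OF f] by simp
  from square_eq_bottom[OF this s] have \<tau>\<gamma>: "sq_hcomp D \<tau> \<gamma> = \<sigma>" .
  have sides: "sq_top D \<sigma> = f" "sq_top D \<tau> = f" "sq_bottom D \<sigma> = g" "sq_bottom D \<tau> = g'"
    "sq_left D \<sigma> = l" "sq_left D \<tau> = l'" "sq_right D \<sigma> = w" "sq_right D \<tau> = w"
    "\<sigma> \<in> Sq D" "\<tau> \<in> Sq D" "Tgt (HC D) g = ?E" "Tgt (HC D) g' = ?E"
    using square_sides[OF s] square_sides[OF t] g g' by (simp_all add: in_hom)
  let ?iso = "\<lambda>\<theta>. square_iso D \<sigma> \<tau> (id_shared D ?A) (id_shared D ?B) \<theta> (id_shared D ?E)"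
  show "\<exists>!\<theta>. ?iso \<theta>"
  proof (rule ex1I)
    have cyl1: "\<exists>\<gamma> \<rho>. is_square D \<gamma> (hid ?A) l l' h \<and> is_square D \<rho> (hid ?B) w w (hid ?E) \<and>
        sq_hcomp D \<tau> \<gamma> = sq_hcomp D \<rho> \<sigma>"
      using \<gamma> square_hid[OF w] \<tau>\<gamma> hcomp_hid(1)[OF s] by metis
    have cyl2: "\<exists>\<alpha> \<beta>. is_square D \<alpha> f (vid ?A) (vid ?B) f \<and> is_square D \<beta> g v (vid ?E) g' \<and>
        sq_vcomp D \<tau> \<alpha> = sq_vcomp D \<beta> \<sigma>"
      using \<rho> square_vid[OF f] \<rho>\<sigma>(1) vcomp_vid(2)[OF t] by metis
    have sh: "shared_iso D ?C ?C' (h, v)"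
      using phi_shared[OF h(1,2)] h(3) by simp
    show "?iso (h, v)"
      unfolding square_iso_def sides id_shared_def fst_conv snd_conv
      using id_shared[OF ob(1)] id_shared[OF ob(2)] id_shared[OF ob(3)] sh cyl1 cyl2
        H.ident_left[OF f] H.ident_right[OF f] g'h H.ident_left[OF g] V.ident_right[OF l']
        \<rho>\<sigma>(2) V.ident_left[OF w] V.ident_right[OF w]
      unfolding id_shared_def by (intro conjI sides refl) simp_all
    fix \<theta> assume "?iso \<theta>"
    then have th: "shared_iso D ?C ?C' \<theta>" "g' \<bullet> fst \<theta> = hid ?E \<bullet> g"
      unfolding square_iso_def sides id_shared_def fst_conv snd_conv by blast+
    obtain x y where xy: "\<theta> = (x, y)" by (cases \<theta>)
    have "x \<in> hom (HC D) ?C ?C'"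
      using th(1) by (simp add: xy shared_iso_def)
    \<comment> \<open>Monicity of \<open>g'\<close> settles the horizontal half; the vertical half
      of a shared isomorphism is \<open>\<phi>\<close> of it.\<close>
    then have "x = h"
      using h_mono[OF g' _ h(2)] th(2) g'h H.ident_left[OF g] by (simp add: xy)
    moreover have "y = \<phi> x"
      using shared_iso_phi th(1) xy by simp
    ultimately show "\<theta> = (h, v)"
      using xy h(3) by simp
  qed
qed

lemma abstract: "abstract_cgw D"
proof -
  have "extends_left_bottom D"
    using cgw_category.extends_top_right[OF transposed_cgw] extends_transposed[OF double_category] by simp
  then show ?thesis
    using extends_top_right shared_iso_bijection cgw
    unfolding abstract_cgw_def has_shared_isos_def cgw_structure_def by blast
qed

end

section \<open>From abstract CGW categories to CGW categories\<close>

text \<open>A bijection as in the definition of shared isomorphisms need not preserve identities: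
  it may be altered by an automorphism of the identity functor. Precomposing with the
  automorphism \<open>e\<close> that it sends to the identities makes it functorial.\<close>

lemma (in shared_isos) normalisable: "\<exists>\<psi>. normalised_shared_isos D \<psi>"
proof -
  have "\<exists>e. iso_arrow (HC D) e \<and> e \<in> hom (HC D) A A \<and> \<phi> e = vid A" if "A \<in> Ob (HC D)" for A
    using phi_surj[OF V.ident_iso V.ident_hom] same_objects that by metis
  then obtain e where e: "\<And>A. A \<in> Ob (HC D) \<Longrightarrow> e A \<in> hom (HC D) A A"
      "\<And>A. A \<in> Ob (HC D) \<Longrightarrow> iso_arrow (HC D) (e A)"
      "\<And>A. A \<in> Ob (HC D) \<Longrightarrow> \<phi> (e A) = vid A"
    by metis
  \<comment> \<open>The identity square of \<open>f\<close> has sides \<open>\<phi> (e A)\<close>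
    and \<open>\<phi> (e B)\<close>, so \<open>h_square_iff\<close> reads it as this
    equation.\<close>
  have e_natural: "e B \<bullet> f = f \<bullet> e A" if f: "f \<in> hom (HC D) A B" for f A B
  proof -
    note o1 = H.hom_ob[OF f, THEN conjunct1] and o2 = H.hom_ob[OF f, THEN conjunct2]
    have "\<exists>\<sigma>. is_square D \<sigma> f (\<phi> (e A)) (\<phi> (e B)) f"
      using square_vid[OF f] e(3)[OF o1] e(3)[OF o2] by auto
    then show ?thesis
      using h_square_iff[OF f f e(1,2)[OF o1] e(1,2)[OF o2]] by simp
  qed
  \<comment> \<open>Dually, \<open>v_square_iff\<close> reads the identity square of
    \<open>u\<close> as naturality of \<open>\<phi> (hid A)\<close> in \<open>A\<close>.\<close>
  have id_natural: "u \<star> \<phi> (hid A) = \<phi> (hid B) \<star> u" if u: "u \<in> hom (VC D) A B" for u A B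
  proof -
    have o1: "A \<in> Ob (HC D)" and o2: "B \<in> Ob (HC D)"
      using V.hom_ob[OF u] same_objects by auto
    show ?thesis
      using v_square_iff[OF u u H.ident_hom[OF o1] H.ident_iso[OF o1] H.ident_hom[OF o2] H.ident_iso[OF o2]]
        square_hid[OF u] by auto
  qed
  define \<psi> where "\<psi> h = \<phi> (h \<bullet> e (Src (HC D) h))" for h
  have \<psi>: "\<psi> h = \<phi> (h \<bullet> e A)" if "h \<in> hom (HC D) A B" for h A B
    using that by (simp add: \<psi>_def in_hom)
  have he: "h \<bullet> e A \<in> hom (HC D) A B \<and> iso_arrow (HC D) (h \<bullet> e A)"
    if "h \<in> hom (HC D) A B" "iso_arrow (HC D) h" for h A B
  proof -
    note o1 = H.hom_ob[OF that(1), THEN conjunct1]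
    show ?thesis
      using H.cmp_hom[OF e(1)[OF o1] that(1)] H.cmp_iso[OF e(1,2)[OF o1] that] by simp
  qed
  \<comment> \<open>A square provided by \<open>h_square_iff\<close> is read through
    \<open>v_square_iff\<close>. So \<open>\<phi>\<close> and \<open>\<psi>\<close> differ by the
    natural automorphism \<open>\<phi> (hid A)\<close>, which cancels from both sides of the
    condition on vertical morphisms.\<close>
  have \<phi>\<psi>: "\<phi> h = \<psi> h \<star> \<phi> (hid A)" if h: "h \<in> hom (HC D) A B" "iso_arrow (HC D) h" for h A B
  proof -
    note A = H.hom_ob[OF h(1), THEN conjunct1]
    note he' = he[OF h, THEN conjunct1] he[OF h, THEN conjunct2]
    note i = H.ident_hom[OF A] H.ident_iso[OF A]
    have "\<exists>\<sigma>. is_square D \<sigma> (e A) (\<phi> (hid A)) (\<phi> h) (h \<bullet> e A)"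
      using h_square_iff[OF e(1)[OF A] he'(1) i h] H.ident_right[OF he'(1)] by simp
    then have "\<phi> h \<star> \<phi> (e A) = \<phi> (h \<bullet> e A) \<star> \<phi> (hid A)"
      using v_square_iff[OF phi_hom[OF i(2,1)] phi_hom[OF h(2,1)] e(1,2)[OF A] he'] by simp
    then show ?thesis
      using V.ident_right[OF phi_hom[OF h(2,1)]] e(3)[OF A] \<psi>[OF h(1)] by simp
  qed
  have "shared_iso_bijection D \<psi>"
    unfolding shared_iso_bijection_def
  proof (intro conjI allI impI ballI)
    fix A B assume A: "A \<in> Ob (HC D)" and B: "B \<in> Ob (HC D)"
    let ?S = "{f \<in> hom (HC D) A B. iso_arrow (HC D) f}"
    let ?i = "inv_arrow (HC D) (e A)"
    note eA = e(1,2)[OF A]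
    note i = H.inv_hom[OF eA(2,1)] H.inv_iso[OF eA(2,1)]
    have "bij_betw (\<lambda>h. h \<bullet> e A) ?S ?S"
    proof (rule bij_betw_byWitness[where f' = "\<lambda>h. h \<bullet> ?i"])
      show "(\<lambda>h. h \<bullet> e A) ` ?S \<subseteq> ?S" "(\<lambda>h. h \<bullet> ?i) ` ?S \<subseteq> ?S"
        using H.cmp_hom[OF eA(1)] H.cmp_iso[OF eA] H.cmp_hom[OF i(1)] H.cmp_iso[OF i] by auto
      show "\<forall>h\<in>?S. h \<bullet> e A \<bullet> ?i = h" "\<forall>h\<in>?S. h \<bullet> ?i \<bullet> e A = h"
        using H.inv_right_cancel'[OF eA(2,1)] H.inv_right_cancel[OF eA(2,1)] by auto
    qed
    moreover have "bij_betw \<phi> ?S {u \<in> hom (VC D) A B. iso_arrow (VC D) u}"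
      using shared A B by (simp add: shared_iso_bijection_def)
    ultimately have "bij_betw (\<phi> \<circ> (\<lambda>h. h \<bullet> e A)) ?S {u \<in> hom (VC D) A B. iso_arrow (VC D) u}"
      by (rule bij_betw_trans)
    then show "bij_betw \<psi> ?S {u \<in> hom (VC D) A B. iso_arrow (VC D) u}"
      by (rule iffD1[OF bij_betw_cong, rotated]) (auto simp: \<psi>)
  next
    fix f g h k
    assume a: "f \<in> Ar (HC D)" "g \<in> Ar (HC D)"
      "h \<in> hom (HC D) (Src (HC D) f) (Src (HC D) g)" "iso_arrow (HC D) h"
      "k \<in> hom (HC D) (Tgt (HC D) f) (Tgt (HC D) g)" "iso_arrow (HC D) k"
    let ?A = "Src (HC D) f" and ?B = "Tgt (HC D) f"
    note f = in_hom_self[OF a(1)] and g = in_hom_self[OF a(2)]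
    have A: "?A \<in> Ob (HC D)" and B: "?B \<in> Ob (HC D)"
      using H.hom_ob[OF f] by auto
    note h' = he[OF a(3,4), THEN conjunct1] he[OF a(3,4), THEN conjunct2]
    note k' = he[OF a(5,6), THEN conjunct1] he[OF a(5,6), THEN conjunct2]
    have "(k \<bullet> e ?B) \<bullet> f = (k \<bullet> f) \<bullet> e ?A"
      using H.assoc[OF f e(1)[OF B] a(5)] e_natural[OF f] H.assoc[OF e(1)[OF A] f a(5)] by simp
    moreover have "g \<bullet> (h \<bullet> e ?A) = (g \<bullet> h) \<bullet> e ?A"
      using H.assoc[OF e(1)[OF A] a(3) g] by simp
    ultimately have "k \<bullet> f = g \<bullet> h \<longleftrightarrow> (k \<bullet> e ?B) \<bullet> f = g \<bullet> (h \<bullet> e ?A)"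
      using H.iso_cancel_right[OF e(2,1)[OF A] H.cmp_hom[OF f a(5)] H.cmp_hom[OF a(3) g]] by auto
    then show "k \<bullet> f = g \<bullet> h \<longleftrightarrow> (\<exists>\<sigma>. is_square D \<sigma> f (\<psi> h) (\<psi> k) g)"
      using h_square_iff[OF f g h' k'] \<psi>[OF a(3)] \<psi>[OF a(5)] by simp
    show "\<sigma> = \<tau>" if "is_square D \<sigma> f (\<psi> h) (\<psi> k) g" "is_square D \<tau> f (\<psi> h) (\<psi> k) g" for \<sigma> \<tau>
      using h_square_unique[OF f g h' k'] \<psi>[OF a(3)] \<psi>[OF a(5)] that by simp
  next
    fix u u' h k
    assume a: "u \<in> Ar (VC D)" "u' \<in> Ar (VC D)"
      "h \<in> hom (HC D) (Src (VC D) u) (Src (VC D) u')" "iso_arrow (HC D) h"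
      "k \<in> hom (HC D) (Tgt (VC D) u) (Tgt (VC D) u')" "iso_arrow (HC D) k"
    let ?A = "Src (VC D) u" and ?B = "Tgt (VC D) u"
    note u = in_hom_self[OF a(1)] and u' = in_hom_self[OF a(2)]
    have A: "?A \<in> Ob (HC D)" and B: "?B \<in> Ob (HC D)"
      using V.hom_ob[OF u] same_objects by auto
    let ?c = "\<phi> (hid ?A)" and ?d = "\<phi> (hid ?B)"
    have c: "?c \<in> hom (VC D) ?A ?A" "iso_arrow (VC D) ?c" and d: "?d \<in> hom (VC D) ?B ?B"
      using phi_hom phi_iso H.ident_hom H.ident_iso A B by auto
    have \<psi>hom: "\<psi> h \<in> hom (VC D) ?A (Src (VC D) u')" "\<psi> k \<in> hom (VC D) ?B (Tgt (VC D) u')"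
      using \<psi>[OF a(3)] \<psi>[OF a(5)] he[OF a(3,4)] he[OF a(5,6)] phi_hom by auto
    have "u' \<star> \<phi> h = (u' \<star> \<psi> h) \<star> ?c"
      using \<phi>\<psi>[OF a(3,4)] V.assoc[OF c(1) \<psi>hom(1) u'] by simp
    moreover have "\<phi> k \<star> u = (\<psi> k \<star> u) \<star> ?c"
      using \<phi>\<psi>[OF a(5,6)] V.assoc[OF u d \<psi>hom(2)] V.assoc[OF c(1) u \<psi>hom(2)] id_natural[OF u] by simp
    ultimately have "u' \<star> \<psi> h = \<psi> k \<star> u \<longleftrightarrow> u' \<star> \<phi> h = \<phi> k \<star> u"
      using V.iso_cancel_right[OF c(2,1) V.cmp_hom[OF \<psi>hom(1) u'] V.cmp_hom[OF u \<psi>hom(2)]] by auto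
    then show "u' \<star> \<psi> h = \<psi> k \<star> u \<longleftrightarrow> (\<exists>\<sigma>. is_square D \<sigma> h u u' k)"
      using v_square_iff[OF u u' a(3-6)] by simp
    show "\<sigma> = \<tau>" if "is_square D \<sigma> h u u' k" "is_square D \<tau> h u u' k" for \<sigma> \<tau>
      using v_square_unique[OF u u' a(3-6) that] .
  qed
  moreover have "\<psi> (hid A) = vid A" if A: "A \<in> Ob (HC D)" for A
    using \<psi>[OF H.ident_hom[OF A]] H.ident_left[OF e(1)[OF A]] e(3)[OF A] by simp
  ultimately have "normalised_shared_isos D \<psi>"
    by unfold_locales
  then show ?thesis
    by blast
qed

section \<open>Comparison of squares in an abstract CGW category\<close>

locale abstract_cgw_category = normalised_shared_isos D \<phi>
  for D :: "('o, 'h, 'v, 's) double_cat" and \<phi> +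
  fixes z
  assumes abstract: "abstract_cgw D" and initial: "double_initial D z"
begin

sublocale monic_double_category D
  using abstract by unfold_locales (simp add: abstract_cgw_def)

lemma left_bottom_square:
  assumes u: "u \<in> hom (VC D) A C" and g: "g \<in> hom (HC D) C E"
  obtains \<sigma> f w where "is_square D \<sigma> f u w g"
proof -
  have "\<exists>\<sigma>\<in>Sq D. sq_left D \<sigma> = u \<and> sq_bottom D \<sigma> = g"
    using abstract u g unfolding abstract_cgw_def extends_left_bottom_def in_hom by simp
  then show ?thesis
    using that unfolding is_square_def by blast
qed

text \<open>The isomorphism comes from \<open>extends_left_bottom\<close>, and
  \<open>shared_iso_phi\<close> writes its vertical half as \<open>\<phi> h\<close>. The horizontal
  cube condition is retained because it identifies the squares themselves once \<open>h\<close> is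
  an identity.\<close>

lemma left_bottom_comparison:
  assumes s: "is_square D \<sigma> f u w g" and t: "is_square D \<tau> f' u w' g"
  obtains h where "iso_arrow (HC D) h" "h \<in> hom (HC D) (Tgt (HC D) f) (Tgt (HC D) f')"
    "f' = h \<bullet> f" "w' \<star> \<phi> h = w"
    "\<exists>\<gamma> \<rho>. is_square D \<gamma> (hid (Src (HC D) f)) u u (hid (Tgt (VC D) u)) \<and>
       is_square D \<rho> h w w' (hid (Tgt (VC D) w)) \<and> sq_hcomp D \<tau> \<gamma> = sq_hcomp D \<rho> \<sigma>"
proof -
  note ss = square_sides[OF s] and st = square_sides[OF t]
  note cs = sq_corners[OF double_category, of \<sigma>] and ct = sq_corners[OF double_category, of \<tau>]
  have c: "Src (HC D) f = Src (VC D) u" "Src (HC D) f' = Src (VC D) u"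
    "Tgt (VC D) u = Src (HC D) g" "Tgt (VC D) w = Tgt (HC D) g"
    using cs ct ss st by auto
  obtain \<theta> where \<theta>: "square_iso D \<sigma> \<tau> (id_shared D (Src (VC D) u)) \<theta>
      (id_shared D (Src (HC D) g)) (id_shared D (Tgt (HC D) g))"
    using abstract square_ar[OF s] c(3) ss st
    unfolding abstract_cgw_def extends_left_bottom_def by blast
  obtain h v where hv: "\<theta> = (h, v)" by (cases \<theta>)
  have \<theta>': "shared_iso D (Tgt (HC D) f) (Tgt (HC D) f') (h, v)"
    "f' \<bullet> hid (Src (VC D) u) = h \<bullet> f" "w' \<star> v = vid (Tgt (HC D) g) \<star> w"
    "\<exists>\<gamma> \<rho>. is_square D \<gamma> (hid (Src (VC D) u)) u u (hid (Src (HC D) g)) \<and>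
       is_square D \<rho> h w w' (hid (Tgt (HC D) g)) \<and> sq_hcomp D \<tau> \<gamma> = sq_hcomp D \<rho> \<sigma>"
    using \<theta> ss st by (simp_all add: square_iso_def id_shared_def hv)
  have f': "f' \<in> hom (HC D) (Src (VC D) u) (Tgt (HC D) f')"
    and w: "w \<in> hom (VC D) (Src (VC D) w) (Tgt (HC D) g)"
    using square_ar[OF s] square_ar[OF t] c by (auto simp: in_hom)
  show ?thesis
  proof (rule that)
    show "iso_arrow (HC D) h" "h \<in> hom (HC D) (Tgt (HC D) f) (Tgt (HC D) f')"
      using \<theta>'(1) by (simp_all add: shared_iso_def)
    show "f' = h \<bullet> f" "w' \<star> \<phi> h = w"
      using \<theta>'(2,3) H.ident_right[OF f'] V.ident_left[OF w] shared_iso_phi[OF \<theta>'(1)] by simp_all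
    show "\<exists>\<gamma> \<rho>. is_square D \<gamma> (hid (Src (HC D) f)) u u (hid (Tgt (VC D) u)) \<and>
       is_square D \<rho> h w w' (hid (Tgt (VC D) w)) \<and> sq_hcomp D \<tau> \<gamma> = sq_hcomp D \<rho> \<sigma>"
      using \<theta>'(4) c by simp
  qed
qed

text \<open>The comparison \<open>h\<close> of two such squares satisfies
  \<open>w \<star> \<phi> h = w\<close>, so monicity of \<open>w\<close> makes \<open>h\<close> an
  identity. The side faces of the cube are then identity squares, and the cube condition says that
  the two squares are equal.\<close>

lemma square_eq_bottom:
  assumes s: "is_square D \<sigma> f u w g" and t: "is_square D \<tau> f' u w g"
  shows "\<sigma> = \<tau>"
proof -
  obtain h \<gamma> \<rho> where h: "iso_arrow (HC D) h" "h \<in> hom (HC D) (Tgt (HC D) f) (Tgt (HC D) f')"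
    and f': "f' = h \<bullet> f" and w: "w \<star> \<phi> h = w"
    and \<gamma>: "is_square D \<gamma> (hid (Src (HC D) f)) u u (hid (Tgt (VC D) u))"
    and \<rho>: "is_square D \<rho> h w w (hid (Tgt (VC D) w))"
    and eq: "sq_hcomp D \<tau> \<gamma> = sq_hcomp D \<rho> \<sigma>"
    using left_bottom_comparison[OF s t] by metis
  let ?B = "Src (VC D) w" and ?E = "Tgt (VC D) w"
  note ss = square_sides[OF s] and st = square_sides[OF t]
  have c: "Src (HC D) f = Src (VC D) u" "Tgt (HC D) f = ?B" "Tgt (HC D) f' = ?B"
    using sq_corners[OF double_category, of \<sigma>] sq_corners[OF double_category, of \<tau>] ss st by auto
  have u: "u \<in> hom (VC D) (Src (VC D) u) (Tgt (VC D) u)" and w': "w \<in> hom (VC D) ?B ?E"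
    using square_ar[OF s] by (auto simp: in_hom)
  have ob: "Src (VC D) u \<in> Ob (HC D)" "Tgt (VC D) u \<in> Ob (HC D)" "?B \<in> Ob (HC D)" "?E \<in> Ob (HC D)"
    using V.hom_ob[OF u] V.hom_ob[OF w'] same_objects by auto
  have hB: "h \<in> hom (HC D) ?B ?B"
    using h(2) c by simp
  have "\<phi> h = vid ?B"
    using v_mono[OF w' phi_hom[OF h(1) hB] V.ident_hom] w V.ident_right[OF w'] ob(3) same_objects by simp
  then have "h = hid ?B"
    using phi_bijection phi_ident[OF ob(3)] h(1) H.ident_iso[OF ob(3)]
    unfolding iso_bijection_def bij_betw_def by (metis inj_onD mem_Collect_eq)
  then have "\<rho> = sq_hid D w"
    using v_square_unique[OF w' w' H.ident_hom[OF ob(3)] H.ident_iso[OF ob(3)]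
        H.ident_hom[OF ob(4)] H.ident_iso[OF ob(4)]] \<rho> square_hid[OF w'] by simp
  moreover have "\<gamma> = sq_hid D u"
    using v_square_unique[OF u u H.ident_hom[OF ob(1)] H.ident_iso[OF ob(1)]
        H.ident_hom[OF ob(2)] H.ident_iso[OF ob(2)]] \<gamma> square_hid[OF u] c(1) by simp
  ultimately show ?thesis
    using eq hcomp_hid(1)[OF s] hcomp_hid(2)[OF t] by simp
qed

lemma top_right_square:
  assumes f: "f \<in> hom (HC D) A B" and w: "w \<in> hom (VC D) B E"
  obtains \<sigma> u g where "is_square D \<sigma> f u w g"
proof -
  have "\<exists>\<sigma>\<in>Sq D. sq_top D \<sigma> = f \<and> sq_right D \<sigma> = w"
    using abstract f w unfolding abstract_cgw_def extends_top_right_def in_hom by simp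
  then show ?thesis
    using that unfolding is_square_def by blast
qed

lemma top_right_comparison:
  assumes s: "is_square D \<sigma> f u w g" and t: "is_square D \<tau> f u' w g'"
  obtains h where "iso_arrow (HC D) h" "h \<in> hom (HC D) (Src (HC D) g) (Src (HC D) g')" "g' \<bullet> h = g"
proof -
  note ss = square_sides[OF s] and st = square_sides[OF t]
  have c: "Tgt (HC D) f = Src (VC D) w" "Tgt (HC D) g = Tgt (VC D) w"
    using sq_corners[OF double_category, of \<sigma>] ss by auto
  obtain \<theta> where \<theta>: "square_iso D \<sigma> \<tau> (id_shared D (Src (HC D) f)) (id_shared D (Tgt (HC D) f)) \<theta>
      (id_shared D (Tgt (VC D) w))"
    using abstract square_ar[OF s] c(1) ss st
    unfolding abstract_cgw_def extends_top_right_def by blast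
  obtain h v where hv: "\<theta> = (h, v)" by (cases \<theta>)
  have \<theta>': "shared_iso D (Src (HC D) g) (Src (HC D) g') (h, v)" "g' \<bullet> h = hid (Tgt (VC D) w) \<bullet> g"
    using \<theta> ss st by (simp_all add: square_iso_def id_shared_def hv)
  have g: "g \<in> hom (HC D) (Src (HC D) g) (Tgt (VC D) w)"
    using square_ar[OF s] c by (auto simp: in_hom)
  show ?thesis
    using that[of h] \<theta>' H.ident_left[OF g] by (simp add: shared_iso_def)
qed

section \<open>The kernel functor of an abstract CGW category\<close>

abbreviation "h0 \<equiv> from_initial (HC D) z"
abbreviation "v0 \<equiv> from_initial (VC D) z"

lemma h0: "A \<in> Ob (HC D) \<Longrightarrow> h0 A \<in> hom (HC D) z A"
  and v0: "A \<in> Ob (HC D) \<Longrightarrow> v0 A \<in> hom (VC D) z A"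
  and h0_eq: "f \<in> hom (HC D) z A \<Longrightarrow> f = h0 A"
  and v0_eq: "u \<in> hom (VC D) z A \<Longrightarrow> u = v0 A"
  using initial H.from_initial_hom H.from_initial_eq V.from_initial_hom V.from_initial_eq same_objects
  unfolding double_initial_def by metis+

lemma z_object: "z \<in> Ob (HC D)"
  using initial by (simp add: double_initial_def initial_object_def)

definition ker :: "'v \<Rightarrow> 'h" where
  "ker w = (SOME m. \<exists>\<sigma> u. is_square D \<sigma> (h0 (Src (VC D) w)) u w m)"

lemma ker:
  assumes w: "w \<in> hom (VC D) A B"
  shows "ker w \<in> hom (HC D) (Src (HC D) (ker w)) B"
    "\<exists>\<sigma>. is_square D \<sigma> (h0 A) (v0 (Src (HC D) (ker w))) w (ker w)"
proof -
  have A: "A \<in> Ob (HC D)" "Src (VC D) w = A" "Tgt (VC D) w = B"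
    using V.hom_ob[OF w] w same_objects by (auto simp: in_hom)
  have "\<exists>m \<sigma> u. is_square D \<sigma> (h0 A) u w m"
    using top_right_square[OF h0[OF A(1)] w] by metis
  then have "\<exists>\<sigma> u. is_square D \<sigma> (h0 A) u w (ker w)"
    unfolding ker_def A(2) by (rule someI_ex)
  then obtain \<sigma> u where s: "is_square D \<sigma> (h0 A) u w (ker w)"
    by blast
  have m: "ker w \<in> hom (HC D) (Src (HC D) (ker w)) B"
    using square_ar[OF s] sq_corners[OF double_category, of \<sigma>] square_sides[OF s] A(3)
    by (auto simp: in_hom)
  show "ker w \<in> hom (HC D) (Src (HC D) (ker w)) B"
    by (rule m)
  have "u = v0 (Src (HC D) (ker w))"
    using square_hom(1)[OF s h0[OF A(1)] m] by (rule v0_eq)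
  then show "\<exists>\<sigma>. is_square D \<sigma> (h0 A) (v0 (Src (HC D) (ker w))) w (ker w)"
    using s by blast
qed

text \<open>The choice of the domain component is harmless: \<open>ker (sq_right D \<sigma>)\<close>
  is monic, so at most one arrow satisfies the equation. The bottom side is stored as codomain
  component, as \<open>kernel_axiom\<close> demands.\<close>

definition kernel :: "('v, 's, 'h, 'h comm_sq) functor_data" where
  "kernel = \<lparr>on_ob = ker,
     on_ar = (\<lambda>\<sigma>. CommSq (ker (sq_left D \<sigma>))
       (SOME s. iso_arrow (HC D) s \<and>
          s \<in> hom (HC D) (Src (HC D) (ker (sq_left D \<sigma>))) (Src (HC D) (ker (sq_right D \<sigma>))) \<and>
          ker (sq_right D \<sigma>) \<bullet> s = sq_bottom D \<sigma> \<bullet> ker (sq_left D \<sigma>))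
       (sq_bottom D \<sigma>) (ker (sq_right D \<sigma>)))\<rparr>"

lemma kernel_ob: "on_ob kernel = ker"
  by (simp add: kernel_def)

lemma kernel_cod: "cs_cod (on_ar kernel \<sigma>) = sq_bottom D \<sigma>"
  by (simp add: kernel_def)

text \<open>Pasting \<open>\<sigma>\<close> to the right of the kernel square of \<open>u\<close>
  gives a square with right side \<open>w\<close> whose top starts at \<emptyset>. Its bottom is
  \<open>g \<bullet> ker u\<close>, and uniqueness for top and right sides compares it with
  \<open>ker w\<close> through an isomorphism of domains.\<close>

lemma kernel_hom:
  assumes s: "is_square D \<sigma> f u w g"
  shows "on_ar kernel \<sigma> \<in> hom (triangle_cat (HC D)) (ker u) (ker w)"
proof -
  let ?A = "Src (VC D) u" and ?B = "Tgt (VC D) u" and ?A' = "Src (VC D) w" and ?B' = "Tgt (VC D) w"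
  note ss = square_sides[OF s]
  have u: "u \<in> hom (VC D) ?A ?B" and w: "w \<in> hom (VC D) ?A' ?B'"
    using square_ar[OF s] by (auto simp: in_hom)
  note f = square_hom'(1)[OF s u w] and g = square_hom'(2)[OF s u w]
  have A: "?A \<in> Ob (HC D)"
    using H.hom_ob[OF f] by simp
  note ku = ker[OF u] and kw = ker[OF w]
  obtain \<alpha> \<beta> where a: "is_square D \<alpha> (h0 ?A) (v0 (Src (HC D) (ker u))) u (ker u)"
    and b: "is_square D \<beta> (h0 ?A') (v0 (Src (HC D) (ker w))) w (ker w)"
    using ku(2) kw(2) by blast
  have c: "is_square D (sq_hcomp D \<sigma> \<alpha>) (h0 ?A') (v0 (Src (HC D) (ker u))) w (g \<bullet> ker u)"
    using square_hcomp[OF a s] h0_eq[OF H.cmp_hom[OF h0[OF A] f]] by simp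
  note gk = H.cmp_hom[OF ku(1) g]
  have "Src (HC D) (g \<bullet> ker u) = Src (HC D) (ker u)"
    using gk by (simp add: in_hom)
  then have "\<exists>s. iso_arrow (HC D) s \<and> s \<in> hom (HC D) (Src (HC D) (ker u)) (Src (HC D) (ker w)) \<and>
      ker w \<bullet> s = g \<bullet> ker u"
    using top_right_comparison[OF c b] by metis
  then have "iso_arrow (HC D) (cs_dom (on_ar kernel \<sigma>)) \<and>
      cs_dom (on_ar kernel \<sigma>) \<in> hom (HC D) (Src (HC D) (ker u)) (Src (HC D) (ker w)) \<and>
      ker w \<bullet> cs_dom (on_ar kernel \<sigma>) = g \<bullet> ker u"
    using ss by (simp add: kernel_def) (rule someI_ex)
  moreover have "ker u \<in> Ar (HC D)" "ker w \<in> Ar (HC D)" "Tgt (HC D) (ker u) = ?B" "Tgt (HC D) (ker w) = ?B'"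
    using ku(1) kw(1) by (simp_all add: in_hom)
  ultimately show ?thesis
    using ss g by (simp add: in_hom_triangle kernel_cod) (simp add: kernel_def)
qed

text \<open>By \<open>triangle_eq\<close> both functor laws need only be compared on codomain
  components, which are bottom sides of squares and compose as those do.\<close>

lemma kernel_functor: "is_functor (H_Dv D) (triangle_cat (HC D)) kernel"
  unfolding is_functor_def kernel_ob
proof (intro conjI ballI impI)
  interpret T: category_on "triangle_cat (HC D)"
    by unfold_locales (rule H.category_triangle)
  have H: "\<sigma> \<in> Ar (H_Dv D) \<Longrightarrow> \<sigma> \<in> Sq D" "Src (H_Dv D) \<sigma> = sq_left D \<sigma>" "Tgt (H_Dv D) \<sigma> = sq_right D \<sigma>" for \<sigma>
    by (simp_all add: H_Dv_def)
  show ker_ob: "ker w \<in> Ob (triangle_cat (HC D))" if "w \<in> Ob (H_Dv D)" for w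
    using ker(1)[OF in_hom_self[of w]] that by (simp add: H_Dv_def in_hom)
  show "on_ar kernel \<sigma> \<in> hom (triangle_cat (HC D)) (ker (Src (H_Dv D) \<sigma>)) (ker (Tgt (H_Dv D) \<sigma>))"
    if "\<sigma> \<in> Ar (H_Dv D)" for \<sigma>
    using kernel_hom[OF square_self] H that by simp
  show "on_ar kernel (Ident (H_Dv D) w) = Ident (triangle_cat (HC D)) (ker w)" if w: "w \<in> Ob (H_Dv D)" for w
  proof -
    have w': "w \<in> hom (VC D) (Src (VC D) w) (Tgt (VC D) w)"
      using w by (simp add: H_Dv_def in_hom)
    note sq = square_hid[OF w']
    have "Ident (H_Dv D) w = sq_hid D w"
      by (simp add: H_Dv_def)
    then show ?thesis
      using triangle_eq[OF kernel_hom[OF sq] T.ident_hom[OF ker_ob[OF w]]] kernel_cod square_sides[OF sq]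
        ker(1)[OF w'] by (simp add: in_hom)
  qed
  fix \<sigma> \<tau> assume a: "\<sigma> \<in> Ar (H_Dv D)" "\<tau> \<in> Ar (H_Dv D)" "Tgt (H_Dv D) \<sigma> = Src (H_Dv D) \<tau>"
  have s: "is_square D \<sigma> (sq_top D \<sigma>) (sq_left D \<sigma>) (sq_right D \<sigma>) (sq_bottom D \<sigma>)"
    and t: "is_square D \<tau> (sq_top D \<tau>) (sq_right D \<sigma>) (sq_right D \<tau>) (sq_bottom D \<tau>)"
    using square_self[of \<sigma>] square_self[of \<tau>] a(3) H(1)[OF a(1)] H(1)[OF a(2)]
    unfolding H(2,3) by simp_all
  note st = square_hcomp[OF s t]
  note hs = kernel_hom[OF s] and ht = kernel_hom[OF t]
  have "\<tau> \<cdot>\<^bsub>H_Dv D\<^esub> \<sigma> = sq_hcomp D \<tau> \<sigma>"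
    by (simp add: H_Dv_def)
  then show "on_ar kernel (\<tau> \<cdot>\<^bsub>H_Dv D\<^esub> \<sigma>) = on_ar kernel \<tau> \<cdot>\<^bsub>triangle_cat (HC D)\<^esub> on_ar kernel \<sigma>"
    using triangle_eq[OF kernel_hom[OF st] H.triangle_cmp_hom[OF hs ht]] kernel_cod square_sides[OF st] by simp
qed

lemma kernel_full:
  assumes u: "u \<in> hom (VC D) A B" and w: "w \<in> hom (VC D) A' B'"
    and d: "d \<in> hom (triangle_cat (HC D)) (ker u) (ker w)"
  obtains \<sigma> f where "is_square D \<sigma> f u w (cs_cod d)" "on_ar kernel \<sigma> = d"
proof -
  note ku = ker[OF u] and kw = ker[OF w]
  let ?K = "Src (HC D) (ker u)" and ?L = "Src (HC D) (ker w)"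
  have g: "cs_cod d \<in> hom (HC D) B B'" and s: "cs_dom d \<in> hom (HC D) ?K ?L" "iso_arrow (HC D) (cs_dom d)"
    and eq: "ker w \<bullet> cs_dom d = cs_cod d \<bullet> ker u"
    using d[unfolded in_hom_triangle] ku(1) kw(1) by (simp_all add: in_hom)
  have ob: "?K \<in> Ob (HC D)" "?L \<in> Ob (HC D)" "A \<in> Ob (HC D)" "A' \<in> Ob (HC D)" "B' \<in> Ob (HC D)"
    using H.hom_ob[OF s(1)] V.hom_ob[OF u] V.hom_ob[OF w] same_objects by auto
  obtain \<alpha> \<beta> where a: "is_square D \<alpha> (h0 A) (v0 ?K) u (ker u)"
    and b: "is_square D \<beta> (h0 A') (v0 ?L) w (ker w)"
    using ku(2) kw(2) by blast
  \<comment> \<open>Left and bottom sides are as desired; the right side \<open>w''\<close> still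
    has to be replaced by \<open>w\<close>.\<close>
  obtain \<tau> f w'' where t: "is_square D \<tau> f u w'' (cs_cod d)"
    using left_bottom_square[OF u g] .
  have w'': "w'' \<in> hom (VC D) (Src (VC D) w'') B'"
    using square_ar[OF t] sq_corners[OF double_category, of \<tau>] square_sides[OF t] g by (simp add: in_hom)
  note f = square_hom'(1)[OF t u w'']
  have ta: "is_square D (sq_hcomp D \<tau> \<alpha>) (f \<bullet> h0 A) (v0 ?K) w'' (cs_cod d \<bullet> ker u)"
    using square_hcomp[OF a t] .
  note zi = H.ident_hom[OF z_object] H.ident_iso[OF z_object]
  \<comment> \<open>Both composites start at \<emptyset>. The resulting square shifts the kernel
    square of \<open>w\<close> along \<open>cs_dom d\<close>, so that its left side ends in
    \<open>?K\<close>.\<close>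
  have "v0 ?L \<star> \<phi> (hid z) = \<phi> (cs_dom d) \<star> v0 ?K"
    using v0_eq[OF V.cmp_hom[OF phi_hom[OF zi(2,1)] v0[OF ob(2)]]]
      v0_eq[OF V.cmp_hom[OF v0[OF ob(1)] phi_hom[OF s(2,1)]]] by simp
  then obtain \<delta> where "is_square D \<delta> (hid z) (v0 ?K) (v0 ?L) (cs_dom d)"
    using v_square_iff[OF v0[OF ob(1)] v0[OF ob(2)] zi s] by blast
  then have bd: "is_square D (sq_hcomp D \<beta> \<delta>) (h0 A') (v0 ?K) w (cs_cod d \<bullet> ker u)"
    using square_hcomp[OF _ b] H.ident_right[OF h0[OF ob(4)]] eq by metis
  have "Tgt (HC D) (f \<bullet> h0 A) = Src (VC D) w''" "Tgt (HC D) (h0 A') = A'"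
    using H.cmp_hom[OF h0[OF ob(3)] f] h0[OF ob(4)] by (simp_all add: in_hom)
  \<comment> \<open>The squares \<open>ta\<close> and \<open>bd\<close> have the same left and
    bottom sides, so their right sides \<open>w''\<close> and \<open>w\<close> differ by an
    isomorphism.\<close>
  then obtain h where h: "iso_arrow (HC D) h" "h \<in> hom (HC D) (Src (VC D) w'') A'" "w \<star> \<phi> h = w''"
    using left_bottom_comparison[OF ta bd] by metis
  note Bi = H.ident_hom[OF ob(5)] H.ident_iso[OF ob(5)]
  have "w \<star> \<phi> h = \<phi> (hid B') \<star> w''"
    using h(3) phi_ident[OF ob(5)] V.ident_left[OF w''] by simp
  \<comment> \<open>Pasted to the right of \<open>\<tau>\<close>, this square exchanges
    \<open>w''\<close> for \<open>w\<close> and leaves the bottom unchanged.\<close>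
  then obtain \<epsilon> where e: "is_square D \<epsilon> h w'' w (hid B')"
    using v_square_iff[OF w'' w h(2,1) Bi] by blast
  have sq: "is_square D (sq_hcomp D \<epsilon> \<tau>) (h \<bullet> f) u w (cs_cod d)"
    using square_hcomp[OF t e] H.ident_left[OF g] by simp
  have "on_ar kernel (sq_hcomp D \<epsilon> \<tau>) = d"
    using triangle_eq[OF kernel_hom[OF sq] d] kernel_cod square_sides[OF sq] by simp
  with sq show ?thesis
    by (rule that)
qed

text \<open>Completing the vertical morphism from \<emptyset> to \<open>K\<close> together with
  \<open>f\<close> gives a square whose top also starts at \<emptyset>, so \<open>f\<close> has the
  shape of a kernel of the right side \<open>w\<close>. The chosen kernel of \<open>w\<close>
  differs from it by an isomorphism of domains, and the identity serves on codomains.\<close>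

lemma kernel_essentially_surjective:
  assumes f: "f \<in> hom (HC D) K B"
  obtains w d where "w \<in> Ar (VC D)" "d \<in> hom (triangle_cat (HC D)) (ker w) f"
    "iso_arrow (triangle_cat (HC D)) d"
proof -
  have ob: "K \<in> Ob (HC D)" "B \<in> Ob (HC D)"
    using H.hom_ob[OF f] by auto
  obtain \<sigma> t w where s: "is_square D \<sigma> t (v0 K) w f"
    using left_bottom_square[OF v0[OF ob(1)] f] .
  have w: "w \<in> hom (VC D) (Src (VC D) w) B"
    using square_ar[OF s] sq_corners[OF double_category, of \<sigma>] square_sides[OF s] f by (simp add: in_hom)
  have "t = h0 (Src (VC D) w)"
    using h0_eq[OF square_hom'(1)[OF s v0[OF ob(1)] w]] .
  with s have s: "is_square D \<sigma> (h0 (Src (VC D) w)) (v0 K) w f"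
    by simp
  note kw = ker[OF w]
  obtain \<beta> where "is_square D \<beta> (h0 (Src (VC D) w)) (v0 (Src (HC D) (ker w))) w (ker w)"
    using kw(2) by blast
  then obtain h where h: "iso_arrow (HC D) h" "h \<in> hom (HC D) (Src (HC D) (ker w)) (Src (HC D) f)"
      "f \<bullet> h = ker w"
    using top_right_comparison[OF _ s] by metis
  let ?d = "CommSq (ker w) h (hid B) f"
  have d: "?d \<in> hom (triangle_cat (HC D)) (ker w) f"
    unfolding in_hom_triangle comm_sq.sel
    using h kw(1) f H.ident_hom[OF ob(2)] H.ident_left[OF kw(1)] by (simp add: in_hom)
  moreover have "iso_arrow (triangle_cat (HC D)) ?d"
    using H.triangle_iso[OF d] H.ident_iso[OF ob(2)] by simp
  moreover have "w \<in> Ar (VC D)"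
    using w by (simp add: in_hom)
  ultimately show ?thesis
    using that by simp
qed

lemma kernel_equivalence: "category_equivalence (H_Dv D) (triangle_cat (HC D)) kernel"
proof (rule category_equivalenceI[OF HV.category H.category_triangle kernel_functor])
  fix u w d
  assume "u \<in> Ob (H_Dv D)" "w \<in> Ob (H_Dv D)" "d \<in> hom (triangle_cat (HC D)) (on_ob kernel u) (on_ob kernel w)"
  then have "u \<in> Ar (VC D)" "w \<in> Ar (VC D)" "d \<in> hom (triangle_cat (HC D)) (ker u) (ker w)"
    by (simp_all add: H_Dv_def kernel_ob)
  then obtain \<sigma> f where "is_square D \<sigma> f u w (cs_cod d)" "on_ar kernel \<sigma> = d"
    using kernel_full[OF in_hom_self in_hom_self] by metis
  then show "\<exists>\<sigma>\<in>hom (H_Dv D) u w. on_ar kernel \<sigma> = d"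
    unfolding in_hom_H_Dv[symmetric] using in_hom_H_Dv by blast
next
  fix u w \<sigma> \<tau>
  assume "\<sigma> \<in> hom (H_Dv D) u w" "\<tau> \<in> hom (H_Dv D) u w" and eq: "on_ar kernel \<sigma> = on_ar kernel \<tau>"
  then obtain f g f' g' where s: "is_square D \<sigma> f u w g" and t: "is_square D \<tau> f' u w g'"
    unfolding in_hom_H_Dv by blast
  have "g = g'"
    using eq kernel_cod[of \<sigma>] kernel_cod[of \<tau>] square_sides[OF s] square_sides[OF t] by simp
  then show "\<sigma> = \<tau>"
    using square_eq_bottom s t by simp
next
  fix f assume "f \<in> Ob (triangle_cat (HC D))"
  then have "f \<in> Ar (HC D)" by simp
  then obtain w d where "w \<in> Ar (VC D)" "d \<in> hom (triangle_cat (HC D)) (ker w) f"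
      "iso_arrow (triangle_cat (HC D)) d"
    using kernel_essentially_surjective[OF in_hom_self] by metis
  then show "\<exists>w\<in>Ob (H_Dv D). \<exists>d\<in>hom (triangle_cat (HC D)) (on_ob kernel w) f.
      iso_arrow (triangle_cat (HC D)) d"
    unfolding kernel_ob by (auto simp: H_Dv_def)
qed

lemma kernel_axiom: "kernel_axiom D z kernel"
  unfolding kernel_axiom_def kernel_ob
proof (intro conjI ballI)
  fix w assume "w \<in> Ar (VC D)"
  then have k: "ker w \<in> hom (HC D) (Src (HC D) (ker w)) (Tgt (VC D) w)"
      "\<exists>\<sigma>. is_square D \<sigma> (h0 (Src (VC D) w)) (v0 (Src (HC D) (ker w))) w (ker w)"
    using ker[OF in_hom_self] by simp_all
  then show "Tgt (HC D) (ker w) = Tgt (VC D) w"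
    by (simp add: in_hom)
  show "\<exists>!\<sigma>. is_square D \<sigma> (h0 (Src (VC D) w)) (v0 (Src (HC D) (ker w))) w (ker w)"
    using k(2) square_eq_bottom by blast
qed (rule kernel_cod)

end

text \<open>The initial object is a parameter because \<open>cgw_structure\<close> demands one
  \<open>z\<close> for both the kernel and the cokernel axiom, and the cokernel is obtained by
  applying this to the transposed double category.\<close>

lemma abstract_cgw_kernel:
  assumes D: "double_category D" and a: "abstract_cgw D" and z: "double_initial D z"
  shows "\<exists>k. category_equivalence (H_Dv D) (triangle_cat (HC D)) k \<and> kernel_axiom D z k"
proof -
  obtain \<phi> where "shared_iso_bijection D \<phi>"
    using a by (auto simp: abstract_cgw_def has_shared_isos_def)
  with D have "shared_isos D \<phi>"
    by unfold_locales
  then obtain \<psi> where "normalised_shared_isos D \<psi>"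
    using shared_isos.normalisable by blast
  then interpret abstract_cgw_category D \<psi> z
    using a z by (simp add: abstract_cgw_category_def abstract_cgw_category_axioms_def)
  show ?thesis
    using kernel_equivalence kernel_axiom by blast
qed

lemma abstract_cgw_structure:
  assumes D: "double_category D" and a: "abstract_cgw D"
  shows "\<exists>\<phi> k c. cgw_structure D \<phi> k c"
proof -
  obtain z where z: "double_initial D z"
    using a by (auto simp: abstract_cgw_def)
  obtain k where k: "category_equivalence (H_Dv D) (triangle_cat (HC D)) k" "kernel_axiom D z k"
    using abstract_cgw_kernel[OF D a z] by blast
  obtain c where c: "category_equivalence (V_Dh D) (triangle_cat (VC D)) c" "cokernel_axiom D z c"
    using abstract_cgw_kernel[OF double_category_transposed[OF D] abstract_cgw_transposed[OF D a], of z] z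
    unfolding double_initial_transposed transposed_simps
    by (auto simp: kernel_axiom_def cokernel_axiom_def)
  obtain \<phi>' where "shared_iso_bijection D \<phi>'"
    using a by (auto simp: abstract_cgw_def has_shared_isos_def)
  with D have "shared_isos D \<phi>'"
    by unfold_locales
  \<comment> \<open>The bijection \<open>\<phi>'\<close> need not be functorial; its normalisation
    is, as an isomorphism of the maximal subgroupoids must be.\<close>
  then obtain \<phi> where "normalised_shared_isos D \<phi>"
    using shared_isos.normalisable by blast
  then interpret normalised_shared_isos D \<phi> .
  have "\<phi> (g \<bullet> f) = \<phi> g \<star> \<phi> f"
    if "iso_arrow (HC D) f" "iso_arrow (HC D) g" "Tgt (HC D) f = Src (HC D) g" for f g
    using phi_cmp[of f "Src (HC D) f" "Src (HC D) g" g "Tgt (HC D) g"] that H.iso_ar[OF that(1)]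
      H.iso_ar[OF that(2)] by (simp add: in_hom)
  then have "category_isomorphism (max_subgroupoid (HC D)) (max_subgroupoid (VC D)) \<lparr>on_ob = (\<lambda>A. A), on_ar = \<phi>\<rparr>"
    unfolding category_isomorphism_iff[OF H.category V.category same_objects[symmetric]]
    using phi_bijection phi_ident by blast
  moreover have "shared_iso D (Src (HC D) f) (Tgt (HC D) f) (f, \<phi> f)" if "iso_arrow (HC D) f" for f
    using phi_shared[OF that in_hom_self[OF H.iso_ar[OF that]]] .
  ultimately show ?thesis
    using k c z a unfolding cgw_structure_def abstract_cgw_def by blast
qed

theorem proposition5p6:
  fixes D :: "('o, 'h, 'v, 's) double_cat"
  assumes "double_category D"
  shows "(\<exists>\<phi> k c. cgw_structure D \<phi> k c) \<longleftrightarrow> abstract_cgw D"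
proof
  assume "\<exists>\<phi> k c. cgw_structure D \<phi> k c"
  then obtain \<phi> k c where "cgw_structure D \<phi> k c" by blast
  with assms interpret cgw_category D \<phi> k c
    by unfold_locales
  show "abstract_cgw D"
    by (rule abstract)
qed (rule abstract_cgw_structure[OF assms])

end
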